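(* Double-ended eertrees can be implemented with worst-case time and space complexity $O(\log \sigma)$ per operation, where $\sigma$ is the size of the alphabet and $n$ is the length of the current string. More precisely: a $\texttt{push\_back}$ or $\texttt{push\_front}$ operation requires worst-case time and space complexity $O(\log \sigma)$, and a $\texttt{pop\_back}$ or $\texttt{pop\_front}$ operation requires worst-case time and space complexity $O(1)$.
   Context: Strings are over an alphabet $\Sigma$ of size $\sigma$. A palindrome is a string equal to its reverse (the empty string $\epsilon$ is a palindrome). The (minimal) eertree of a string $s$ is the following structure: it has one node for every distinct non-empty palindromic substring of $s$, plus two special root nodes $\mathsf{even}$ (representing $\epsilon$, length $0$) and $\mathsf{odd}$ (representing an imaginary string of length $-1$); for a node $v$ and character $c$, the edge $\operatorname{next}(v,c)$ points to the node representing $c\,\operatorname{str}(v)\,c$ if that palindrome occurs in $s$ (with the convention that $c\,\operatorname{str}(\mathsf{odd})\,c = c$), and is $\mathsf{null}$ otherwise; every node $v$ has a suffix link $\operatorname{link}(v)$ to the node of the longest proper palindromic suffix of $\operatorname{str}(v)$ (with $\operatorname{link}(\mathsf{even})=\operatorname{link}(\mathsf{odd})=\mathsf{odd}$). Each node stores the length of its palindrome. A double-ended eertree is a data structure storing a string $s$ (initially empty) together with access to the eertree of the current $s$, supporting the operations $\texttt{push\_back}(c)$: $s\gets sc$; $\texttt{push\_front}(c)$: $s\gets cs$; $\texttt{pop\_back}()$: remove the last character of non-empty $s$; $\texttt{pop\_front}()$: remove the first character of non-empty $s$. The computational model is the word RAM with constant cost per instruction (word size $\Omega(\log n)$). *)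

theory Defs
  imports
    Complex_Main
    "HOL-Library.Sublist"
    "HOL-Library.Landau_Symbols"
begin

section \<open>The eertree of a string\<close>

definition palindrome :: "'a list \<Rightarrow> bool" where
  "palindrome p \<longleftrightarrow> rev p = p"

text \<open>A node is identified with the palindrome that it represents; the imaginary string of
  length \<open>-1\<close> gets a constructor of its own.\<close>

datatype 'a node = Odd | Pal "'a list"

abbreviation Even :: "'a node" where
  "Even \<equiv> Pal []"

definition eertree_nodes :: "'a list \<Rightarrow> 'a node set" where
  "eertree_nodes s = {Odd, Even} \<union> {Pal p | p. p \<noteq> [] \<and> palindrome p \<and> sublist p s}"

fun node_len :: "'a node \<Rightarrow> int" where
  "node_len Odd = -1"
| "node_len (Pal p) = int (length p)"

fun surround :: "'a \<Rightarrow> 'a node \<Rightarrow> 'a list" where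
  "surround c Odd = [c]"
| "surround c (Pal p) = c # p @ [c]"

definition node_next :: "'a list \<Rightarrow> 'a node \<Rightarrow> 'a \<Rightarrow> 'a node option" where
  "node_next s v c =
     (if Pal (surround c v) \<in> eertree_nodes s then Some (Pal (surround c v)) else None)"

definition longest_proper_pal_suffix :: "'a list \<Rightarrow> 'a list" where
  "longest_proper_pal_suffix p = (ARG_MAX length q. strict_suffix q p \<and> palindrome q)"

fun node_link :: "'a node \<Rightarrow> 'a node" where
  "node_link Odd = Odd"
| "node_link (Pal p) = (if p = [] then Odd else Pal (longest_proper_pal_suffix p))"


section \<open>The word RAM\<close>

text \<open>Words of size \<open>w\<close> are the natural numbers below \<open>2 ^ w\<close>, and all arithmetic is modulo
  \<open>2 ^ w\<close>. Register and label operands are literals of the program, so that a program uses a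
  constant number of registers, whereas memory is addressed by register contents and hence
  consists of \<open>2 ^ w\<close> cells. Division by zero yields zero. Running off the end of the program
  halts the machine.\<close>

datatype alu_op = Add | Sub | Mul | Div | Mod | And | Or | Xor | Shl | Shr

datatype instr =
    Imm nat nat \<comment> \<open>\<open>Imm r k\<close>: \<open>r := k\<close>\<close>
  | Alu alu_op nat nat nat \<comment> \<open>\<open>Alu f r a b\<close>: \<open>r := f a b\<close>\<close>
  | Load nat nat \<comment> \<open>\<open>Load r a\<close>: \<open>r := memory[a]\<close>\<close>
  | Store nat nat \<comment> \<open>\<open>Store a r\<close>: \<open>memory[a] := r\<close>\<close>
  | Branch_Less nat nat nat \<comment> \<open>\<open>Branch_Less a b l\<close>: if \<open>a < b\<close> go to \<open>l\<close>\<close>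
  | Branch_Eq nat nat nat

type_synonym program = "instr list"

record ram =
  pc :: nat
  reg :: "nat \<Rightarrow> nat"
  mem :: "nat \<Rightarrow> nat"

fun alu :: "nat \<Rightarrow> alu_op \<Rightarrow> nat \<Rightarrow> nat \<Rightarrow> nat" where
  "alu w Add a b = (a + b) mod 2 ^ w"
| "alu w Sub a b = (a + 2 ^ w - b) mod 2 ^ w"
| "alu w Mul a b = (a * b) mod 2 ^ w"
| "alu w Div a b = a div b"
| "alu w Mod a b = a mod b"
| "alu w And a b = Bit_Operations.and a b"
| "alu w Or a b = Bit_Operations.or a b"
| "alu w Xor a b = Bit_Operations.xor a b"
| "alu w Shl a b = (a * 2 ^ b) mod 2 ^ w"
| "alu w Shr a b = a div 2 ^ b"

fun exec_instr :: "nat \<Rightarrow> instr \<Rightarrow> ram \<Rightarrow> ram" where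
  "exec_instr w (Imm r k) x =
     x\<lparr>pc := pc x + 1, reg := (reg x)(r := k mod 2 ^ w)\<rparr>"
| "exec_instr w (Alu f r a b) x =
     x\<lparr>pc := pc x + 1, reg := (reg x)(r := alu w f (reg x a) (reg x b))\<rparr>"
| "exec_instr w (Load r a) x =
     x\<lparr>pc := pc x + 1, reg := (reg x)(r := mem x (reg x a))\<rparr>"
| "exec_instr w (Store a r) x =
     x\<lparr>pc := pc x + 1, mem := (mem x)(reg x a := reg x r)\<rparr>"
| "exec_instr w (Branch_Less a b l) x =
     x\<lparr>pc := if reg x a < reg x b then l else pc x + 1\<rparr>"
| "exec_instr w (Branch_Eq a b l) x =
     x\<lparr>pc := if reg x a = reg x b then l else pc x + 1\<rparr>"

definition halted :: "program \<Rightarrow> ram \<Rightarrow> bool" where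
  "halted P x \<longleftrightarrow> length P \<le> pc x"

definition step :: "nat \<Rightarrow> program \<Rightarrow> ram \<Rightarrow> ram" where
  "step w P x = (if halted P x then x else exec_instr w (P ! pc x) x)"

fun instr_cells :: "instr \<Rightarrow> ram \<Rightarrow> nat set" where
  "instr_cells (Load r a) x = {reg x a}"
| "instr_cells (Store a r) x = {reg x a}"
| "instr_cells _ x = {}"

definition accessed :: "program \<Rightarrow> ram \<Rightarrow> nat set" where
  "accessed P x = (if halted P x then {} else instr_cells (P ! pc x) x)"

text \<open>Only the memory survives from one call to the next: a call starts with its arguments in
  the lowest registers and all other registers zero. It returns its result in register 0.\<close>

definition start :: "nat list \<Rightarrow> (nat \<Rightarrow> nat) \<Rightarrow> ram" where
  "start args m = \<lparr>pc = 0, reg = (\<lambda>i. if i < length args then args ! i else 0), mem = m\<rparr>"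

text \<open>Every instruction costs one unit of time. The space of a call is the number of memory cells
  that it accesses, which in particular bounds the number of newly allocated ones.\<close>

definition runs ::
  "nat \<Rightarrow> program \<Rightarrow> nat list \<Rightarrow> (nat \<Rightarrow> nat) \<Rightarrow> nat \<Rightarrow> nat \<Rightarrow> ram \<Rightarrow> bool" where
  "runs w P args m time space y \<longleftrightarrow>
     (let x = (\<lambda>i. (step w P ^^ i) (start args m)) in
        y = x time \<and> halted P y \<and> (\<forall>i<time. \<not> halted P (x i)) \<and>
        space = card (\<Union>i<time. accessed P (x i)))"

definition runs_within ::
  "nat \<Rightarrow> program \<Rightarrow> nat list \<Rightarrow> (nat \<Rightarrow> nat) \<Rightarrow> nat \<Rightarrow> nat \<Rightarrow> bool" where
  "runs_within w P args m T S \<longleftrightarrow>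
     (\<exists>time space y. runs w P args m time space y \<and> time \<le> T \<and> space \<le> S)"

definition answers ::
  "nat \<Rightarrow> program \<Rightarrow> nat list \<Rightarrow> (nat \<Rightarrow> nat) \<Rightarrow> nat \<Rightarrow> nat \<Rightarrow> nat \<Rightarrow> bool" where
  "answers w P args m T S r \<longleftrightarrow>
     (\<exists>time space y. runs w P args m time space y \<and> time \<le> T \<and> space \<le> S \<and>
        reg y 0 = r \<and> mem y = m)"


section \<open>Double-ended eertrees\<close>

text \<open>The alphabet of size \<open>\<sigma>\<close> is \<open>{0..<\<sigma>}\<close>.\<close>

datatype deque_op = Push_Back nat | Push_Front nat | Pop_Back | Pop_Front

fun apply_op :: "deque_op \<Rightarrow> nat list \<Rightarrow> nat list" where
  "apply_op (Push_Back c) s = s @ [c]"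
| "apply_op (Push_Front c) s = c # s"
| "apply_op Pop_Back s = butlast s"
| "apply_op Pop_Front s = tl s"

fun applicable :: "nat \<Rightarrow> deque_op \<Rightarrow> nat list \<Rightarrow> bool" where
  "applicable \<sigma> (Push_Back c) s \<longleftrightarrow> c < \<sigma>"
| "applicable \<sigma> (Push_Front c) s \<longleftrightarrow> c < \<sigma>"
| "applicable \<sigma> Pop_Back s \<longleftrightarrow> s \<noteq> []"
| "applicable \<sigma> Pop_Front s \<longleftrightarrow> s \<noteq> []"

record eertree_impl =
  init_code :: program
  push_back_code :: program
  push_front_code :: program
  pop_back_code :: program
  pop_front_code :: program
  even_code :: program
  odd_code :: program
  len_code :: program
  link_code :: program
  next_code :: program

fun op_code :: "eertree_impl \<Rightarrow> deque_op \<Rightarrow> program" where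
  "op_code D (Push_Back c) = push_back_code D"
| "op_code D (Push_Front c) = push_front_code D"
| "op_code D Pop_Back = pop_back_code D"
| "op_code D Pop_Front = pop_front_code D"

fun op_args :: "deque_op \<Rightarrow> nat list" where
  "op_args (Push_Back c) = [c]"
| "op_args (Push_Front c) = [c]"
| "op_args Pop_Back = []"
| "op_args Pop_Front = []"

text \<open>Word size \<open>\<Omega>(log n)\<close> with constant \<open>K\<close>; the summand 2 keeps the logarithm positive for the
  empty string.\<close>

definition word_size_ok :: "real \<Rightarrow> nat \<Rightarrow> nat \<Rightarrow> bool" where
  "word_size_ok K w n \<longleftrightarrow> K * log 2 (real n + 2) \<le> real w"

text \<open>\<open>reachable D K \<sigma> w s m\<close>: some sequence of operations, run by \<open>D\<close> on zeroed memory,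
  turns the empty string into \<open>s\<close> and leaves the memory \<open>m\<close>, and the word size suffices for
  every intermediate string.\<close>

inductive reachable ::
  "eertree_impl \<Rightarrow> real \<Rightarrow> nat \<Rightarrow> nat \<Rightarrow> nat list \<Rightarrow> (nat \<Rightarrow> nat) \<Rightarrow> bool"
  for D :: eertree_impl and K :: real and \<sigma> w :: nat where
  init: "\<lbrakk>word_size_ok K w 0; runs w (init_code D) [\<sigma>] (\<lambda>_. 0) time space y\<rbrakk>
    \<Longrightarrow> reachable D K \<sigma> w [] (mem y)"
| op: "\<lbrakk>reachable D K \<sigma> w s m; applicable \<sigma> f s; word_size_ok K w (length (apply_op f s));
    runs w (op_code D f) (op_args f) m time space y\<rbrakk>
    \<Longrightarrow> reachable D K \<sigma> w (apply_op f s) (mem y)"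

text \<open>Nodes are accessed through non-zero words \<open>h v\<close> (pointers), and the word 0 is \<open>null\<close>.
  Lengths are returned in two's complement because of the length \<open>-1\<close>. Everything takes constant
  time and space except for following an edge, which is subject to the bounds \<open>T\<close> and \<open>S\<close>.
  The queries leave the memory unchanged.\<close>

definition provides_eertree ::
  "eertree_impl \<Rightarrow> nat \<Rightarrow> nat \<Rightarrow> nat \<Rightarrow> nat \<Rightarrow> nat \<Rightarrow> nat list \<Rightarrow> (nat \<Rightarrow> nat) \<Rightarrow> bool" where
  "provides_eertree D \<sigma> w C T S s m \<longleftrightarrow>
     (\<exists>h. inj_on h (eertree_nodes s) \<and>
        (\<forall>v\<in>eertree_nodes s. 0 < h v \<and> h v < 2 ^ w) \<and>
        answers w (even_code D) [] m C C (h Even) \<and>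
        answers w (odd_code D) [] m C C (h Odd) \<and>
        (\<forall>v\<in>eertree_nodes s.
           answers w (len_code D) [h v] m C C (nat (node_len v mod 2 ^ w)) \<and>
           answers w (link_code D) [h v] m C C (h (node_link v)) \<and>
           (\<forall>c<\<sigma>. answers w (next_code D) [h v, c] m T S
              (case node_next s v c of None \<Rightarrow> 0 | Some u \<Rightarrow> h u))))"

end

theory Submission
  imports Defs
begin

text \<open>Call an occurrence of a palindrome in the string a surface if it is the longest palindrome
  that starts and the longest that ends at its place. The longest palindromic prefix and suffix are
  surfaces, a push creates one surface and destroys at most one, and a palindrome occurs exactly once
  if no node links to it and exactly one surface carries it. Hence it suffices to store the surfaces at
  their two ends, and to count for every node the surfaces that carry it and the nodes that link to it;
  a node is deleted as soon as this number becomes zero.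

  The centre of the palindrome created by a push of \<open>c\<close> is the longest palindromic suffix, or its
  longest proper palindromic suffix that is preceded by \<open>c\<close>. The latter is found by walking through
  the bits of \<open>c\<close>: node \<open>v\<close> stores for every \<open>i\<close> the nearest link ancestor whose letter before the
  link agrees with that of \<open>v\<close> in the bits below \<open>i\<close> and differs in bit \<open>i\<close>. This costs
  \<open>O(log \<sigma>)\<close> per node, and the row of a new node is filled during the walk that starts at its link.

  The word size \<open>100 log (n + 2)\<close> leaves an address space polynomial in the length, so edges are kept
  in one sparse table indexed by pairs of numbers \<open>O(n)\<close>. As the alphabet may be as large as the
  address space, letters are first renamed: each block of 16 letters that occurs in the string owns a
  small number.\<close>

text \<open>The obstacle is the constant time of a pop: whether the palindrome at the front occurs
  elsewhere, and whether another palindrome replaces it as a surface, must be decided locally. The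
  first is read from one reference counter, the second from one slot: a surface reappears exactly if
  the link is nonempty and no surface is stored at the place where the link starts as a suffix. A
  deletion erases one edge and leaves the other data of the node behind, so the invariants constrain
  live nodes only.

  The row of a node must serve every letter \<open>c\<close>. This works because a bit has only two
  values: from a node that differs from \<open>c\<close> at bit \<open>i\<close>, the walk goes on
  to the nearest ancestor that differs from this node there, whatever the higher bits of
  \<open>c\<close> are.

  The number 16 occurs twice for one reason. Sixteen arrays share \<open>2 ^ w\<close> cells, so an
  array has \<open>2 ^ (w - 4)\<close> entries. Letters may be as large as \<open>2 ^ w\<close> and
  cannot serve as indices, but the numbers \<open>c div 16\<close> can; hence the blocks of 16
  letters.\<close>

abbreviation lps :: "'a list \<Rightarrow> 'a list" where
  "lps \<equiv> longest_proper_pal_suffix"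

section \<open>Palindromes and their longest palindromic prefixes and suffixes\<close>

definition lpp :: "'a list \<Rightarrow> 'a list" where
  "lpp s = (ARG_MAX length q. prefix q s \<and> palindrome q)"

lemma palindrome_Nil [simp]: "palindrome []" and palindrome_single [simp]: "palindrome [c]"
  by (auto simp: palindrome_def)

lemma palindrome_surround [simp]: "palindrome (c # p @ [c]) \<longleftrightarrow> palindrome p"
  by (auto simp: palindrome_def)

lemma palindrome_ConsE:
  assumes "palindrome (c # p)"
  obtains "p = []" | q where "p = q @ [c]" "palindrome q"
proof (cases p rule: rev_cases)
  case Nil
  then show thesis by (rule that(1))
next
  case (snoc q a)
  have eq: "rev (c # q @ [a]) = c # q @ [a]"
    using assms unfolding palindrome_def snoc .
  have "a = c \<and> rev q = q"
    using arg_cong[OF eq, of hd] arg_cong[OF eq, of "\<lambda>x. butlast (tl x)"] by simp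
  with snoc show thesis by (intro that(2)[of q]) (auto simp: palindrome_def)
qed

text \<open>Reversal fixes both words and exchanges prefixes with suffixes. Links are therefore
  treated as prefixes below, which fits a push at the front.\<close>

lemma suffix_pal_iff: "palindrome p \<Longrightarrow> palindrome q \<Longrightarrow> suffix q p \<longleftrightarrow> prefix q p"
  by (simp add: suffix_to_prefix palindrome_def)

lemma strict_suffix_pal_iff: "palindrome p \<Longrightarrow> palindrome q \<Longrightarrow> strict_suffix q p \<longleftrightarrow> strict_prefix q p"
  by (simp add: strict_suffix_def strict_prefix_def suffix_pal_iff)

lemma lps_props:
  assumes "p \<noteq> []"
  shows strict_suffix_lps: "strict_suffix (lps p) p" and pal_lps: "palindrome (lps p)"
    and lps_max: "strict_suffix q p \<Longrightarrow> palindrome q \<Longrightarrow> length q \<le> length (lps p)"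
proof -
  let ?Q = "\<lambda>q. strict_suffix q p \<and> palindrome q"
  have 0: "?Q []" using assms by (auto simp: strict_suffix_def)
  have b: "\<forall>q. ?Q q \<longrightarrow> length q < Suc (length p)"
    by (auto simp: strict_suffix_def dest: suffix_length_le)
  have "?Q (arg_max length ?Q)" by (rule arg_max_natI[OF 0 b])
  then show "strict_suffix (lps p) p" "palindrome (lps p)"
    by (auto simp: longest_proper_pal_suffix_def)
  show "length q \<le> length (lps p)" if "strict_suffix q p" "palindrome q"
    using arg_max_nat_le[of ?Q q length] b that by (simp add: longest_proper_pal_suffix_def)
qed

lemma length_lps_less: "p \<noteq> [] \<Longrightarrow> length (lps p) < length p"
  using strict_suffix_lps[of p] by (simp add: suffix_length_less)

lemma lpp_props:
  shows prefix_lpp: "prefix (lpp s) s" and pal_lpp: "palindrome (lpp s)"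
    and lpp_max: "prefix q s \<Longrightarrow> palindrome q \<Longrightarrow> length q \<le> length (lpp s)"
proof -
  let ?Q = "\<lambda>q. prefix q s \<and> palindrome q"
  have 0: "?Q []" by auto
  have b: "\<forall>q. ?Q q \<longrightarrow> length q < Suc (length s)" by (auto dest: prefix_length_le)
  have "?Q (arg_max length ?Q)" by (rule arg_max_natI[OF 0 b])
  then show "prefix (lpp s) s" "palindrome (lpp s)" by (auto simp: lpp_def)
  show "length q \<le> length (lpp s)" if "prefix q s" "palindrome q"
    using arg_max_nat_le[of ?Q q length] b that by (simp add: lpp_def)
qed

lemma lpp_eqI:
  assumes "prefix q s" "palindrome q" "\<And>q'. prefix q' s \<Longrightarrow> palindrome q' \<Longrightarrow> length q' \<le> length q"
  shows "lpp s = q"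
proof -
  have "length (lpp s) = length q"
    using assms lpp_props by (metis le_antisym)
  with assms(1) prefix_lpp[of s] show ?thesis
    by (metis prefix_same_cases prefix_order.eq_iff prefix_length_prefix le_refl)
qed

lemma lpp_nonempty: "s \<noteq> [] \<Longrightarrow> lpp s \<noteq> []"
  using lpp_max[of "[hd s]" s] by (cases s) auto

lemma lps_prefix: "palindrome p \<Longrightarrow> p \<noteq> [] \<Longrightarrow> strict_prefix (lps p) p"
  using lps_props strict_suffix_pal_iff by blast

lemma lps_prefix_max:
  "palindrome p \<Longrightarrow> strict_prefix q p \<Longrightarrow> palindrome q \<Longrightarrow> length q \<le> length (lps p)"
  using lps_max strict_suffix_pal_iff by (metis strict_prefix_simps(1))

lemma lps_eqI:
  assumes "palindrome p" "strict_prefix q p" "palindrome q"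
    "\<And>q'. strict_prefix q' p \<Longrightarrow> palindrome q' \<Longrightarrow> length q' \<le> length q"
  shows "lps p = q"
proof -
  have "p \<noteq> []" using assms by auto
  then have l: "strict_prefix (lps p) p" "palindrome (lps p)"
    using assms lps_prefix pal_lps by blast+
  have "length (lps p) = length q"
    using assms l lps_prefix_max by (metis le_antisym)
  with assms(2) l show ?thesis
    by (metis prefix_length_prefix le_refl prefix_order.antisym prefix_order.less_imp_le)
qed

lemma lps_single [simp]: "lps [c] = []"
  using length_lps_less[of "[c]"] by auto

section \<open>Nodes\<close>

lemma Odd_in_nodes [simp]: "Odd \<in> eertree_nodes s" and Even_in_nodes [simp]: "Even \<in> eertree_nodes s"
  by (auto simp: eertree_nodes_def)

lemma Pal_in_nodes_iff: "Pal p \<in> eertree_nodes s \<longleftrightarrow> palindrome p \<and> sublist p s"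
  by (auto simp: eertree_nodes_def)

lemma Pal_sublist_in_nodes:
  "Pal p \<in> eertree_nodes s \<Longrightarrow> sublist q p \<Longrightarrow> palindrome q \<Longrightarrow> Pal q \<in> eertree_nodes s"
  by (meson Pal_in_nodes_iff sublist_order.order_trans)

lemma node_link_in_nodes: "v \<in> eertree_nodes s \<Longrightarrow> node_link v \<in> eertree_nodes s"
proof (cases v)
  case (Pal p)
  assume "v \<in> eertree_nodes s"
  with Pal show ?thesis
    using strict_suffix_lps[of p] pal_lps[of p]
    by (auto intro: Pal_sublist_in_nodes suffix_imp_sublist simp: strict_suffix_def)
qed simp

text \<open>A palindromic prefix shorter than the longest one is also a suffix of it, so it occurs a
  second time, further right, inside \<open>s\<close>. Only the longest one can be new.\<close>

lemma nodes_Cons: "eertree_nodes (c # s) = insert (Pal (lpp (c # s))) (eertree_nodes s)"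
proof -
  have 1: "sublist p s" if "prefix p (c # s)" "palindrome p" "p \<noteq> lpp (c # s)" for p
  proof -
    have "prefix p (lpp (c # s))"
      using that lpp_max[of p "c # s"] prefix_lpp[of "c # s"] prefix_length_prefix by blast
    then have "suffix p (lpp (c # s))" using suffix_pal_iff that pal_lpp by blast
    then have "strict_suffix p (lpp (c # s))" using that by (auto simp: strict_suffix_def)
    then obtain a b where "lpp (c # s) = a # b @ p"
      by (metis strict_suffix_def suffix_def append_Nil neq_Nil_conv append_Cons)
    moreover obtain r where "c # s = lpp (c # s) @ r" using prefix_lpp prefixE by blast
    ultimately have "s = b @ p @ r" by simp
    then show ?thesis by (auto simp: sublist_def)
  qed
  show ?thesis
    using lpp_props(1,2)[of "c # s"] lpp_nonempty[of "c # s"]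
    by (auto simp: eertree_nodes_def sublist_Cons_right intro: 1)
qed

lemma palindrome_rev [simp]: "palindrome (rev p) \<longleftrightarrow> palindrome p"
  by (metis palindrome_def rev_rev_ident)

text \<open>This reduces the back of the deque to the front of the reversed string.\<close>

lemma nodes_rev [simp]: "eertree_nodes (rev s) = eertree_nodes s"
proof -
  have "sublist p (rev s) \<longleftrightarrow> sublist p s" if "palindrome p" for p
    using that by (metis palindrome_def sublist_rev)
  then show ?thesis by (auto simp: eertree_nodes_def)
qed

lemma nodes_Nil: "eertree_nodes [] = {Odd, Even}"
  by (auto simp: eertree_nodes_def)

lemma finite_nodes [simp]: "finite (eertree_nodes s)"
  by (induction s) (auto simp: nodes_Nil nodes_Cons)

definition pals :: "'a list \<Rightarrow> 'a list set" where
  "pals s = {p. p \<noteq> [] \<and> palindrome p \<and> sublist p s}"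

lemma nodes_pals: "eertree_nodes s = {Odd, Even} \<union> Pal ` pals s"
  by (auto simp: eertree_nodes_def pals_def)

lemma pals_Cons: "pals (c # s) = insert (lpp (c # s)) (pals s)"
proof -
  have "p \<in> pals s \<longleftrightarrow> p \<noteq> [] \<and> Pal p \<in> eertree_nodes s" for p :: "'a list" and s
    by (auto simp: pals_def Pal_in_nodes_iff)
  then show ?thesis using lpp_nonempty[of "c # s"] by (auto simp: nodes_Cons)
qed

lemma pals_Nil [simp]: "pals [] = {}" by (auto simp: pals_def)

lemma finite_pals [simp]: "finite (pals s)"
  by (induction s) (auto simp: pals_Cons)

lemma pals_rev [simp]: "pals (rev s) = pals s"
proof -
  have "sublist p (rev s) \<longleftrightarrow> sublist p s" if "palindrome p" for p
    using that by (metis palindrome_def sublist_rev)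
  then show ?thesis by (auto simp: pals_def)
qed

text \<open>Each letter contributes at most one palindrome. This keeps node indices linear in the
  length, as the edge table requires.\<close>

lemma card_pals_le: "card (pals s) \<le> length s"
proof (induction s)
  case (Cons c s)
  then show ?case using card_insert_le_m1 by (simp add: pals_Cons card_insert_if)
qed simp

lemma surround_inj: "surround c u = surround c' u' \<Longrightarrow> c = c' \<and> u = u'"
  by (cases u; cases u') auto

lemma surround_in_pals:
  assumes "surround c u \<in> pals s"
  shows "u \<in> eertree_nodes s" "c \<in> set s"
proof -
  from assms have *: "palindrome (surround c u)" "sublist (surround c u) s"
    by (auto simp: pals_def)
  have "c \<in> set (surround c u)" by (cases u) auto
  with * show "c \<in> set s" by (meson set_mono_sublist subsetD)
  show "u \<in> eertree_nodes s"
  proof (cases u)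
    case (Pal p)
    have "sublist p (surround c u)" using Pal by (auto simp: sublist_def intro: exI[of _ "[c]"])
    with * Pal show ?thesis
      by (auto simp: Pal_in_nodes_iff intro: sublist_order.order_trans)
  qed simp
qed

section \<open>Direct links\<close>

text \<open>The label 0 of the roots may equal a letter. This is harmless: a search that stops at a root
  returns its link, which is the odd root.\<close>

fun lab :: "nat node \<Rightarrow> nat" where
  "lab Odd = 0"
| "lab (Pal p) = (if p = [] then 0 else p ! length (lps p))"

text \<open>The predicate is left open because the search for one letter goes through a sequence of
  weaker predicates that test only its low bits.\<close>

function first_anc :: "(nat \<Rightarrow> bool) \<Rightarrow> nat node \<Rightarrow> nat node" where
  "first_anc Q v = (if v = Odd \<or> Q (lab v) then v else first_anc Q (node_link v))"
  by auto
termination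
  apply (relation "measure (\<lambda>(Q, v). nat (node_len v + 1))")
   apply simp
  subgoal for Q v using length_lps_less by (cases v) (force split: if_splits)+
  done

declare first_anc.simps [simp del]

lemma first_anc_Odd [simp]: "first_anc Q Odd = Odd"
  by (simp add: first_anc.simps)

lemma first_anc_in_nodes: "v \<in> eertree_nodes s \<Longrightarrow> first_anc Q v \<in> eertree_nodes s"
proof (induction Q v rule: first_anc.induct)
  case (1 Q v)
  then show ?case
    by (subst first_anc.simps) (auto intro: node_link_in_nodes)
qed

text \<open>The nodes skipped under the weaker condition violate the stronger one as well, so a
  search can be refined in stages, each resuming where the previous one stopped.\<close>

lemma first_anc_mono:
  assumes "\<And>x. Q' x \<Longrightarrow> Q x"
  shows "first_anc Q' v = first_anc Q' (first_anc Q v)"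
  using assms
proof (induction Q v rule: first_anc.induct)
  case (1 Q v)
  show ?case
  proof (cases "v = Odd \<or> Q (lab v)")
    case False
    then have "first_anc Q' v = first_anc Q' (node_link v)"
      using first_anc.simps[of Q' v] 1(2)[of "lab v"] by auto
    moreover have "first_anc Q v = first_anc Q (node_link v)"
      using False first_anc.simps[of Q v] by auto
    ultimately show ?thesis using 1(1)[OF False 1(2)] by simp
  next
    case True
    then have "first_anc Q v = v" by (subst first_anc.simps) simp
    then show ?thesis by simp
  qed
qed

text \<open>The direct link: the longest proper palindromic suffix of \<open>v\<close> that is
  preceded by \<open>c\<close>, or \<open>Odd\<close>. The label of a node is the letter in front of
  its link, so the suffix wanted is the link of the ancestor found.\<close>

definition dlink :: "nat \<Rightarrow> nat node \<Rightarrow> nat node" where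
  "dlink c v = node_link (first_anc (\<lambda>x. x = c) v)"

lemma dlink_Odd [simp]: "dlink c Odd = Odd" by (simp add: dlink_def)
lemma dlink_Even [simp]: "dlink c Even = Odd"
  by (simp add: dlink_def first_anc.simps[of _ Even])

lemma dlink_rec:
  "p \<noteq> [] \<Longrightarrow> dlink c (Pal p) = (if p ! length (lps p) = c then Pal (lps p) else dlink c (Pal (lps p)))"
  by (simp add: dlink_def first_anc.simps[of _ "Pal p"])

lemma strict_prefix_nth: "strict_prefix q p \<Longrightarrow> i < length q \<Longrightarrow> p ! i = q ! i"
  by (auto simp: strict_prefix_def prefix_def nth_append)

text \<open>Iterated, this says that the link chain runs through all proper palindromic
  prefixes.\<close>

lemma strict_prefix_via_lps:
  assumes "palindrome p" "strict_prefix q p" "palindrome q"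
  shows "q = lps p \<or> strict_prefix q (lps p)"
proof -
  have "p \<noteq> []" using assms by auto
  then have "strict_prefix (lps p) p" "length q \<le> length (lps p)"
    using assms lps_prefix lps_prefix_max by blast+
  with assms(2) show ?thesis
    by (metis prefix_length_prefix prefix_order.less_le prefix_order.le_less)
qed

text \<open>Induction along the link chain. For a palindromic prefix \<open>q\<close> shorter than
  the link, \<open>p\<close> and its link have the same letter behind \<open>q\<close>, so the
  condition passes on to the link.\<close>

lemma dlink_cases:
  assumes "palindrome p"
  obtains (none) "dlink c (Pal p) = Odd"
      "\<And>q. strict_prefix q p \<Longrightarrow> palindrome q \<Longrightarrow> p ! length q \<noteq> c"
    | (some) q where "dlink c (Pal p) = Pal q" "strict_prefix q p" "palindrome q" "p ! length q = c"
      "\<And>q'. strict_prefix q' p \<Longrightarrow> palindrome q' \<Longrightarrow> p ! length q' = c \<Longrightarrow> length q' \<le> length q"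
proof -
  have "(dlink c (Pal p) = Odd \<and> (\<forall>q. strict_prefix q p \<and> palindrome q \<longrightarrow> p ! length q \<noteq> c)) \<or>
    (\<exists>q. dlink c (Pal p) = Pal q \<and> strict_prefix q p \<and> palindrome q \<and> p ! length q = c \<and>
      (\<forall>q'. strict_prefix q' p \<and> palindrome q' \<and> p ! length q' = c \<longrightarrow> length q' \<le> length q))"
    using assms
  proof (induction "length p" arbitrary: p rule: less_induct)
    case less
    show ?case
    proof (cases "p = []")
      case False
      note l = lps_prefix[OF less.prems False] pal_lps[OF False]
      show ?thesis
      proof (cases "p ! length (lps p) = c")
        case True
        then show ?thesis using l False lps_prefix_max[OF less.prems] by (auto simp: dlink_rec)
      next
        case F: False
        have eq: "dlink c (Pal p) = dlink c (Pal (lps p))" using F False by (simp add: dlink_rec)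
        have iff: "strict_prefix q p \<and> palindrome q \<and> p ! length q = c \<longleftrightarrow>
            strict_prefix q (lps p) \<and> palindrome q \<and> lps p ! length q = c" for q
          using strict_prefix_via_lps[OF less.prems, of q] l F
            strict_prefix_nth[OF l(1), of "length q"]
          by (metis prefix_length_less prefix_order.less_trans)
        show ?thesis
          using less.hyps[OF length_lps_less[OF False] l(2)] unfolding eq using iff by metis
      qed
    qed auto
  qed
  with none some show thesis by metis
qed

text \<open>The empty string is given \<open>Odd\<close>: its first push must produce a single
  letter, and a slot of zeroed memory reads as the index of \<open>Odd\<close>.\<close>

definition lpn :: "'a list \<Rightarrow> 'a node" where
  "lpn s = (if s = [] then Odd else Pal (lpp s))"

text \<open>Indexing \<open>c # s\<close> instead of \<open>s\<close> covers the odd root: the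
  letter behind a prefix of length \<open>k\<close> has index \<open>k + 1\<close>, and for
  \<open>k = -1\<close> this is \<open>c\<close> itself.\<close>

definition center :: "nat \<Rightarrow> nat list \<Rightarrow> nat node" where
  "center c s = (if node_len (lpn s) + 1 \<le> int (length s) \<and> (c # s) ! nat (node_len (lpn s) + 1) = c
     then lpn s else dlink c (lpn s))"

lemma lpn_in_nodes: "lpn s \<in> eertree_nodes s"
  using prefix_lpp pal_lpp by (auto simp: lpn_def Pal_in_nodes_iff intro: prefix_imp_sublist)

lemma prefix_snoc_iff: "prefix (q @ [c]) s \<longleftrightarrow> prefix q s \<and> length q < length s \<and> s ! length q = c"
proof
  assume "prefix (q @ [c]) s" then show "prefix q s \<and> length q < length s \<and> s ! length q = c"
    by (auto simp: prefix_def)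
next
  assume "prefix q s \<and> length q < length s \<and> s ! length q = c"
  then obtain r where "s = q @ r" "length r > 0" "s ! length q = c" by (auto simp: prefix_def)
  then show "prefix (q @ [c]) s" by (cases r) (auto simp: prefix_def)
qed

lemma pal_prefix_Cons_iff:
  "prefix t (c # s) \<and> palindrome t \<longleftrightarrow>
   t = [] \<or> t = [c] \<or> (\<exists>q. t = c # q @ [c] \<and> palindrome q \<and> prefix q s \<and> length q < length s \<and> s ! length q = c)"
  (is "?L \<longleftrightarrow> ?R")
proof
  assume L: ?L
  then consider "t = []" | r where "t = c # r" by (cases t) auto
  then show ?R
  proof cases
    case 2
    from L have "palindrome (c # r)" using 2 by simp
    then show ?thesis
      by (cases rule: palindrome_ConsE) (use L 2 in \<open>auto simp: prefix_snoc_iff\<close>)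
  qed simp
next
  assume ?R then show ?L by (auto simp: prefix_snoc_iff)
qed

text \<open>Apart from \<open>[]\<close> and \<open>[c]\<close>, a palindromic prefix of
  \<open>c # s\<close> is \<open>c # q @ [c]\<close> with \<open>q\<close> a palindromic prefix of
  \<open>s\<close> followed by \<open>c\<close>. Such a \<open>q\<close> is \<open>lpp s\<close>
  itself or a proper palindromic prefix of it, and the longest of the latter is the direct
  link.\<close>

lemma lpp_Cons: "lpp (c # s) = surround c (center c s)"
proof (cases "s = []")
  case True
  have "lpp [c] = [c]" using lpp_nonempty[of "[c]"] prefix_lpp[of "[c]"] by (auto simp: prefix_Cons)
  with True show ?thesis by (simp add: center_def lpn_def)
next
  case False
  let ?v = "lpp s"
  have v: "prefix ?v s" "palindrome ?v" using lpp_props by auto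
  have sp: "q = ?v \<or> strict_prefix q ?v" if "prefix q s" "palindrome q" for q
    using that v lpp_max[of q s] by (metis prefix_length_prefix prefix_order.le_less)
  show ?thesis
  proof (cases "length ?v < length s \<and> s ! length ?v = c")
    case True
    then have "center c s = Pal ?v" using False by (auto simp: center_def lpn_def nat_add_distrib)
    then show ?thesis
      using v True
      by (intro lpp_eqI)
        (use lpp_max in \<open>auto simp: pal_prefix_Cons_iff[THEN iffD1] prefix_snoc_iff dest!: conjI[THEN pal_prefix_Cons_iff[THEN iffD1]]\<close>)
  next
    case F: False
    then have c: "center c s = dlink c (Pal ?v)"
      using False by (auto simp: center_def lpn_def nat_add_distrib)
    have red: "strict_prefix q ?v \<and> ?v ! length q = c"
      if "palindrome q" "prefix q s" "length q < length s" "s ! length q = c" for q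
    proof -
      have "strict_prefix q ?v" using sp[of q] that F by auto
      moreover have "s ! length q = ?v ! length q"
        using v(1) prefix_length_less[OF \<open>strict_prefix q ?v\<close>] by (metis nth_append prefix_def)
      ultimately show ?thesis using that by simp
    qed
    from v(2) show ?thesis
    proof (cases rule: dlink_cases[where c = c])
      case none
      have "lpp (c # s) = [c]"
        by (rule lpp_eqI) (use red none(2) in \<open>auto dest!: conjI[THEN pal_prefix_Cons_iff[THEN iffD1]]\<close>)
      then show ?thesis using c none(1) by simp
    next
      case (some q)
      have "length q < length ?v" using some(2) prefix_length_less by blast
      then have "prefix (q @ [c]) ?v"
        using some by (auto simp: prefix_snoc_iff strict_prefix_def)
      then have "prefix (q @ [c]) s" using v(1) by (rule prefix_order.trans)
      then have "lpp (c # s) = c # q @ [c]"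
        by (intro lpp_eqI) (use red some in \<open>auto dest!: conjI[THEN pal_prefix_Cons_iff[THEN iffD1]]\<close>)
      then show ?thesis using c some(1) by simp
    qed
  qed
qed

lemma center_in_nodes: "center c s \<in> eertree_nodes s"
  using first_anc_in_nodes[OF lpn_in_nodes, of _ s] node_link_in_nodes lpn_in_nodes[of s]
  by (auto simp: center_def dlink_def)

text \<open>The link of a new node results from the same search, started at its centre. A centre
  \<open>Odd\<close> is different: the new palindrome is a single letter and its link is
  \<open>Even\<close>.\<close>

lemma lps_surround:
  assumes "palindrome p"
  shows "lps (surround c (Pal p)) = surround c (dlink c (Pal p))"
proof -
  have cs: "t = [] \<or> t = [c] \<or> (\<exists>q. t = c # q @ [c] \<and> palindrome q \<and> strict_prefix q p \<and> p ! length q = c)"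
    if "strict_prefix t (c # p @ [c])" "palindrome t" for t
  proof -
    consider "t = []" | "t = [c]" | q where "t = c # q @ [c]" "palindrome q" "prefix (q @ [c]) (p @ [c])"
    proof (atomize_elim)
      have "prefix t (c # p @ [c])" using \<open>strict_prefix t (c # p @ [c])\<close> by (simp add: strict_prefix_def)
      with \<open>palindrome t\<close> have "t = [] \<or> t = [c] \<or> (\<exists>q. t = c # q @ [c] \<and> palindrome q \<and> prefix (q @ [c]) (p @ [c]))"
        using pal_prefix_Cons_iff[of t c "p @ [c]"] unfolding prefix_snoc_iff[of _ c "p @ [c]"] by blast
      then show "t = [] \<or> t = [c] \<or> (\<exists>q. t = c # q @ [c] \<and> palindrome q \<and> prefix (q @ [c]) (p @ [c]))" .
    qed
    then show ?thesis
    proof cases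
      case (3 q)
      with that have "q \<noteq> p" "prefix (q @ [c]) p" by (auto simp: strict_prefix_def)
      then show ?thesis using 3 by (auto simp: prefix_snoc_iff strict_prefix_def)
    qed auto
  qed
  have pp: "palindrome (c # p @ [c])" using assms by simp
  from assms show ?thesis
  proof (cases rule: dlink_cases[where c = c])
    case none
    have "lps (c # p @ [c]) = [c]"
    proof (rule lps_eqI[OF pp])
      show "strict_prefix [c] (c # p @ [c])" by (simp add: strict_prefix_def)
      show "length q' \<le> length [c]" if "strict_prefix q' (c # p @ [c])" "palindrome q'" for q'
        using cs[OF that] none(2) by auto
    qed simp
    then show ?thesis using none(1) by simp
  next
    case (some q)
    have "prefix (q @ [c]) p"
      using some by (auto simp: prefix_snoc_iff prefix_length_less strict_prefix_def)
    then have "strict_prefix (c # q @ [c]) (c # p @ [c])"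
      by (auto simp: strict_prefix_def prefix_def)
    then have "lps (c # p @ [c]) = c # q @ [c]"
    proof (rule lps_eqI[OF pp])
      show "palindrome (c # q @ [c])" using some by simp
      show "length q' \<le> length (c # q @ [c])" if "strict_prefix q' (c # p @ [c])" "palindrome q'" for q'
        using cs[OF that] some(5) by auto
    qed
    then show ?thesis using some(1) by simp
  qed
qed

section \<open>Surfaces\<close>

definition factor :: "'a list \<Rightarrow> nat \<Rightarrow> nat \<Rightarrow> 'a list" where
  "factor s i j = take (j - i) (drop i s)"

definition pal_at :: "'a list \<Rightarrow> nat \<Rightarrow> nat \<Rightarrow> bool" where
  "pal_at s i j \<longleftrightarrow> i < j \<and> j \<le> length s \<and> palindrome (factor s i j)"

definition surfaces :: "'a list \<Rightarrow> (nat \<times> nat) set" where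
  "surfaces s = {(i, j). pal_at s i j \<and> (\<forall>j'. pal_at s i j' \<longrightarrow> j' \<le> j) \<and> (\<forall>i'. pal_at s i' j \<longrightarrow> i \<le> i')}"

lemma length_factor [simp]: "j \<le> length s \<Longrightarrow> length (factor s i j) = j - i"
  by (simp add: factor_def)

lemma nth_factor: "j \<le> length s \<Longrightarrow> t < j - i \<Longrightarrow> factor s i j ! t = s ! (i + t)"
  by (simp add: factor_def)

lemma factor_Cons [simp]: "factor (c # s) (Suc i) (Suc j) = factor s i j"
  by (simp add: factor_def)

lemma pal_at_Cons [simp]: "pal_at (c # s) (Suc i) (Suc j) \<longleftrightarrow> pal_at s i j"
  by (simp add: pal_at_def)

text \<open>Symmetry in absolute positions, so that reflections can be composed by arithmetic on
  indices.\<close>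

lemma pal_at_nth:
  "pal_at s i j \<longleftrightarrow> i < j \<and> j \<le> length s \<and> (\<forall>t. i \<le> t \<and> t < j \<longrightarrow> s ! t = s ! (i + j - 1 - t))"
proof (cases "i < j \<and> j \<le> length s")
  case True
  have "palindrome (factor s i j) \<longleftrightarrow> (\<forall>t<j - i. s ! (i + (j - i - Suc t)) = s ! (i + t))"
    using True by (simp add: palindrome_def list_eq_iff_nth_eq rev_nth nth_factor del: diff_Suc_eq_diff_pred)
  also have "\<dots> \<longleftrightarrow> (\<forall>t. i \<le> t \<and> t < j \<longrightarrow> s ! t = s ! (i + j - 1 - t))"
  proof safe
    fix t assume *: "\<forall>t<j - i. s ! (i + (j - i - Suc t)) = s ! (i + t)" "i \<le> t" "t < j"
    then have "t - i < j - i" by auto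
    with * have "s ! (i + (j - i - Suc (t - i))) = s ! (i + (t - i))" by blast
    moreover have "i + (j - i - Suc (t - i)) = i + j - 1 - t" "i + (t - i) = t" using * by auto
    ultimately show "s ! t = s ! (i + j - 1 - t)" by simp
  next
    fix t assume *: "\<forall>t. i \<le> t \<and> t < j \<longrightarrow> s ! t = s ! (i + j - 1 - t)" "t < j - i"
    from *(2) have "i \<le> i + t \<and> i + t < j" by simp
    with *(1) have "s ! (i + t) = s ! (i + j - 1 - (i + t))" by blast
    moreover have "i + j - 1 - (i + t) = i + (j - i - Suc t)" using *(2) by simp
    ultimately show "s ! (i + (j - i - Suc t)) = s ! (i + t)" by simp
  qed
  finally show ?thesis using True by (simp add: pal_at_def)
qed (auto simp: pal_at_def)

lemma factor_rev:
  "i \<le> j \<Longrightarrow> j \<le> length s \<Longrightarrow> factor (rev s) (length s - j) (length s - i) = rev (factor s i j)"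
  by (intro nth_equalityI) (auto simp: rev_nth nth_factor intro!: arg_cong[of _ _ "(!) s"])

lemma pal_at_rev:
  assumes "j \<le> length s"
  shows "pal_at (rev s) (length s - j) (length s - i) \<longleftrightarrow> pal_at s i j"
proof (cases "i < j")
  case True
  with assms show ?thesis by (auto simp: pal_at_def factor_rev)
next
  case False
  with assms show ?thesis by (auto simp: pal_at_def)
qed

text \<open>Two palindromes with a common end force a period; the centres of symmetry of the periodic
  part lie so densely that one of them reflects any position inside to a start in between.\<close>

lemma pal_at_between:
  assumes "pal_at s b f" "pal_at s b' f" "b' < b" "b < e" "e < f"
  obtains b'' where "b' \<le> b''" "b'' < b" "pal_at s b'' e"
proof -
  define q where "q = b - b'"
  have q: "q > 0" "b = b' + q" using assms(3) by (auto simp: q_def)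
  have len: "f \<le> length s" "b < f" using assms by (auto simp: pal_at_def)
  have r1: "s ! t = s ! (b + f - 1 - t)" if "b \<le> t" "t < f" for t
    using assms(1) that by (auto simp: pal_at_nth)
  have r2: "s ! t = s ! (b' + f - 1 - t)" if "b' \<le> t" "t < f" for t
    using assms(2) that by (auto simp: pal_at_nth)
  \<comment> \<open>Reflecting first in the one palindrome and then in the other is a translation by
    \<open>q\<close>, hence a period.\<close>
  have per1: "s ! (x + q) = s ! x" if "b' \<le> x" "x + q < f" for x
  proof -
    have "s ! (x + q) = s ! (b + f - 1 - (x + q))" using that q by (intro r1) auto
    also have "b + f - 1 - (x + q) = b' + f - 1 - x" using q by simp
    also have "s ! \<dots> = s ! x" using that q by (intro r2[symmetric]) auto
    finally show ?thesis .
  qed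
  have per: "s ! (x + k * q) = s ! x" if "b' \<le> x" "x + k * q < f" for x k
    using that
  proof (induction k)
    case (Suc k)
    have "s ! (x + k * q + q) = s ! (x + k * q)"
      using Suc.prems by (intro per1) (auto simp: algebra_simps)
    then show ?case using Suc by (simp add: algebra_simps)
  qed simp
  \<comment> \<open>The longer palindrome reflects \<open>t\<close> to
    \<open>b' + f - 1 - t\<close>. Subtracting \<open>k\<close> periods gives the reflection of the
    interval from \<open>b''\<close> to \<open>e\<close>, and the remainder modulo \<open>q\<close>
    puts \<open>b''\<close> between \<open>b'\<close> and \<open>b\<close>.\<close>
  define k where "k = (f - e) div q"
  define b'' where "b'' = b' + (f - e) mod q"
  have fe: "f - e = (f - e) mod q + k * q" unfolding k_def by (rule mod_div_mult_eq[symmetric])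
  then have sum: "b' + f = b'' + e + k * q" using assms by (simp add: b''_def)
  have b'': "b' \<le> b''" "b'' < b" using q by (auto simp: b''_def)
  have "s ! t = s ! (b'' + e - 1 - t)" if "b'' \<le> t" "t < e" for t
  proof -
    have "s ! t = s ! (b' + f - 1 - t)" using that b'' assms by (intro r2) auto
    also have "b' + f - 1 - t = (b'' + e - 1 - t) + k * q" using that sum assms by linarith
    also have "s ! \<dots> = s ! (b'' + e - 1 - t)"
      using that sum b'' assms by (intro per) auto
    finally show ?thesis .
  qed
  then have "pal_at s b'' e" using b'' assms len by (auto simp: pal_at_nth)
  with b'' that show thesis by blast
qed

text \<open>The mirror image, for palindromes with a common start.\<close>

lemma pal_at_between':
  assumes "pal_at s a b" "pal_at s a b'" "b < b'" "a < i" "i < b"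
  obtains e where "b < e" "e \<le> b'" "pal_at s i e"
proof -
  let ?n = "length s"
  have l: "b \<le> ?n" "b' \<le> ?n" using assms by (auto simp: pal_at_def)
  have 1: "pal_at (rev s) (?n - b) (?n - a)" "pal_at (rev s) (?n - b') (?n - a)"
    using assms l by (simp_all add: pal_at_rev)
  obtain c where c: "?n - b' \<le> c" "c < ?n - b" "pal_at (rev s) c (?n - i)"
    by (rule pal_at_between[OF 1, of "?n - i"]) (use assms l in auto)
  have "pal_at s i (?n - c)"
    using c pal_at_rev[of "?n - c" s i] l by simp
  then show thesis using c l that[of "?n - c"] by simp
qed

text \<open>Since a surface is determined by its start, and likewise by its end, one slot per
  position and side can hold it.\<close>

lemma surfaces_fst_inj: "(i, j) \<in> surfaces s \<Longrightarrow> (i, j') \<in> surfaces s \<Longrightarrow> j = j'"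
  unfolding surfaces_def by (auto intro: le_antisym)

lemma surfaces_snd_inj: "(i, j) \<in> surfaces s \<Longrightarrow> (i', j) \<in> surfaces s \<Longrightarrow> i = i'"
  unfolding surfaces_def by (auto intro: le_antisym)

lemma surfacesD: "(i, j) \<in> surfaces s \<Longrightarrow> i < j \<and> j \<le> length s \<and> palindrome (factor s i j)"
  by (auto simp: surfaces_def pal_at_def)

lemma surfaces_rev: "surfaces (rev s) = (\<lambda>(i, j). (length s - j, length s - i)) ` surfaces s"
proof -
  have *: "(length s - j, length s - i) \<in> surfaces (rev s)" if ij: "(i, j) \<in> surfaces s" for i j and s :: "'a list"
  proof -
    have "i < j" "j \<le> length s" using surfacesD[OF ij] by auto
    moreover have "j' \<le> length s - i" if "pal_at (rev s) (length s - j) j'" for j'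
    proof -
      have "j' \<le> length s" using that unfolding pal_at_def by simp
      then have "pal_at s (length s - j') j"
        using that pal_at_rev[of j s "length s - j'"] \<open>j \<le> _\<close> by simp
      then show ?thesis using ij \<open>j' \<le> _\<close> by (auto simp: surfaces_def)
    qed
    moreover have "length s - j \<le> i'" if "pal_at (rev s) i' (length s - i)" for i'
    proof -
      have "i' \<le> length s" using that unfolding pal_at_def by linarith
      then have "pal_at s i (length s - i')"
        using that pal_at_rev[of "length s - i'" s i] by simp
      then show ?thesis using ij \<open>i' \<le> _\<close> by (auto simp: surfaces_def)
    qed
    ultimately show ?thesis using ij by (auto simp: surfaces_def pal_at_rev)
  qed
  show ?thesis
  proof (intro set_eqI iffI)
    fix x assume "x \<in> surfaces (rev s)"
    then obtain i j where x: "x = (i, j)" "(i, j) \<in> surfaces (rev s)" by (cases x) auto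
    have "i < j" "j \<le> length s" using surfacesD[OF x(2)] by auto
    then show "x \<in> (\<lambda>(i, j). (length s - j, length s - i)) ` surfaces s"
      using *[OF x(2)] x(1) by (force intro!: image_eqI[of _ _ "(length s - j, length s - i)"])
  qed (use * in auto)
qed

lemma finite_surfaces [simp]: "finite (surfaces s)"
  by (rule finite_subset[of _ "{..length s} \<times> {..length s}"]) (auto dest: surfacesD)

lemma factor_prefix: "factor s 0 j = take j s"
  by (simp add: factor_def)

lemma pal_at_0: "pal_at s 0 j \<longleftrightarrow> 0 < j \<and> j \<le> length s \<and> palindrome (take j s)"
  by (simp add: pal_at_def factor_prefix)

lemma take_lpp: "take (length (lpp s)) s = lpp s"
proof -
  obtain r where "s = lpp s @ r" using prefix_lpp prefixE by blast
  then show ?thesis by (metis append_eq_conv_conj)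
qed

lemma pal_at_lpp: "pal_at (c # s) 0 (length (lpp (c # s)))"
  using lpp_nonempty[of "c # s"] pal_lpp[of "c # s"] prefix_lpp[of "c # s"]
  by (auto simp: pal_at_0 take_lpp dest: prefix_length_le)

lemma pal_at_0_le: "pal_at s 0 j \<Longrightarrow> j \<le> length (lpp s)"
  using lpp_max[of "take j s" s] by (auto simp: pal_at_0 take_is_prefix)

text \<open>Only the surface that ends where the new prefix ends can be lost. One with an earlier
  end survives: if a shorter palindromic prefix had the same end, \<open>pal_at_between'\<close>,
  applied to this prefix and the longest one, would give a longer palindrome at the start of the
  surface.\<close>

lemma surfaces_Cons:
  "surfaces (c # s) = insert (0, length (lpp (c # s)))
     {(Suc i, Suc j) | i j. (i, j) \<in> surfaces s \<and> Suc j \<noteq> length (lpp (c # s))}"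
  (is "_ = insert (0, ?L) ?S")
proof -
  note L = pal_at_lpp[of c s]
  have pos: "0 < j" if "pal_at s i j" for i j and s :: "'a list"
    using that by (simp add: pal_at_def)
  have "(0, j) \<in> surfaces (c # s) \<longleftrightarrow> j = ?L" for j
    using L pal_at_0_le[of "c # s"] by (auto simp: surfaces_def intro: le_antisym)
  moreover have "(Suc i, j) \<in> surfaces (c # s) \<longleftrightarrow> (Suc i, j) \<in> ?S" for i j
  proof (cases j)
    case (Suc j')
    show ?thesis
    proof
      assume *: "(Suc i, j) \<in> surfaces (c # s)"
      then have "Suc j' \<noteq> ?L" using L unfolding surfaces_def Suc by fastforce
      moreover have "(i, j') \<in> surfaces s"
        unfolding surfaces_def mem_Collect_eq case_prod_conv
      proof (intro conjI allI impI)
        show "pal_at s i j'" using * by (simp add: surfaces_def Suc)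
        show "k \<le> j'" if "pal_at s i k" for k
        proof -
          have "pal_at (c # s) (Suc i) (Suc k)" using that by simp
          then have "Suc k \<le> Suc j'" using * unfolding surfaces_def Suc by blast
          then show ?thesis by simp
        qed
        show "i \<le> k" if "pal_at s k j'" for k
        proof -
          have "pal_at (c # s) (Suc k) (Suc j')" using that by simp
          then have "Suc i \<le> Suc k" using * unfolding surfaces_def Suc by blast
          then show ?thesis by simp
        qed
      qed
      ultimately show "(Suc i, j) \<in> ?S" using Suc by blast
    next
      assume "(Suc i, j) \<in> ?S"
      then have s: "(i, j') \<in> surfaces s" "Suc j' \<noteq> ?L" using Suc by auto
      have "pal_at (c # s) (Suc i) j" using s Suc by (auto simp: surfaces_def)
      moreover have max: "k \<le> j" if "pal_at (c # s) (Suc i) k" for k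
        using that s Suc by (cases k) (auto simp: surfaces_def dest: pos)
      moreover have "Suc i \<le> k" if k: "pal_at (c # s) k j" for k
      proof (cases k)
        case 0
        then have "j \<le> ?L" using k pal_at_0_le by blast
        then have "j < ?L" using s Suc by auto
        moreover have "Suc i < j" using s Suc by (auto dest: surfacesD)
        ultimately obtain e where "j < e" "pal_at (c # s) (Suc i) e"
          using pal_at_between'[of "c # s" 0 j ?L "Suc i"] k 0 L by auto
        then show ?thesis using max by fastforce
      next
        case (Suc k')
        then show ?thesis using k s \<open>j = Suc j'\<close> by (auto simp: surfaces_def)
      qed
      ultimately show "(Suc i, j) \<in> surfaces (c # s)" by (auto simp: surfaces_def)
    qed
  qed (auto dest: surfacesD)
  ultimately have "(i, j) \<in> surfaces (c # s) \<longleftrightarrow> (i, j) = (0, ?L) \<or> (i, j) \<in> ?S" for i j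
    by (cases i) auto
  then show ?thesis by auto
qed

lemma surfaces_Nil [simp]: "surfaces [] = {}"
  by (auto dest: surfacesD)

lemma card_surfaces_le: "card (surfaces s) \<le> length s"
proof -
  have "card (surfaces s) = card (fst ` surfaces s)"
    by (rule card_image[symmetric]) (auto simp: inj_on_def dest: surfaces_fst_inj)
  also have "\<dots> \<le> card {..<length s}" by (rule card_mono) (auto dest: surfacesD)
  finally show ?thesis by simp
qed

text \<open>Pushing a letter buries at most one surface, which is then the longest proper palindromic
  suffix of the new longest palindromic prefix.\<close>

definition buried :: "'a \<Rightarrow> 'a list \<Rightarrow> bool" where
  "buried c s \<longleftrightarrow> (\<exists>i j. (i, j) \<in> surfaces s \<and> Suc j = length (lpp (c # s)))"

lemma factor_lpp_suffix:
  "i \<le> length (lpp s) \<Longrightarrow> factor s i (length (lpp s)) = drop i (lpp s)"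
  by (metis factor_def take_lpp drop_take)

lemma pal_at_lpp_end:
  assumes "pal_at (c # s) i (length (lpp (c # s)))" "0 < i"
  shows "length (lpp (c # s)) - i \<le> length (lps (lpp (c # s)))"
proof -
  let ?v = "lpp (c # s)"
  have i: "i < length ?v" "palindrome (drop i ?v)"
    using assms by (auto simp: pal_at_def factor_lpp_suffix)
  have "strict_suffix (drop i ?v) ?v"
    using assms(2) i by (auto simp: strict_suffix_def suffix_drop)
      (metis diff_less length_drop less_irrefl less_trans)
  then show ?thesis using lps_max[OF _ _ i(2)] lpp_nonempty[of "c # s"] by fastforce
qed

lemma pal_at_lps:
  assumes "lps (lpp (c # s)) \<noteq> []"
  shows "pal_at (c # s) (length (lpp (c # s)) - length (lps (lpp (c # s)))) (length (lpp (c # s)))"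
proof -
  let ?v = "lpp (c # s)"
  have v: "?v \<noteq> []" using lpp_nonempty by blast
  have "suffix (lps ?v) ?v" using strict_suffix_lps[OF v] by (simp add: strict_suffix_def)
  then have "drop (length ?v - length (lps ?v)) ?v = lps ?v"
    by (metis suffix_def append_eq_conv_conj length_append add_diff_cancel_right')
  moreover have "length ?v \<le> length (c # s)" using prefix_lpp prefix_length_le by blast
  ultimately show ?thesis
    using assms pal_lps[OF v] v by (auto simp: pal_at_def factor_lpp_suffix)
qed

text \<open>The buried surface ends where the new prefix ends and reaches as far left as a
  palindrome of \<open>s\<close> with that end can, so it is the longest proper palindromic suffix
  of the new prefix.\<close>

lemma buried_length:
  assumes "(i, j) \<in> surfaces s" "Suc j = length (lpp (c # s))"
  shows "Suc i + length (lps (lpp (c # s))) = length (lpp (c # s))"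
    and "factor s i j = lps (lpp (c # s))" and "lps (lpp (c # s)) \<noteq> []"
proof -
  let ?v = "lpp (c # s)"
  have v: "?v \<noteq> []" using lpp_nonempty by blast
  have ij: "i < j" using assms surfacesD by blast
  have p: "pal_at (c # s) (Suc i) (length ?v)"
    using assms by (simp flip: assms(2)) (simp add: surfaces_def)
  from pal_at_lpp_end[OF p] have 1: "length ?v - Suc i \<le> length (lps ?v)" by simp
  with ij assms(2) show ne: "lps ?v \<noteq> []" by auto
  have lt: "length (lps ?v) < length ?v" using length_lps_less[OF v] .
  then obtain i' where i': "length ?v - length (lps ?v) = Suc i'" by (metis Suc_diff_Suc)
  from pal_at_lps[OF ne] have "pal_at s i' j" unfolding i' by (simp flip: assms(2))
  with assms(1) have "i \<le> i'" by (auto simp: surfaces_def)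
  with i' 1 lt show eq: "Suc i + length (lps ?v) = length ?v" by simp
  have "suffix (lps ?v) ?v" using strict_suffix_lps[OF v] by (simp add: strict_suffix_def)
  then have "drop (length ?v - length (lps ?v)) ?v = lps ?v"
    by (metis suffix_def append_eq_conv_conj length_append add_diff_cancel_right')
  moreover have "length ?v - length (lps ?v) = Suc i" using eq by simp
  moreover have "factor (c # s) (Suc i) (length ?v) = drop (Suc i) ?v"
    by (rule factor_lpp_suffix) (use eq in simp)
  ultimately show "factor s i j = lps ?v" by (simp flip: assms(2))
qed

text \<open>A pop must decide this from \<open>c # s\<close> alone. Suppose the link is nonempty and
  nothing was buried. Then the longest palindrome starting where the link starts as a suffix is a
  surface: one with the same end and an earlier start would, by \<open>pal_at_between\<close>, yield
  a proper palindromic suffix of the prefix that is longer than its link.\<close>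

lemma buried_iff:
  "buried c s \<longleftrightarrow> lps (lpp (c # s)) \<noteq> [] \<and>
     (\<nexists>j. (length (lpp (c # s)) - length (lps (lpp (c # s))), j) \<in> surfaces (c # s))"
  (is "_ \<longleftrightarrow> ?k \<noteq> [] \<and> (\<nexists>j. (?b, j) \<in> _)")
proof
  let ?v = "lpp (c # s)"
  assume "buried c s"
  then obtain i j where ij: "(i, j) \<in> surfaces s" "Suc j = length ?v" by (auto simp: buried_def)
  note b = buried_length[OF ij]
  have b': "?b = Suc i" using b(1) by simp
  have "(Suc i, j') \<notin> surfaces (c # s)" for j'
  proof
    assume "(Suc i, j') \<in> surfaces (c # s)"
    then obtain k where "(i, k) \<in> surfaces s" "Suc k \<noteq> length ?v"
      unfolding surfaces_Cons by blast
    with ij surfaces_fst_inj show False by metis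
  qed
  then show "?k \<noteq> [] \<and> (\<nexists>j. (?b, j) \<in> surfaces (c # s))" using b(3) b' by simp
next
  let ?v = "lpp (c # s)"
  assume *: "?k \<noteq> [] \<and> (\<nexists>j. (?b, j) \<in> surfaces (c # s))"
  have v: "?v \<noteq> []" using lpp_nonempty by blast
  have lt: "length ?k < length ?v" using length_lps_less[OF v] .
  obtain i where i: "?b = Suc i" using lt by (metis Suc_diff_Suc)
  obtain e where e: "length ?v = Suc e" using v by (cases ?v) auto
  have p: "pal_at s i e" using pal_at_lps[of c s] * unfolding i by (simp add: e)
  have left: "i \<le> i'" if "pal_at s i' e" for i'
    using pal_at_lpp_end[of c s "Suc i'"] that i lt by (simp add: e)
  show "buried c s"
  proof (rule ccontr)
    assume nb: "\<not> buried c s"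
    define j where "j = (GREATEST j. pal_at s i j)"
    have bnd: "\<And>y. pal_at s i y \<Longrightarrow> y \<le> length s" by (simp add: pal_at_def)
    have j: "pal_at s i j" "\<And>j'. pal_at s i j' \<Longrightarrow> j' \<le> j"
      unfolding j_def using GreatestI_nat[of "pal_at s i", OF p bnd] Greatest_le_nat[of "pal_at s i", OF _ bnd] by auto
    have "(i, j) \<in> surfaces s"
    proof -
      have "i \<le> i'" if i': "pal_at s i' j" for i'
      proof (rule ccontr)
        assume "\<not> i \<le> i'"
        then have "i' < i" by simp
        have "e \<le> j" using j p by blast
        show False
        proof (cases "e = j")
          case True with left i' \<open>i' < i\<close> show False by fastforce
        next
          case False
          with \<open>e \<le> j\<close> have "e < j" by simp
          moreover have "i < e" using p by (simp add: pal_at_def)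
          ultimately obtain b'' where "b'' < i" "pal_at s b'' e"
            using pal_at_between[OF j(1) i' \<open>i' < i\<close>] by blast
          with left show False by fastforce
        qed
      qed
      with j show ?thesis by (auto simp: surfaces_def)
    qed
    moreover from this nb e have "Suc j \<noteq> length ?v" by (auto simp: buried_def)
    ultimately have "(Suc i, Suc j) \<in> surfaces (c # s)" by (auto simp: surfaces_Cons)
    with * i show False by auto
  qed
qed

section \<open>Reference counts\<close>

definition refs :: "'a list \<Rightarrow> 'a list \<Rightarrow> nat" where
  "refs s p = card {q \<in> pals s. lps q = p} + card {x \<in> surfaces s. factor s (fst x) (snd x) = p}"

lemma sublist_factor: "sublist (factor s i j) s"
  by (metis factor_def sublist_order.order_trans sublist_drop sublist_take)

lemma pal_at_pals: "pal_at s i j \<Longrightarrow> factor s i j \<in> pals s"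
  using sublist_factor[of s i j] length_factor[of j s i]
  by (cases "factor s i j = []") (auto simp: pal_at_def pals_def)

lemma factor_in_pals: "(i, j) \<in> surfaces s \<Longrightarrow> factor s i j \<in> pals s"
  by (rule pal_at_pals) (simp add: surfaces_def)

lemma lps_in_pals: "q \<in> pals s \<Longrightarrow> lps q \<noteq> [] \<Longrightarrow> lps q \<in> pals s"
  using strict_suffix_lps[of q] pal_lps[of q] suffix_imp_sublist[of "lps q" q]
  by (auto simp: pals_def strict_suffix_def intro: sublist_order.order_trans)

lemma refs_eq_0: "p \<notin> pals s \<Longrightarrow> p \<noteq> [] \<Longrightarrow> refs s p = 0"
  using factor_in_pals[of _ _ s] lps_in_pals[of _ s] by (auto simp: refs_def)

text \<open>If \<open>p\<close> is a proper prefix of a longer palindrome of \<open>s\<close>, the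
  link chain of the latter reaches a node that links to \<open>p\<close>. Otherwise no longer
  palindrome shares a start or an end with an occurrence of \<open>p\<close>, so that occurrence is
  a surface.\<close>

lemma refs_pos:
  assumes "p \<in> pals s"
  shows "refs s p > 0"
proof (cases "\<exists>q \<in> pals s. strict_prefix p q")
  case True
  then obtain q where "q \<in> pals s" "strict_prefix p q" by blast
  then have "\<exists>q \<in> pals s. lps q = p"
  proof (induction "length q" arbitrary: q rule: less_induct)
    case less
    have p: "palindrome p" "p \<noteq> []" using assms by (auto simp: pals_def)
    have q: "palindrome q" "q \<noteq> []" using less.prems by (auto simp: pals_def)
    from strict_prefix_via_lps[OF q(1) less.prems(2) p(1)] show ?case
    proof
      assume *: "strict_prefix p (lps q)"
      then have "lps q \<noteq> []" by auto
      then show ?thesis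
        using less.hyps[OF length_lps_less[OF q(2)] _ *] less.prems lps_in_pals by blast
    qed (use less.prems in auto)
  qed
  then have "{q \<in> pals s. lps q = p} \<noteq> {}" by blast
  then show ?thesis by (simp add: refs_def card_gt_0_iff)
next
  case False
  from assms have p: "palindrome p" "p \<noteq> []" "sublist p s" by (auto simp: pals_def)
  then obtain u v where s: "s = u @ p @ v" by (auto simp: sublist_def)
  let ?i = "length u" and ?j = "length u + length p"
  have fac: "factor s ?i ?j = p" by (simp add: factor_def s)
  have at: "pal_at s ?i ?j" using p fac by (simp add: pal_at_def s)
  have "(?i, ?j) \<in> surfaces s"
  proof -
    have "j' \<le> ?j" if j': "pal_at s ?i j'" for j'
    proof (rule ccontr)
      assume "\<not> j' \<le> ?j"
      then have "strict_prefix p (factor s ?i j')"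
        using length_factor[of j' s ?i] j'
        by (auto simp: strict_prefix_def factor_def s pal_at_def prefix_def)
      with False pal_at_pals[OF j'] show False by blast
    qed
    moreover have "?i \<le> i'" if i': "pal_at s i' ?j" for i'
    proof (rule ccontr)
      assume *: "\<not> ?i \<le> i'"
      have "factor s i' ?j = drop i' u @ p" using * by (simp add: factor_def s)
      moreover have "drop i' u \<noteq> []" using * by simp
      ultimately have "strict_suffix p (factor s i' ?j)" by (auto simp: strict_suffix_def suffix_def)
      then have "strict_prefix p (factor s i' ?j)"
        using strict_suffix_pal_iff p(1) i' by (auto simp: pal_at_def)
      with False pal_at_pals[OF i'] show False by blast
    qed
    ultimately show ?thesis using at by (auto simp: surfaces_def)
  qed
  then have "{x \<in> surfaces s. factor s (fst x) (snd x) = p} \<noteq> {}" using fac by force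
  then show ?thesis by (simp add: refs_def card_gt_0_iff)
qed

text \<open>The exact balance of a push: a surface gained, possibly one buried, and a link gained if
  the node is new. The loss is added on the left to avoid truncated subtraction, so that a pop can
  read the equation backwards.\<close>

lemma refs_Cons:
  "refs (c # s) p + (if buried c s \<and> p = lps (lpp (c # s)) then 1 else 0) =
   refs s p + (if p = lpp (c # s) then 1 else 0) +
     (if lpp (c # s) \<notin> pals s \<and> p = lps (lpp (c # s)) then 1 else 0)"
proof -
  let ?v = "lpp (c # s)"
  let ?A = "\<lambda>s. {q \<in> pals s. lps q = p}" and ?B = "\<lambda>s. {x \<in> surfaces s. factor s (fst x) (snd x) = p}"
  let ?K = "{x \<in> surfaces s. Suc (snd x) = length ?v \<and> factor s (fst x) (snd x) = p}"
  let ?up = "\<lambda>x. (Suc (fst x), Suc (snd x))"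
  have A: "card (?A (c # s)) = card (?A s) + (if ?v \<notin> pals s \<and> p = lps ?v then 1 else 0)"
  proof -
    have "?A (c # s) = (if ?v \<notin> pals s \<and> p = lps ?v then insert ?v (?A s) else ?A s)"
      by (auto simp: pals_Cons)
    then show ?thesis by simp
  qed
  have fv: "factor (c # s) 0 (length ?v) = ?v" by (simp add: factor_prefix take_lpp)
  have "?B (c # s) = (if p = ?v then {(0, length ?v)} else {}) \<union> ?up ` (?B s - ?K)"
    using fv by (auto simp: surfaces_Cons image_iff) force+
  moreover have "card (?up ` (?B s - ?K)) = card (?B s - ?K)"
    by (rule card_image) (auto simp: inj_on_def)
  moreover have "card (?B s - ?K) = card (?B s) - card ?K"
    by (rule card_Diff_subset) auto
  moreover have "card ?K \<le> card (?B s)" by (rule card_mono) auto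
  moreover have "finite (?B s - ?K)" by simp
  ultimately have B: "card (?B (c # s)) + card ?K = card (?B s) + (if p = ?v then 1 else 0)"
    by (auto simp: card_insert_if image_iff)
  have K: "card ?K = (if buried c s \<and> p = lps ?v then 1 else 0)"
  proof (cases "buried c s \<and> p = lps ?v")
    case True
    then obtain i j where ij: "(i, j) \<in> surfaces s" "Suc j = length ?v" by (auto simp: buried_def)
    have "?K = {(i, j)}"
    proof (intro set_eqI iffI)
      fix x assume *: "x \<in> ?K"
      then have "Suc (snd x) = Suc j" using ij(2) by simp
      then have x: "x = (fst x, j)" by (metis nat.inject prod.collapse)
      with * have "(fst x, j) \<in> surfaces s" by (metis (no_types, lifting) mem_Collect_eq)
      with surfaces_snd_inj[OF ij(1)] x show "x \<in> {(i, j)}" by (metis singletonI)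
    next
      fix x assume "x \<in> {(i, j)}"
      with ij buried_length(2)[OF ij] True show "x \<in> ?K" by simp
    qed
    then show ?thesis using True by simp
  next
    case False
    then have "?K = {}" using buried_length(2)[of _ _ s c] by (auto simp: buried_def)
    then have "card ?K = 0" by (simp only: card.empty)
    then show ?thesis using False by (simp only: if_False)
  qed
  show ?thesis using A B K by (simp add: refs_def)
qed

lemma refs_rev [simp]: "refs (rev s) p = refs s p"
proof -
  let ?f = "\<lambda>(i, j). (length s - j, length s - i)"
  let ?B = "\<lambda>s. {x \<in> surfaces s. factor s (fst x) (snd x) = p}"
  have fac: "factor (rev s) (length s - j) (length s - i) = factor s i j" if "(i, j) \<in> surfaces s" for i j
    using surfacesD[OF that] factor_rev[of i j s] by (auto simp: palindrome_def)
  have "?B (rev s) = ?f ` ?B s"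
    using fac by (auto simp: surfaces_rev image_iff) force+
  moreover have "inj_on ?f (?B s)"
    by (auto simp: inj_on_def dest!: surfacesD)
  ultimately show ?thesis by (simp add: refs_def card_image)
qed

text \<open>Keeps the counters far below the word size, so that they never wrap around.\<close>

lemma refs_le: "refs s p \<le> 2 * length s"
proof -
  have "card {q \<in> pals s. lps q = p} \<le> card (pals s)" by (rule card_mono) auto
  moreover have "card {x \<in> surfaces s. factor s (fst x) (snd x) = p} \<le> card (surfaces s)"
    by (rule card_mono) auto
  ultimately show ?thesis using card_pals_le[of s] card_surfaces_le[of s] by (simp add: refs_def)
qed

section \<open>A structured language on top of the word RAM\<close>

text \<open>The memory is split into 16 interleaved arrays: entry \<open>i\<close> of array \<open>j\<close> is cell \<open>16 * i + j\<close>.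
  Variables are the registers below 32, the registers from 32 on hold intermediate results.
  The only loop runs once for every bit of entry 0 of array 15.\<close>

datatype aexp = Const nat | Var nat | Bin alu_op aexp aexp | Arr nat aexp

datatype test = Equal | Smaller

primrec holds :: "test \<Rightarrow> nat \<Rightarrow> nat \<Rightarrow> bool" where
  "holds Equal a b \<longleftrightarrow> a = b"
| "holds Smaller a b \<longleftrightarrow> a < b"

primrec branch :: "test \<Rightarrow> nat \<Rightarrow> nat \<Rightarrow> nat \<Rightarrow> instr" where
  "branch Equal = Branch_Eq"
| "branch Smaller = Branch_Less"

datatype com =
    Skip
  | Set nat aexp
  | Put nat aexp aexp
  | Seq com com (infixr \<open>;;\<close> 60)
  | Cond test aexp aexp com com
  | Bits nat com

abbreviation "If_Eq \<equiv> Cond Equal"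
abbreviation "If_Less \<equiv> Cond Smaller"

type_synonym arrays = "nat \<Rightarrow> nat \<Rightarrow> nat"
type_synonym store = "(nat \<Rightarrow> nat) \<times> arrays"

fun bitlen :: "nat \<Rightarrow> nat" where
  "bitlen n = (if n = 0 then 0 else Suc (bitlen (n div 2)))"

declare bitlen.simps [simp del]

text \<open>The address \<open>16 * i + j\<close> is computed modulo \<open>2 ^ w\<close>, which
  drops the four highest bits of \<open>i\<close>; hence the index modulo
  \<open>2 ^ (w - 4)\<close>.\<close>

primrec aval :: "nat \<Rightarrow> aexp \<Rightarrow> store \<Rightarrow> nat" where
  "aval w (Const k) st = k mod 2 ^ w"
| "aval w (Var x) st = fst st x"
| "aval w (Bin f a b) st = alu w f (aval w a st) (aval w b st)"
| "aval w (Arr j e) st = snd st j (aval w e st mod 2 ^ (w - 4))"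

definition put :: "arrays \<Rightarrow> nat \<Rightarrow> nat \<Rightarrow> nat \<Rightarrow> arrays" where
  "put A j i v = A(j := (A j)(i := v))"

primrec exec :: "nat \<Rightarrow> com \<Rightarrow> store \<Rightarrow> store" where
  "exec w Skip st = st"
| "exec w (Set r e) st = ((fst st)(r := aval w e st), snd st)"
| "exec w (Put j a e) st = (fst st, put (snd st) j (aval w a st mod 2 ^ (w - 4)) (aval w e st))"
| "exec w (c ;; d) st = exec w d (exec w c st)"
| "exec w (Cond t a b c d) st = (if holds t (aval w a st) (aval w b st) then exec w c st else exec w d st)"
| "exec w (Bits r c) st =
     ((\<lambda>st. exec w c ((fst st)(r := fst st r div 2), snd st)) ^^ bitlen (snd st 15 0))
       ((fst st)(r := snd st 15 0), snd st)"

primrec elen :: "aexp \<Rightarrow> nat" where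
  "elen (Const k) = 1"
| "elen (Var x) = 1"
| "elen (Bin f a b) = elen a + elen b + 1"
| "elen (Arr j e) = elen e + 5"

definition address :: "nat \<Rightarrow> nat \<Rightarrow> program" where
  "address j r = [Imm (r + 1) 16, Alu Mul r r (r + 1), Imm (r + 1) j, Alu Add r r (r + 1)]"

text \<open>\<open>Alu Or r x x\<close> is a register move. The registers from \<open>r\<close> on
  serve as an evaluation stack; those below \<open>r\<close> are preserved.\<close>

primrec compile_exp :: "aexp \<Rightarrow> nat \<Rightarrow> program" where
  "compile_exp (Const k) r = [Imm r k]"
| "compile_exp (Var x) r = [Alu Or r x x]"
| "compile_exp (Bin f a b) r = compile_exp a r @ compile_exp b (r + 1) @ [Alu f r r (r + 1)]"
| "compile_exp (Arr j e) r = compile_exp e r @ address j r @ [Load r r]"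

primrec clen :: "com \<Rightarrow> nat" where
  "clen Skip = 0"
| "clen (Set r e) = elen e + 1"
| "clen (Put j a e) = elen e + elen a + 5"
| "clen (c ;; d) = clen c + clen d"
| "clen (Cond t a b c d) = elen a + elen b + clen c + clen d + 2"
| "clen (Bits r c) = clen c + 12"

text \<open>The else branch is laid out first, and \<open>Branch_Eq 0 0\<close> is an unconditional
  jump. A loop has 7 instructions of setup, 4 at its head at offset 7, and one jump back, which
  makes 12 besides the body.\<close>

primrec compile :: "com \<Rightarrow> nat \<Rightarrow> program" where
  "compile Skip l = []"
| "compile (Set r e) l = compile_exp e 32 @ [Alu Or r 32 32]"
| "compile (Put j a e) l = compile_exp e 32 @ compile_exp a 33 @ address j 33 @ [Store 33 32]"
| "compile (c ;; d) l = compile c l @ compile d (l + clen c)"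
| "compile (Cond t a b c d) l = compile_exp a 32 @ compile_exp b 33 @
     [branch t 32 33 (l + elen a + elen b + clen d + 2)] @
     compile d (l + elen a + elen b + 1) @
     [Branch_Eq 0 0 (l + elen a + elen b + clen d + 2 + clen c)] @
     compile c (l + elen a + elen b + clen d + 2)"
| "compile (Bits r c) l = compile_exp (Arr 15 (Const 0)) 32 @ [Alu Or r 32 32] @
     [Imm 32 0, Branch_Eq r 32 (l + clen c + 12), Imm 32 2, Alu Div r r 32] @
     compile c (l + 11) @ [Branch_Eq 0 0 (l + 7)]"

text \<open>Both branches of a conditional are added up: coarse, but the bound is then evaluated by
  plain simplification. \<open>L\<close> bounds the number of rounds of a loop.\<close>

primrec cost :: "nat \<Rightarrow> com \<Rightarrow> nat" where
  "cost L Skip = 0"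
| "cost L (Set r e) = elen e + 1"
| "cost L (Put j a e) = elen e + elen a + 5"
| "cost L (c ;; d) = cost L c + cost L d"
| "cost L (Cond t a b c d) = elen a + elen b + cost L c + cost L d + 2"
| "cost L (Bits r c) = L * (cost L c + 5) + 9"

primrec exp_ok :: "aexp \<Rightarrow> bool" where
  "exp_ok (Const k) = True"
| "exp_ok (Var x) \<longleftrightarrow> x < 32"
| "exp_ok (Bin f a b) \<longleftrightarrow> exp_ok a \<and> exp_ok b"
| "exp_ok (Arr j e) \<longleftrightarrow> j < 16 \<and> exp_ok e"

primrec writes :: "com \<Rightarrow> nat set" where
  "writes Skip = {}"
| "writes (Set r e) = {r}"
| "writes (Put j a e) = {}"
| "writes (c ;; d) = writes c \<union> writes d"
| "writes (Cond t a b c d) = writes c \<union> writes d"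
| "writes (Bits r c) = insert r (writes c)"

primrec puts :: "com \<Rightarrow> nat set" where
  "puts Skip = {}"
| "puts (Set r e) = {}"
| "puts (Put j a e) = {j}"
| "puts (c ;; d) = puts c \<union> puts d"
| "puts (Cond t a b c d) = puts c \<union> puts d"
| "puts (Bits r c) = puts c"

primrec loop_free :: "com \<Rightarrow> bool" where
  "loop_free Skip = True"
| "loop_free (Set r e) = True"
| "loop_free (Put j a e) = True"
| "loop_free (c ;; d) \<longleftrightarrow> loop_free c \<and> loop_free d"
| "loop_free (Cond t a b c d) \<longleftrightarrow> loop_free c \<and> loop_free d"
| "loop_free (Bits r c) = False"

text \<open>The body of a loop must not write the counting register; this fixes the number of rounds
  in advance.\<close>

primrec com_ok :: "com \<Rightarrow> bool" where
  "com_ok Skip = True"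
| "com_ok (Set r e) \<longleftrightarrow> r < 32 \<and> exp_ok e"
| "com_ok (Put j a e) \<longleftrightarrow> j < 16 \<and> exp_ok a \<and> exp_ok e"
| "com_ok (c ;; d) \<longleftrightarrow> com_ok c \<and> com_ok d"
| "com_ok (Cond t a b c d) \<longleftrightarrow> exp_ok a \<and> exp_ok b \<and> com_ok c \<and> com_ok d"
| "com_ok (Bits r c) \<longleftrightarrow> r < 32 \<and> r \<notin> writes c \<and> com_ok c"

section \<open>Correctness of the compiler\<close>

lemma length_address [simp]: "length (address j r) = 4"
  by (simp add: address_def)

lemma length_compile_exp [simp]: "length (compile_exp e r) = elen e"
  by (induction e arbitrary: r) auto

lemma length_compile [simp]: "length (compile c l) = clen c"
  by (induction c arbitrary: l) auto

lemma exec_unwritten: "r \<notin> writes c \<Longrightarrow> fst (exec w c st) r = fst st r"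
proof (induction c arbitrary: st)
  case (Bits q c)
  have "fst (((\<lambda>st. exec w c ((fst st)(q := fst st q div 2), snd st)) ^^ n) st) r = fst st r" for n st
    using Bits by (induction n) auto
  then show ?case using Bits by simp
qed auto

lemma exec_unput: "j \<notin> puts c \<Longrightarrow> snd (exec w c st) j = snd st j"
proof (induction c arbitrary: st)
  case (Bits q c)
  have "snd (((\<lambda>st. exec w c ((fst st)(q := fst st q div 2), snd st)) ^^ n) st) j = snd st j" for n st
    using Bits by (induction n) auto
  then show ?case by simp
qed (auto simp: put_def)

definition code_at :: "program \<Rightarrow> nat \<Rightarrow> program \<Rightarrow> bool" where
  "code_at P l c \<longleftrightarrow> (\<exists>pre post. P = pre @ c @ post \<and> length pre = l)"

lemma code_at_append: "code_at P l (c @ d) \<longleftrightarrow> code_at P l c \<and> code_at P (l + length c) d"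
proof
  assume "code_at P l (c @ d)"
  then obtain pre post where "P = pre @ (c @ d) @ post" "length pre = l" by (auto simp: code_at_def)
  then show "code_at P l c \<and> code_at P (l + length c) d"
    unfolding code_at_def by (metis append.assoc length_append)
next
  assume *: "code_at P l c \<and> code_at P (l + length c) d"
  then obtain pre post where P: "P = pre @ c @ post" "length pre = l" unfolding code_at_def by blast
  from * obtain pre' post' where P': "P = pre' @ d @ post'" "length pre' = l + length c"
    unfolding code_at_def by blast
  from P P' have "(pre @ c) @ post = pre' @ d @ post'" "length (pre @ c) = length pre'" by simp_all
  then have "post = d @ post'" by (metis append_eq_append_conv)
  then have "P = pre @ (c @ d) @ post'" using P by simp
  with P(2) show "code_at P l (c @ d)" unfolding code_at_def by blast
qed

lemma code_at_Cons: "code_at P l (i # c) \<longleftrightarrow> l < length P \<and> P ! l = i \<and> code_at P (Suc l) c"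
proof -
  have "code_at P l [i] \<longleftrightarrow> l < length P \<and> P ! l = i"
  proof
    assume "l < length P \<and> P ! l = i"
    then have "P = take l P @ [i] @ drop (Suc l) P" "length (take l P) = l"
      by (auto simp: id_take_nth_drop)
    then show "code_at P l [i]" unfolding code_at_def by blast
  qed (auto simp: code_at_def)
  then show ?thesis using code_at_append[of P l "[i]" c] by simp
qed

definition steps :: "nat \<Rightarrow> program \<Rightarrow> nat \<Rightarrow> ram \<Rightarrow> ram \<Rightarrow> bool" where
  "steps w P t x y \<longleftrightarrow> (step w P ^^ t) x = y"

lemma steps_0 [simp]: "steps w P 0 x x" by (simp add: steps_def)

lemma steps_trans: "steps w P t x y \<Longrightarrow> steps w P t' y z \<Longrightarrow> steps w P (t + t') x z"
  by (simp add: steps_def funpow_add add.commute[of t])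

lemma steps_Suc: "pc x < length P \<Longrightarrow> steps w P t (exec_instr w (P ! pc x) x) y \<Longrightarrow> steps w P (Suc t) x y"
  by (simp add: steps_def step_def halted_def funpow_swap1)

definition represents :: "ram \<Rightarrow> store \<Rightarrow> bool" where
  "represents x st \<longleftrightarrow> (\<forall>q<32. reg x q = fst st q) \<and> (\<forall>j<16. \<forall>i. mem x (16 * i + j) = snd st j i)"

lemma address_arith:
  fixes j v :: nat
  assumes "5 \<le> w" "j < 16"
  shows "((v * (16 mod 2 ^ w)) mod 2 ^ w + j mod 2 ^ w) mod 2 ^ w = 16 * (v mod 2 ^ (w - 4)) + j"
proof -
  have w: "(2::nat) ^ w = 16 * 2 ^ (w - 4)"
  proof -
    have "(2::nat) ^ w = 2 ^ (4 + (w - 4))" using assms by simp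
    then show ?thesis by (simp only: power_add) simp
  qed
  have "(16::nat) < 2 ^ w" using power_strict_increasing[of 4 w "2::nat"] assms by simp
  then have m: "16 mod 2 ^ w = (16::nat)" "j mod 2 ^ w = j"
    using assms(2) by (simp_all only: mod_less order.strict_trans)
  have "(v * 16) mod 2 ^ w = 16 * (v mod 2 ^ (w - 4))"
    unfolding w by (simp only: mult.commute[of v 16] mult_mod_right)
  moreover have "16 * (v mod 2 ^ (w - 4)) + j < 2 ^ w"
  proof -
    have "v mod 2 ^ (w - 4) < 2 ^ (w - 4)" by simp
    then show ?thesis using assms unfolding w by linarith
  qed
  ultimately show ?thesis using m by simp
qed

lemma address_correct:
  assumes "5 \<le> w" "j < 16" "code_at P (pc x) (address j r)"
  shows "\<exists>y. steps w P 4 x y \<and> pc y = pc x + 4 \<and> mem y = mem x \<and>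
    reg y r = 16 * (reg x r mod 2 ^ (w - 4)) + j \<and> (\<forall>q<r. reg y q = reg x q)"
proof -
  let ?y = "x\<lparr>pc := pc x + 4, reg := (reg x)(r + 1 := j mod 2 ^ w,
     r := ((reg x r * (16 mod 2 ^ w)) mod 2 ^ w + j mod 2 ^ w) mod 2 ^ w)\<rparr>"
  have "steps w P (Suc (Suc (Suc (Suc 0)))) x ?y"
    using assms(3) unfolding address_def code_at_Cons
    by (intro steps_Suc) (auto simp: steps_def fun_upd_def cong: if_cong)
  then show ?thesis
    using address_arith[OF assms(1,2)] by (intro exI[of _ ?y]) (simp add: eval_nat_numeral)
qed

lemma steps_1: "pc x < length P \<Longrightarrow> exec_instr w (P ! pc x) x = y \<Longrightarrow> steps w P (Suc 0) x y"
  using steps_Suc[of x P w 0 y] by simp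

lemma compile_exp_correct:
  assumes "5 \<le> w" "exp_ok e" "32 \<le> r" "code_at P (pc x) (compile_exp e r)" "represents x st"
  shows "\<exists>y. steps w P (elen e) x y \<and> pc y = pc x + elen e \<and> mem y = mem x \<and>
    reg y r = aval w e st \<and> (\<forall>q<r. reg y q = reg x q)"
  using assms(2-)
proof (induction e arbitrary: r x)
  case (Const k)
  then show ?case by (auto simp: code_at_Cons intro!: exI steps_1)
next
  case (Var v)
  then show ?case by (auto simp: code_at_Cons represents_def intro!: exI steps_1)
next
  case (Bin f a b)
  from Bin.prems have c: "code_at P (pc x) (compile_exp a r)"
    "code_at P (pc x + elen a) (compile_exp b (r + 1))"
    "code_at P (pc x + elen a + elen b) [Alu f r r (r + 1)]"
    by (auto simp: code_at_append)
  from Bin.IH(1)[OF _ Bin.prems(2) c(1) Bin.prems(4)] Bin.prems obtain y where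
    y: "steps w P (elen a) x y" "pc y = pc x + elen a" "mem y = mem x"
    "reg y r = aval w a st" "\<forall>q<r. reg y q = reg x q" by auto
  then have "represents y st" using Bin.prems by (auto simp: represents_def)
  with Bin.IH(2)[of "r + 1" y] Bin.prems c(2) y obtain z where
    z: "steps w P (elen b) y z" "pc z = pc y + elen b" "mem z = mem y"
    "reg z (r + 1) = aval w b st" "\<forall>q<r + 1. reg z q = reg y q" by auto
  have "steps w P (Suc 0) z (z\<lparr>pc := pc z + 1,
      reg := (reg z)(r := alu w f (aval w a st) (aval w b st))\<rparr>)"
    using c(3) y z by (intro steps_1) (auto simp: code_at_Cons)
  from steps_trans[OF steps_trans[OF y(1) z(1)] this] show ?case
    using y z by (intro exI[of _ "z\<lparr>pc := pc z + 1,
      reg := (reg z)(r := alu w f (aval w a st) (aval w b st))\<rparr>"]) auto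
next
  case (Arr j e)
  from Arr.prems have c: "code_at P (pc x) (compile_exp e r)"
    "code_at P (pc x + elen e) (address j r)"
    "code_at P (pc x + elen e + 4) [Load r r]"
    by (auto simp: code_at_append)
  from Arr.IH[OF _ Arr.prems(2) c(1) Arr.prems(4)] Arr.prems obtain y where
    y: "steps w P (elen e) x y" "pc y = pc x + elen e" "mem y = mem x"
    "reg y r = aval w e st" "\<forall>q<r. reg y q = reg x q" by auto
  from address_correct[OF assms(1), of j P y r] Arr.prems c(2) y obtain z where
    z: "steps w P 4 y z" "pc z = pc y + 4" "mem z = mem y"
    "reg z r = 16 * (reg y r mod 2 ^ (w - 4)) + j" "\<forall>q<r. reg z q = reg y q" by auto
  let ?u = "z\<lparr>pc := pc z + 1, reg := (reg z)(r := mem z (reg z r))\<rparr>"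
  have "steps w P (Suc 0) z ?u"
    using c(3) y z by (intro steps_1) (auto simp: code_at_Cons)
  from steps_trans[OF steps_trans[OF y(1) z(1)] this] have "steps w P (elen e + 5) x ?u"
    by (simp add: add.commute add.left_commute)
  then show ?case
    using y z Arr.prems by (intro exI[of _ ?u]) (auto simp: represents_def)
qed

lemma bitlen_0 [simp]: "bitlen 0 = 0" by (simp add: bitlen.simps)

text \<open>The loop bound is read from entry 0 of array 15 and so must not change during the run.
  The alternative without loops allows the initialisation to write that entry.\<close>

lemma compile_correct:
  assumes "5 \<le> w" "com_ok c" "code_at P (pc x) (compile c (pc x))" "represents x st"
    "15 \<notin> puts c \<and> bitlen (snd st 15 0) \<le> L \<or> loop_free c"
  shows "\<exists>t y. steps w P t x y \<and> t \<le> cost L c \<and> pc y = pc x + clen c \<and> represents y (exec w c st)"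
  using assms(2-)
proof (induction c arbitrary: x st)
  case Skip
  then show ?case by (intro exI[of _ 0] exI[of _ x]) auto
next
  case (Set r e)
  from Set.prems have c: "code_at P (pc x) (compile_exp e 32)" "code_at P (pc x + elen e) [Alu Or r 32 32]"
    by (auto simp: code_at_append)
  from compile_exp_correct[OF assms(1) _ _ c(1) Set.prems(3)] Set.prems obtain y where
    y: "steps w P (elen e) x y" "pc y = pc x + elen e" "mem y = mem x"
    "reg y 32 = aval w e st" "\<forall>q<32. reg y q = reg x q" by auto
  let ?z = "y\<lparr>pc := pc y + 1, reg := (reg y)(r := aval w e st)\<rparr>"
  have "steps w P (Suc 0) y ?z"
    using c(2) y by (intro steps_1) (auto simp: code_at_Cons)
  from steps_trans[OF y(1) this] show ?case
    using y Set.prems by (intro exI[of _ "elen e + 1"] exI[of _ ?z]) (auto simp: represents_def)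
next
  case (Put j a e)
  from Put.prems have c: "code_at P (pc x) (compile_exp e 32)"
    "code_at P (pc x + elen e) (compile_exp a 33)"
    "code_at P (pc x + elen e + elen a) (address j 33)"
    "code_at P (pc x + elen e + elen a + 4) [Store 33 32]"
    by (auto simp: code_at_append add.assoc)
  from compile_exp_correct[OF assms(1) _ _ c(1) Put.prems(3)] Put.prems obtain y where
    y: "steps w P (elen e) x y" "pc y = pc x + elen e" "mem y = mem x"
    "reg y 32 = aval w e st" "\<forall>q<32. reg y q = reg x q" by auto
  then have ry: "represents y st" using Put.prems by (auto simp: represents_def)
  with compile_exp_correct[OF assms(1), of a 33 P y st] Put.prems c(2) y obtain z where
    z: "steps w P (elen a) y z" "pc z = pc y + elen a" "mem z = mem y"
    "reg z 33 = aval w a st" "\<forall>q<33. reg z q = reg y q" by auto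
  from address_correct[OF assms(1), of j P z 33] Put.prems c(3) y z obtain u where
    u: "steps w P 4 z u" "pc u = pc z + 4" "mem u = mem z"
    "reg u 33 = 16 * (reg z 33 mod 2 ^ (w - 4)) + j" "\<forall>q<33. reg u q = reg z q" by auto
  let ?v = "u\<lparr>pc := pc u + 1, mem := (mem u)(reg u 33 := reg u 32)\<rparr>"
  have "steps w P (Suc 0) u ?v"
    using c(4) y z u by (intro steps_1) (auto simp: code_at_Cons)
  note st = steps_trans[OF steps_trans[OF steps_trans[OF y(1) z(1)] u(1)] this]
  have r32: "reg u 32 = aval w e st" using u z y by simp
  have idx: "16 * i' + j' = 16 * i + j \<longleftrightarrow> i' = i \<and> j' = j" if "j' < 16" for i i' j' :: nat
  proof -
    have "j < 16" using Put.prems(1) by simp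
    have "i' = (16 * i' + j') div 16" "j' = (16 * i' + j') mod 16"
      "i = (16 * i + j) div 16" "j = (16 * i + j) mod 16"
      using that \<open>j < 16\<close> by simp_all
    then show ?thesis by metis
  qed
  have "represents ?v (exec w (Put j a e) st)"
    using y z u Put.prems idx by (auto simp: represents_def put_def r32)
  then show ?case
    using st y z u by (intro exI[of _ "elen e + elen a + 4 + 1"] exI[of _ ?v]) auto
next
  case (Seq c d)
  have cc: "code_at P (pc x) (compile c (pc x))" "code_at P (pc x + clen c) (compile d (pc x + clen c))"
    using Seq.prems by (auto simp: code_at_append)
  from Seq.IH(1)[OF _ cc(1) Seq.prems(3)] Seq.prems obtain t y where
    y: "steps w P t x y" "t \<le> cost L c" "pc y = pc x + clen c" "represents y (exec w c st)" by auto
  moreover have "15 \<notin> puts d \<and> bitlen (snd (exec w c st) 15 0) \<le> L \<or> loop_free d"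
    using Seq.prems exec_unput[of 15 c w st] by auto
  ultimately obtain t' z where
    z: "steps w P t' y z" "t' \<le> cost L d" "pc z = pc y + clen d" "represents z (exec w d (exec w c st))"
    using Seq.IH(2)[of y "exec w c st"] Seq.prems cc(2) by auto
  show ?case
    using steps_trans[OF y(1) z(1)] y z by (intro exI[of _ "t + t'"] exI[of _ z]) auto
next
  case (Cond t a b c d)
  let ?l = "pc x + elen a + elen b"
  have cc: "code_at P (pc x) (compile_exp a 32)" "code_at P (pc x + elen a) (compile_exp b 33)"
    "?l < length P \<and> P ! ?l = branch t 32 33 (?l + clen d + 2)"
    "code_at P (?l + 1) (compile d (?l + 1))"
    "?l + 1 + clen d < length P \<and> P ! (?l + 1 + clen d) = Branch_Eq 0 0 (?l + clen d + 2 + clen c)"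
    "code_at P (?l + clen d + 2) (compile c (?l + clen d + 2))"
    using Cond.prems(2) by (auto simp: code_at_append code_at_Cons ac_simps)
  from compile_exp_correct[OF assms(1) _ _ cc(1) Cond.prems(3)] Cond.prems obtain y where
    y: "steps w P (elen a) x y" "pc y = pc x + elen a" "mem y = mem x"
    "reg y 32 = aval w a st" "\<forall>q<32. reg y q = reg x q" by auto
  then have ry: "represents y st" using Cond.prems by (auto simp: represents_def)
  with compile_exp_correct[OF assms(1), of b 33 P y st] Cond.prems cc(2) y obtain z where
    z: "steps w P (elen b) y z" "pc z = pc y + elen b" "mem z = mem y"
    "reg z 33 = aval w b st" "\<forall>q<33. reg z q = reg y q" by auto
  then have rz: "represents z st" "reg z 32 = aval w a st" using ry y by (auto simp: represents_def)
  note xz = steps_trans[OF y(1) z(1)]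
  have br: "exec_instr w (branch t 32 33 k) z =
      z\<lparr>pc := if holds t (aval w a st) (aval w b st) then k else pc z + 1\<rparr>" for k
    using rz z by (cases t) auto
  show ?case
  proof (cases "holds t (aval w a st) (aval w b st)")
    case True
    let ?u = "z\<lparr>pc := ?l + clen d + 2\<rparr>"
    have u: "steps w P (Suc 0) z ?u"
      using cc(3) y z True by (intro steps_1) (auto simp: br)
    have "represents ?u st" using rz by (simp add: represents_def)
    with Cond.IH(1)[of ?u st] Cond.prems cc(6) obtain t v where
      v: "steps w P t ?u v" "t \<le> cost L c" "pc v = ?l + clen d + 2 + clen c" "represents v (exec w c st)"
      by auto
    show ?thesis
      using steps_trans[OF steps_trans[OF xz u] v(1)] v True
      by (intro exI[of _ "elen a + elen b + Suc 0 + t"] exI[of _ v]) auto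
  next
    case False
    let ?u = "z\<lparr>pc := ?l + 1\<rparr>"
    have u: "steps w P (Suc 0) z ?u"
      using cc(3) y z False by (intro steps_1) (auto simp: br)
    have "represents ?u st" using rz by (simp add: represents_def)
    with Cond.IH(2)[of ?u st] Cond.prems cc(4) obtain t v where
      v: "steps w P t ?u v" "t \<le> cost L d" "pc v = ?l + 1 + clen d" "represents v (exec w d st)"
      by auto
    let ?r = "v\<lparr>pc := ?l + clen d + 2 + clen c\<rparr>"
    have r: "steps w P (Suc 0) v ?r"
      using cc(5) v by (intro steps_1) (auto simp: code_at_Cons)
    have "represents ?r (exec w d st)" using v by (simp add: represents_def)
    then show ?thesis
      using steps_trans[OF steps_trans[OF steps_trans[OF xz u] v(1)] r] v False
      by (intro exI[of _ "elen a + elen b + Suc 0 + t + Suc 0"] exI[of _ ?r]) auto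
  qed
next
  case (Bits r c)
  let ?h = "pc x + 7"
  let ?f = "\<lambda>st. exec w c ((fst st)(r := fst st r div 2), snd st)"
  have cc: "code_at P (pc x) (compile_exp (Arr 15 (Const 0)) 32)" "code_at P (pc x + 6) [Alu Or r 32 32]"
    "code_at P ?h [Imm 32 0, Branch_Eq r 32 (pc x + clen c + 12), Imm 32 2, Alu Div r r 32]"
    "code_at P (pc x + 11) (compile c (pc x + 11))"
    "code_at P (pc x + 11 + clen c) [Branch_Eq 0 0 ?h]"
    using Bits.prems(2)[unfolded compile.simps code_at_append length_compile_exp length_compile
        list.size elen.simps]
    by (simp_all add: eval_nat_numeral)
  from compile_exp_correct[OF assms(1) _ _ cc(1) Bits.prems(3)] obtain y where
    y: "steps w P 6 x y" "pc y = pc x + 6" "mem y = mem x"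
    "reg y 32 = snd st 15 0" "\<forall>q<32. reg y q = reg x q" by auto
  let ?z = "y\<lparr>pc := ?h, reg := (reg y)(r := snd st 15 0)\<rparr>"
  have z: "steps w P (Suc 0) y ?z"
    using cc(2) y by (intro steps_1) (auto simp: code_at_Cons)
  have w2: "2 mod 2 ^ w = (2::nat)"
    using power_strict_increasing[of 1 w "2::nat"] assms(1) by simp
  \<comment> \<open>A round takes 4 instructions at the head, the body and a jump back, hence the
    summand 5; leaving the loop takes 2. With the 7 of setup this gives the 9 in
    \<open>cost\<close>.\<close>
  have loop: "\<exists>t v. steps w P t u v \<and> t \<le> bitlen (reg u r) * (cost L c + 5) + 2 \<and>
      pc v = pc x + clen c + 12 \<and> represents v ((?f ^^ bitlen (reg u r)) st')"
    if "pc u = ?h" "represents u st'" "15 \<notin> puts c \<and> bitlen (snd st' 15 0) \<le> L" for u st'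
    using that
  proof (induction "reg u r" arbitrary: u st' rule: less_induct)
    case less
    have cd: "?h < length P" "P ! ?h = Imm 32 0" "Suc ?h < length P"
      "P ! Suc ?h = Branch_Eq r 32 (pc x + clen c + 12)"
      "Suc (Suc ?h) < length P" "P ! Suc (Suc ?h) = Imm 32 2"
      "Suc (Suc (Suc ?h)) < length P" "P ! Suc (Suc (Suc ?h)) = Alu Div r r 32"
      using cc(3) by (auto simp: code_at_Cons)
    have r: "r < 32" "r \<notin> writes c" "com_ok c" using Bits.prems by auto
    show ?case
    proof (cases "reg u r = 0")
      case True
      let ?v = "u\<lparr>pc := pc x + clen c + 12, reg := (reg u)(32 := 0)\<rparr>"
      have "steps w P (Suc (Suc 0)) u ?v"
        using cd less.prems True r by (intro steps_Suc steps_1) (auto simp: steps_def)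
      moreover have "represents ?v st'" using less.prems r by (auto simp: represents_def)
      ultimately show ?thesis
        using True by (intro exI[of _ "Suc (Suc 0)"] exI[of _ ?v]) auto
    next
      case False
      let ?v = "u\<lparr>pc := pc x + 11, reg := (reg u)(32 := 2, r := reg u r div 2)\<rparr>"
      let ?st = "((fst st')(r := fst st' r div 2), snd st')"
      have v: "steps w P (Suc (Suc (Suc (Suc 0)))) u ?v"
        using cd less.prems False r w2
        by (intro steps_Suc) (auto simp: steps_def fun_upd_twist)
      have rv: "represents ?v ?st"
        using less.prems r by (auto simp: represents_def)
      with Bits.IH[of ?v ?st] r cc(4) less.prems obtain t s where
        s: "steps w P t ?v s" "t \<le> cost L c" "pc s = pc x + 11 + clen c" "represents s (exec w c ?st)"
        by auto
      let ?q = "s\<lparr>pc := ?h\<rparr>"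
      have q: "steps w P (Suc 0) s ?q"
        using cc(5) s by (intro steps_1) (auto simp: code_at_Cons)
      have rq: "represents ?q (?f st')" using s by (simp add: represents_def)
      have "reg s r = fst (exec w c ?st) r" using s r by (simp add: represents_def)
      also have "\<dots> = fst ?st r" using r by (intro exec_unwritten)
      also have "\<dots> = reg u r div 2" using less.prems r by (simp add: represents_def)
      finally have rr: "reg ?q r = reg u r div 2" by simp
      have "15 \<notin> puts c \<and> bitlen (snd (?f st') 15 0) \<le> L"
        using less.prems exec_unput[of 15 c w ?st] by simp
      with less.hyps[of ?q "?f st'"] rq rr False obtain t' p where
        p: "steps w P t' ?q p" "t' \<le> bitlen (reg u r div 2) * (cost L c + 5) + 2"
          "pc p = pc x + clen c + 12" "represents p ((?f ^^ bitlen (reg u r div 2)) (?f st'))"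
        by auto
      have b: "bitlen (reg u r) = Suc (bitlen (reg u r div 2))"
        using False by (simp add: bitlen.simps)
      show ?thesis
        using steps_trans[OF steps_trans[OF steps_trans[OF v s(1)] q] p(1)] p s
        unfolding b funpow_Suc_right o_apply
        by (intro exI[of _ "Suc (Suc (Suc (Suc 0))) + t + Suc 0 + t'"] exI[of _ p]) auto
    qed
  qed
  have "represents ?z ((fst st)(r := snd st 15 0), snd st)"
    using y Bits.prems by (auto simp: represents_def)
  with loop[of ?z "((fst st)(r := snd st 15 0), snd st)"] Bits.prems obtain t v where
    v: "steps w P t ?z v" "t \<le> bitlen (snd st 15 0) * (cost L c + 5) + 2"
      "pc v = pc x + clen c + 12" "represents v (exec w (Bits r c) st)"
    by auto
  have "bitlen (snd st 15 0) * (cost L c + 5) \<le> L * (cost L c + 5)"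
    using Bits.prems by (intro mult_right_mono) auto
  with v(2) have "6 + Suc 0 + t \<le> cost L (Bits r c)" by (simp only: cost.simps)
  with v steps_trans[OF steps_trans[OF y(1) z] v(1)] show ?case
    by (intro exI[of _ "6 + Suc 0 + t"] exI[of _ v]) (simp only: clen.simps, simp)
qed

section \<open>Exact running time and space of compiled programs\<close>

lemma halted_steps: "halted P x \<Longrightarrow> (step w P ^^ t) x = x"
  by (induction t) (auto simp: step_def)

lemma card_accessed_le: "card (accessed P x) \<le> 1"
  by (cases "P ! pc x") (auto simp: accessed_def)

lemma card_Union_accessed_le: "card (\<Union>i<t. accessed P (f i)) \<le> t"
proof -
  have "card (\<Union>i<t. accessed P (f i)) \<le> (\<Sum>i<t. card (accessed P (f i)))"
    by (rule card_UN_le) simp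
  also have "\<dots> \<le> (\<Sum>i<t. 1)" by (rule sum_mono) (rule card_accessed_le)
  finally show ?thesis by simp
qed

text \<open>\<open>runs\<close> asks for the first moment of halting, while compiler correctness
  yields some moment at which the machine has halted. A halted machine does not change, so the least
  such moment has the same final state. Space is bounded by time because an instruction accesses at
  most one cell.\<close>

lemma steps_halted_runs:
  assumes "steps w P t (start args m) y" "halted P y"
  shows "\<exists>time space. runs w P args m time space y \<and> time \<le> t \<and> space \<le> t"
proof -
  let ?x = "\<lambda>i. (step w P ^^ i) (start args m)"
  let ?H = "\<lambda>i. halted P (?x i)"
  define k where "k = (LEAST i. ?H i)"
  have t: "?H t" using assms unfolding steps_def by (simp only:)
  have k: "?H k" unfolding k_def by (rule LeastI[of ?H, OF t])
  have kt: "k \<le> t" unfolding k_def by (rule Least_le[of ?H, OF t])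
  have min: "\<not> ?H i" if "i < k" for i
    using not_less_Least[of i ?H] that unfolding k_def by blast
  have "?x t = (step w P ^^ (t - k)) (?x k)"
    using kt funpow_add[of "t - k" k "step w P"] by simp
  then have "y = ?x k" using assms(1) halted_steps[OF k] unfolding steps_def by (simp only:)
  then have "runs w P args m k (card (\<Union>i<k. accessed P (?x i))) y"
    using k min by (simp add: runs_def)
  moreover have "card (\<Union>i<k. accessed P (?x i)) \<le> t"
    using card_Union_accessed_le[where f = ?x and t = k] kt by (rule le_trans)
  ultimately show ?thesis using kt by blast
qed

lemma runs_unique:
  assumes "runs w P args m t s y" "runs w P args m t' s' y'"
  shows "y = y'"
proof -
  have "t = t'"
    using assms unfolding runs_def Let_def by (metis linorder_neqE_nat)
  then show ?thesis using assms by (simp add: runs_def Let_def)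
qed

definition initial :: "nat list \<Rightarrow> (nat \<Rightarrow> nat) \<Rightarrow> store" where
  "initial args m = (\<lambda>i. if i < length args then args ! i else 0, \<lambda>j i. m (16 * i + j))"

theorem compile_runs:
  assumes "5 \<le> w" "com_ok c"
    "15 \<notin> puts c \<and> bitlen (m 15) \<le> L \<or> loop_free c"
  shows "\<exists>time space y. runs w (compile c 0) args m time space y \<and> time \<le> cost L c \<and>
    space \<le> cost L c \<and> represents y (exec w c (initial args m))"
proof -
  let ?P = "compile c 0"
  have "represents (start args m) (initial args m)"
    by (auto simp: represents_def start_def initial_def)
  moreover have "code_at ?P 0 ?P" by (auto simp: code_at_def)
  ultimately obtain t y where y: "steps w ?P t (start args m) y" "t \<le> cost L c" "pc y = clen c"
      "represents y (exec w c (initial args m))"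
    using compile_correct[of w c ?P "start args m" "initial args m" L] assms
    by (auto simp: start_def initial_def)
  then have "halted ?P y" by (simp add: halted_def)
  with steps_halted_runs[OF y(1)] y show ?thesis by (meson le_trans)
qed

text \<open>The machine is deterministic, so a run assumed in \<open>reachable\<close> is the one
  computed by \<open>exec\<close>.\<close>

lemma runs_exec:
  assumes "5 \<le> w" "com_ok c" "15 \<notin> puts c \<or> loop_free c"
    "runs w (compile c 0) args m time space y"
  shows "represents y (exec w c (initial args m))"
  using compile_runs[OF assms(1,2), of m "bitlen (m 15)" args] assms(3,4) runs_unique by blast

lemma runs_within_compile:
  assumes "5 \<le> w" "com_ok c" "15 \<notin> puts c \<and> bitlen (m 15) \<le> L \<or> loop_free c"
    "cost L c \<le> T" "cost L c \<le> S"
  shows "runs_within w (compile c 0) args m T S"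
  using compile_runs[of w c m L args] assms unfolding runs_within_def by (meson le_trans)

lemma mem_code_without_Store:
  assumes "\<And>a r. Store a r \<notin> set P"
  shows "mem ((step w P ^^ t) x) = mem x"
proof (induction t)
  case (Suc t)
  have "mem (step w P x) = mem x" for x
  proof (cases "halted P x")
    case False
    then have "P ! pc x \<in> set P" by (simp add: halted_def)
    with assms have "\<And>a r. P ! pc x \<noteq> Store a r" by metis
    then show ?thesis using False by (cases "P ! pc x") (auto simp: step_def)
  qed (simp add: step_def)
  with Suc show ?case by simp
qed simp

lemma Store_notin_compile_exp: "Store a r \<notin> set (compile_exp e q)"
  by (induction e arbitrary: q) (auto simp: address_def)

lemma Store_notin_compile: "puts c = {} \<Longrightarrow> Store a r \<notin> set (compile c l)"
proof (induction c arbitrary: l)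
  case (Cond t a b c d)
  then show ?case by (cases t) (auto simp: Store_notin_compile_exp)
qed (auto simp: address_def Store_notin_compile_exp)

lemma answers_compile:
  assumes "5 \<le> w" "com_ok c" "puts c = {}" "loop_free c" "cost 0 c \<le> T" "cost 0 c \<le> S"
    "fst (exec w c (initial args m)) 0 = r"
  shows "answers w (compile c 0) args m T S r"
proof -
  from compile_runs[OF assms(1,2), of m 0 args] assms(4) obtain time space y where
    y: "runs w (compile c 0) args m time space y" "time \<le> cost 0 c" "space \<le> cost 0 c"
      "represents y (exec w c (initial args m))" by blast
  have "mem y = mem (start args m)"
    using y(1) mem_code_without_Store[of "compile c 0" time w "start args m"] Store_notin_compile[OF assms(3)]
    by (simp add: runs_def Let_def)
  moreover have "reg y 0 = r" using y(4) assms(7) by (simp add: represents_def)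
  ultimately show ?thesis
    using y assms(5,6) unfolding answers_def by (auto simp: start_def intro!: exI)
qed

section \<open>Words and addresses\<close>

text \<open>A pairing in the style of Cantor that needs no division: since
  \<open>x <= x + y\<close>, adding \<open>x\<close> to the square of \<open>x + y\<close> stays
  below the next square.\<close>

definition pair :: "nat \<Rightarrow> nat \<Rightarrow> nat" where
  "pair x y = (x + y) * (x + y) + x"

lemma pair_inj [simp]: "pair x y = pair x' y' \<longleftrightarrow> x = x' \<and> y = y'"
proof
  assume eq: "pair x y = pair x' y'"
  have *: "a + b \<ge> a' + b'" if "pair a b = pair a' b'" for a b a' b'
  proof (rule ccontr)
    assume "\<not> a + b \<ge> a' + b'"
    then have "a + b + 1 \<le> a' + b'" by simp
    then have "(a + b + 1) * (a + b + 1) \<le> (a' + b') * (a' + b')" by (intro mult_le_mono)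
    with that show False by (simp add: pair_def algebra_simps)
  qed
  have "x + y = x' + y'" using *[of x y x' y'] *[of x' y' x y] eq by linarith
  with eq show "x = x' \<and> y = y'" by (simp add: pair_def)
qed simp

lemma less_power_bitlen: "n < 2 ^ bitlen n"
proof (induction n rule: bitlen.induct)
  case (1 n)
  then show ?case by (cases "n = 0") (auto simp: bitlen.simps[of n])
qed

lemma bitlen_le: "n < 2 ^ k \<Longrightarrow> bitlen n \<le> k"
proof (induction n arbitrary: k rule: bitlen.induct)
  case (1 n)
  show ?case
  proof (cases "n = 0")
    case False
    then obtain k' where k: "k = Suc k'" using 1(2) by (cases k) auto
    with 1(2) have "n div 2 < 2 ^ k'" by auto
    with 1(1)[OF False] False k show ?thesis by (simp add: bitlen.simps[of n])
  qed simp
qed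

text \<open>A zero entry means absence. An equation for the graph fixes the stored entries and the
  emptiness of all other slots at the same time.\<close>

definition graph :: "nat \<Rightarrow> (nat \<Rightarrow> nat) \<Rightarrow> (nat \<times> nat) set" where
  "graph R f = {(x, k). x < R \<and> f x = k \<and> k \<noteq> 0}"

lemma graph_iff: "(x, k) \<in> graph R f \<longleftrightarrow> x < R \<and> f x = k \<and> k \<noteq> 0"
  by (simp add: graph_def)

lemma graph_upd:
  "x < R \<Longrightarrow> k \<noteq> 0 \<Longrightarrow> graph R (f(x := k)) = insert (x, k) {y \<in> graph R f. fst y \<noteq> x}"
  by (auto simp: graph_def)

lemma graph_upd_0: "graph R (f(x := 0)) = {y \<in> graph R f. fst y \<noteq> x}"
  by (auto simp: graph_def)

definition move :: "bool \<Rightarrow> alu_op" where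
  "move d = (if d then Add else Sub)"

text \<open>\<open>N\<close> bounds the length of the string. \<open>room\<close> ensures that the
  \<open>pair\<close> of a node index, below \<open>N + 2\<close>, with a letter code, below
  \<open>16 * (N + 2)\<close>, or with a bit number, at most \<open>w\<close>, is an array
  index.\<close>

locale word_ram =
  fixes w \<sigma> N :: nat
  assumes w5: "5 \<le> w"
    and sigma_pos: "1 \<le> \<sigma>" and sigma_less: "\<sigma> < 2 ^ w"
    and N2: "2 \<le> N"
    and room: "(17 * (N + 2) + 16 + w) * (17 * (N + 2) + 16 + w) + (N + 2) < 2 ^ (w - 4)"
begin

abbreviation R :: nat where "R \<equiv> 2 ^ (w - 4)"

lemma word_eq: "(2::nat) ^ w = 16 * R"
proof -
  have "(2::nat) ^ w = 2 ^ (4 + (w - 4))" using w5 by simp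
  then show ?thesis by (simp only: power_add) simp
qed

lemma R_less: "R < 2 ^ w" unfolding word_eq by simp

lemma small_less_R: "x \<le> 17 * (N + 2) + 16 + w \<Longrightarrow> x < R"
  using room le_square[of "17 * (N + 2) + 16 + w"] by linarith

lemma small_less_word: "x \<le> 17 * (N + 2) + 16 + w \<Longrightarrow> x < 2 ^ w"
  using small_less_R R_less less_trans by blast

lemma pair_less_R:
  assumes "x < N + 2" "y < 16 * (N + 2) + 16 + w"
  shows "pair x y < R"
proof -
  have "x + y \<le> 17 * (N + 2) + 16 + w" using assms by simp
  then have "(x + y) * (x + y) \<le> (17 * (N + 2) + 16 + w) * (17 * (N + 2) + 16 + w)"
    by (rule mult_le_mono) fact
  with room assms(1) show ?thesis unfolding pair_def by linarith
qed

definition bits :: nat where "bits = bitlen \<sigma>"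

lemma bits_le: "bits \<le> w" unfolding bits_def by (rule bitlen_le[OF sigma_less])

lemma less_bits: "c < \<sigma> \<Longrightarrow> c < 2 ^ bits"
  using less_power_bitlen[of \<sigma>] by (simp add: bits_def)

section \<open>Circular positions\<close>

text \<open>The string is a window of a circular array of size \<open>R\<close>. The integers let
  either end move below 0.\<close>

definition pos :: "bool \<Rightarrow> nat \<Rightarrow> nat \<Rightarrow> nat" where
  "pos d P i = nat ((if d then int P + int i else int P - int i) mod int R)"

lemma int_pos: "int (pos d P i) = (if d then int P + int i else int P - int i) mod int R"
  by (simp add: pos_def)

lemma pos_less [simp]: "pos d P i < R"
proof -
  have "int (pos d P i) < int R" unfolding int_pos by (rule pos_mod_bound) simp
  then show ?thesis by (simp only: of_nat_less_iff)
qed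

text \<open>Positions are kept as full words and reduced only on access. As \<open>R\<close> divides
  \<open>2 ^ w\<close>, a wrap at \<open>2 ^ w\<close> does not change the slot.\<close>

lemma int_alu_move:
  assumes "i \<le> 2 ^ w"
  shows "int (alu w (move d) P i) mod int R = (if d then int P + int i else int P - int i) mod int R"
proof -
  have dv: "int R dvd 2 ^ w" using word_eq by (metis dvd_triv_right of_nat_mult of_nat_numeral of_nat_power)
  show ?thesis
  proof (cases d)
    case True
    then show ?thesis using dv by (simp add: move_def of_nat_mod mod_mod_cancel)
  next
    case False
    have eq: "int (P + 2 ^ w - i) = int P - int i + 2 ^ w" using assms by (simp add: of_nat_diff)
    have "int (alu w (move d) P i) = int (P + 2 ^ w - i) mod 2 ^ w"
      using False by (simp add: move_def of_nat_mod)
    then have "int (alu w (move d) P i) = (int P - int i + 2 ^ w) mod 2 ^ w"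
      unfolding eq .
    then show ?thesis using dv False by (simp add: mod_mod_cancel)
  qed
qed

lemma alu_move_mod: "i \<le> 2 ^ w \<Longrightarrow> alu w (move d) P i mod R = pos d P i"
proof -
  assume "i \<le> 2 ^ w"
  then have "int (alu w (move d) P i mod R) = int (pos d P i)"
    using int_alu_move[of i d P] by (simp add: int_pos of_nat_mod)
  then show ?thesis by (simp only: of_nat_eq_iff)
qed

lemma pos_cong:
  assumes "(if d then int P + int i else int P - int i) mod int R =
    (if d' then int P' + int i' else int P' - int i') mod int R"
  shows "pos d P i = pos d' P' i'"
  using assms by (simp add: pos_def)

lemma pos_shift:
  assumes "int Q mod int R = x mod int R"
    "(if d then x + int i else x - int i) mod int R = (if d' then int P' + int i' else int P' - int i') mod int R"
  shows "pos d Q i = pos d' P' i'"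
proof (rule pos_cong)
  have "(int Q + int i) mod int R = (x + int i) mod int R"
    "(int Q - int i) mod int R = (x - int i) mod int R"
    using assms(1) by (metis mod_add_left_eq, metis mod_diff_left_eq)
  then show "(if d then int Q + int i else int Q - int i) mod int R =
    (if d' then int P' + int i' else int P' - int i') mod int R"
    using assms(2) by (cases d) auto
qed

lemma pos_back: "pos d (alu w (move (\<not> d)) P 1) (Suc i) = pos d P i"
  by (rule pos_shift[OF int_alu_move]) (auto simp: algebra_simps)

lemma pos_forth: "pos d (alu w (move d) P 1) i = pos d P (Suc i)"
  by (rule pos_shift[OF int_alu_move]) (auto simp: algebra_simps)

text \<open>Turns the end of a suffix and its length into the place where it starts.\<close>

lemma pos_return: "a \<le> 2 ^ w \<Longrightarrow> b \<le> a \<Longrightarrow> pos (\<not> d) (alu w (move d) P a) b = pos d P (a - b)"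
  by (rule pos_shift[OF int_alu_move]) (auto simp: algebra_simps of_nat_diff)

lemma pos_0: "pos d P 0 = P mod R"
  by (simp add: pos_def nat_mod_distrib)
    (metis nat_int of_nat_mod of_nat_numeral of_nat_power)

lemma pos_inj:
  assumes "i < R" "j < R"
  shows "pos d P i = pos d P j \<longleftrightarrow> i = j"
proof
  assume "pos d P i = pos d P j"
  then have "int (pos d P i) = int (pos d P j)" by simp
  then have "int R dvd int i - int j \<or> int R dvd int j - int i"
    unfolding int_pos mod_eq_dvd_iff by (auto split: if_splits)
  then have "int R dvd \<bar>int i - int j\<bar>" by (metis abs_minus_commute dvd_abs_iff)
  moreover have "\<bar>int i - int j\<bar> < int R" using assms by linarith
  ultimately have "\<bar>int i - int j\<bar> = 0"
    using zdvd_not_zless[of "\<bar>int i - int j\<bar>" "int R"] by linarith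
  then show "i = j" by simp
qed simp

section \<open>Free lists\<close>

text \<open>An entry \<open>nf k\<close> stores the successor of the free index \<open>k\<close> minus \<open>k + 1\<close>, so that zeroed
  memory is the infinite free list \<open>M, M + 1, \<dots>\<close>.\<close>

fun chain :: "(nat \<Rightarrow> nat) \<Rightarrow> nat \<Rightarrow> nat list \<Rightarrow> nat \<Rightarrow> bool" where
  "chain nf f [] M \<longleftrightarrow> f = M"
| "chain nf f (k # ks) M \<longleftrightarrow> f = k \<and> chain nf ((k + 1 + nf k) mod 2 ^ w) ks M"

definition free_list :: "nat set \<Rightarrow> nat \<Rightarrow> (nat \<Rightarrow> nat) \<Rightarrow> bool" where
  "free_list U f nf \<longleftrightarrow> (\<exists>L M. chain nf f L M \<and> distinct L \<and> set L \<inter> U = {} \<and>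
     set L \<union> U = {2..<M} \<and> 2 \<le> M \<and> M \<le> N + 2 \<and> (\<forall>k. M \<le> k \<and> k < R \<longrightarrow> nf k = 0))"

lemma chain_cong: "(\<And>k. k \<in> set L \<Longrightarrow> nf k = nf' k) \<Longrightarrow> chain nf f L M = chain nf' f L M"
  by (induction nf f L M rule: chain.induct) auto

lemma free_list_bounds: "free_list U f nf \<Longrightarrow> k \<in> U \<Longrightarrow> 2 \<le> k \<and> k < N + 2"
proof -
  assume "free_list U f nf" "k \<in> U"
  then obtain L M where "set L \<union> U = {2..<M}" "M \<le> N + 2" unfolding free_list_def by blast
  with \<open>k \<in> U\<close> have "k \<in> {2..<M}" by blast
  with \<open>M \<le> N + 2\<close> show ?thesis by simp
qed

text \<open>If no released index is left, all of \<open>{2..<M}\<close> is in use, so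
  \<open>card U < N\<close> leaves room for \<open>M\<close>. Reuse thus keeps the indices below
  \<open>N + 2\<close> however many operations are performed.\<close>

lemma free_list_alloc:
  assumes "free_list U f nf" "card U < N"
  shows "f \<notin> U" "2 \<le> f" "f < N + 2" "free_list (insert f U) ((f + 1 + nf f) mod 2 ^ w) nf"
proof -
  obtain L M where L: "chain nf f L M" "distinct L" "set L \<inter> U = {}" "set L \<union> U = {2..<M}"
    "2 \<le> M" "M \<le> N + 2" "\<forall>k. M \<le> k \<and> k < R \<longrightarrow> nf k = 0"
    using assms(1) unfolding free_list_def by blast
  have "f \<notin> U \<and> 2 \<le> f \<and> f < N + 2 \<and> free_list (insert f U) ((f + 1 + nf f) mod 2 ^ w) nf"
  proof (cases L)
    case Nil
    then have U: "U = {2..<M}" and f: "f = M" using L by auto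
    with assms(2) have M: "M < N + 2" by simp
    then have "nf M = 0" using L(7) small_less_R[of M] by simp
    moreover have "(M + 1) mod 2 ^ w = M + 1" using small_less_word[of "M + 1"] M by simp
    ultimately have "free_list (insert f U) ((f + 1 + nf f) mod 2 ^ w) nf"
      unfolding free_list_def using U f L M by (intro exI[of _ "[]"] exI[of _ "M + 1"]) auto
    then show ?thesis using U f M L by auto
  next
    case (Cons k ks)
    with L have f: "f = k" "chain nf ((f + 1 + nf f) mod 2 ^ w) ks M" by auto
    have "f \<in> {2..<M}" using L(4) Cons f by auto
    moreover have "free_list (insert f U) ((f + 1 + nf f) mod 2 ^ w) nf"
      unfolding free_list_def using L Cons f by (intro exI[of _ ks] exI[of _ M]) auto
    ultimately show ?thesis using L Cons f by auto
  qed
  then show "f \<notin> U" "2 \<le> f" "f < N + 2" "free_list (insert f U) ((f + 1 + nf f) mod 2 ^ w) nf"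
    by auto
qed

lemma free_list_release:
  assumes "free_list U f nf" "k \<in> U" "f < 2 ^ w"
  shows "free_list (U - {k}) k (nf(k := (f + 2 ^ w - (k + 1) mod 2 ^ w) mod 2 ^ w))"
proof -
  obtain L M where L: "chain nf f L M" "distinct L" "set L \<inter> U = {}" "set L \<union> U = {2..<M}"
    "2 \<le> M" "M \<le> N + 2" "\<forall>k. M \<le> k \<and> k < R \<longrightarrow> nf k = 0"
    using assms(1) unfolding free_list_def by blast
  let ?nf = "nf(k := (f + 2 ^ w - (k + 1) mod 2 ^ w) mod 2 ^ w)"
  have k: "k \<in> {2..<M}" "k \<notin> set L" using L assms(2) by auto
  then have small: "(k + 1) mod 2 ^ w = k + 1" "k + 1 < 2 ^ w"
    using small_less_word[of "k + 1"] L(6) by auto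
  have "(k + 1 + ?nf k) mod 2 ^ w = (k + 1 + (f + 2 ^ w - (k + 1))) mod 2 ^ w"
    unfolding small(1) by (simp only: fun_upd_same mod_add_right_eq)
  also have "\<dots> = f" using small(2) assms(3) by simp
  finally have "(k + 1 + ?nf k) mod 2 ^ w = f" .
  moreover have "chain ?nf f L M"
    using L(1) chain_cong[of L nf ?nf f M] k(2) by (metis fun_upd_apply)
  ultimately have "chain ?nf k (k # L) M" by (simp only: chain.simps)
  moreover have "set (k # L) \<inter> (U - {k}) = {}" "set (k # L) \<union> (U - {k}) = {2..<M}" "distinct (k # L)"
    using L k assms(2) by auto
  moreover have "?nf x = 0" if "M \<le> x \<and> x < R" for x using that L(7) k by simp
  ultimately show ?thesis unfolding free_list_def using L(5,6) by blast
qed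

lemma free_list_head_less: "free_list U f nf \<Longrightarrow> f < 2 ^ w"
proof -
  assume "free_list U f nf"
  then obtain L M where L: "chain nf f L M" "set L \<union> U = {2..<M}" "M \<le> N + 2"
    unfolding free_list_def by blast
  have "f \<le> N + 2"
  proof (cases L)
    case (Cons k ks)
    with L have "f \<in> {2..<M}" by auto
    with L show ?thesis by simp
  qed (use L in simp)
  then show ?thesis by (intro small_less_word) simp
qed

end

section \<open>Memory layout and programs\<close>

text \<open>Array 0 holds scalars: the length at 1, the positions of the first and the last letter at 2
  and 3, the heads of the two free lists at 4 and 5. Arrays 2 and 3 hold the nodes of the surfaces
  that start and that end at a position. The index of a node is its handle minus 1, so that zeroed
  memory describes the odd root, with index 0. \<open>LEN\<close> is shifted by 1 for the same reason.
  Arrays 11 and 14 are the free lists of node indices and of block numbers.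

  Everything is programmed for the head of a list that is either the string (direction
  \<open>True\<close>) or its reverse (direction \<open>False\<close>). Throughout a push or a pop, register 0 holds the
  letter, 1 the old length, 2 the position of the letter, 3 the node of the longest palindromic prefix (in a push
  first of the old list, then of the new one), 4 the code of the letter, and 9 the link of the node
  in 3; register 6 holds the centre during a push.\<close>

abbreviation (input) TEXT :: nat where "TEXT \<equiv> 1"
abbreviation (input) LEN :: nat where "LEN \<equiv> 4"
abbreviation (input) LINK :: nat where "LINK \<equiv> 5"
abbreviation (input) LAB :: nat where "LAB \<equiv> 6"
abbreviation (input) ALT :: nat where "ALT \<equiv> 7"
abbreviation (input) EDGE :: nat where "EDGE \<equiv> 8"
abbreviation (input) NEXT :: nat where "NEXT \<equiv> 9"
abbreviation (input) REF :: nat where "REF \<equiv> 10"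
abbreviation (input) COUNT :: nat where "COUNT \<equiv> 12"
abbreviation (input) BUCK :: nat where "BUCK \<equiv> 13"

definition near :: "bool \<Rightarrow> nat" where "near d = (if d then 2 else 3)"

definition pair_e :: "aexp \<Rightarrow> aexp \<Rightarrow> aexp" where
  "pair_e a b = Bin Add (Bin Mul (Bin Add a b) (Bin Add a b)) a"

definition search_body :: "nat \<Rightarrow> com" where
  "search_body q =
     If_Eq (Bin Mod (Arr LAB (Var q)) (Bin Shl (Const 2) (Var 7)))
           (Bin Mod (Var 0) (Bin Shl (Const 2) (Var 7)))
       Skip
       (Set q (Arr ALT (pair_e (Var q) (Var 7)))) ;;
     Set 7 (Bin Add (Var 7) (Const 1))"

definition search :: "nat \<Rightarrow> com" where
  "search q = Set 7 (Const 0) ;; Bits 8 (search_body q) ;; Set q (Arr LINK (Var q))"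

text \<open>Entry \<open>i\<close> of the new row is the nearest ancestor that agrees with the new
  label below bit \<open>i\<close> and differs at it. If the current node differs at bit
  \<open>i\<close>, it is that ancestor and the walk moves on to its alternative; if it agrees, the
  entry is inherited from its row.\<close>

definition build_body :: com where
  "build_body =
     If_Eq (Bin Mod (Arr LAB (Var 6)) (Bin Shl (Const 2) (Var 7)))
           (Bin Mod (Var 10) (Bin Shl (Const 2) (Var 7)))
       (Put ALT (pair_e (Var 3) (Var 7)) (Arr ALT (pair_e (Var 6) (Var 7))))
       (Put ALT (pair_e (Var 3) (Var 7)) (Var 6) ;;
        Set 6 (Arr ALT (pair_e (Var 6) (Var 7)))) ;;
     Set 7 (Bin Add (Var 7) (Const 1))"

definition build :: com where
  "build = Set 6 (Var 9) ;; Set 7 (Const 0) ;; Bits 8 build_body"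

definition alloc :: "nat \<Rightarrow> nat \<Rightarrow> nat \<Rightarrow> com" where
  "alloc r cell nf =
     Set r (Arr 0 (Const cell)) ;;
     Put 0 (Const cell) (Bin Add (Bin Add (Var r) (Const 1)) (Arr nf (Var r)))"

definition release :: "nat \<Rightarrow> nat \<Rightarrow> nat \<Rightarrow> com" where
  "release r cell nf =
     Put nf (Var r) (Bin Sub (Arr 0 (Const cell)) (Bin Add (Var r) (Const 1))) ;;
     Put 0 (Const cell) (Var r)"

definition code_e :: aexp where
  "code_e = Bin Add (Bin Mul (Arr BUCK (Bin Div (Var 0) (Const 16))) (Const 16)) (Bin Mod (Var 0) (Const 16))"

definition count_char :: com where
  "count_char =
     Set 4 (Bin Div (Var 0) (Const 16)) ;;
     If_Eq (Arr COUNT (Var 4)) (Const 0) (alloc 5 5 14 ;; Put BUCK (Var 4) (Var 5)) Skip ;;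
     Put COUNT (Var 4) (Bin Add (Arr COUNT (Var 4)) (Const 1)) ;;
     Set 4 code_e"

definition uncount_char :: com where
  "uncount_char =
     Set 4 (Bin Div (Var 0) (Const 16)) ;;
     Put COUNT (Var 4) (Bin Sub (Arr COUNT (Var 4)) (Const 1)) ;;
     If_Eq (Arr COUNT (Var 4)) (Const 0)
       (Set 5 (Arr BUCK (Var 4)) ;; release 5 5 14 ;; Put BUCK (Var 4) (Const 0)) Skip"

text \<open>The direct link is computed first and overridden if the longest palindromic prefix
  itself extends. Since \<open>LEN\<close> is the length plus 1, it is the offset from the new
  letter to the letter that must equal it.\<close>

definition find_center :: "bool \<Rightarrow> com" where
  "find_center d =
     Set 6 (Var 3) ;; search 6 ;;
     If_Less (Var 1) (Arr LEN (Var 3)) Skip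
       (If_Eq (Arr TEXT (Bin (move d) (Var 2) (Arr LEN (Var 3)))) (Var 0) (Set 6 (Var 3)) Skip)"

text \<open>By symmetry, the letter in front of the link as a suffix is the letter behind the link
  as a prefix; it is read from the text.\<close>

definition init_node :: "bool \<Rightarrow> com" where
  "init_node d =
     Put LEN (Var 3) (Bin Add (Arr LEN (Var 6)) (Const 2)) ;;
     Put LINK (Var 3) (Var 9) ;;
     Set 10 (Arr TEXT (Bin (move d) (Var 2) (Bin Sub (Arr LEN (Var 9)) (Const 1)))) ;;
     Put LAB (Var 3) (Var 10) ;;
     Put EDGE (Var 3) (Var 5) ;;
     Put NEXT (Var 5) (Var 3) ;;
     Put REF (Var 3) (Const 0) ;;
     Put REF (Var 9) (Bin Add (Arr REF (Var 9)) (Const 1))"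

text \<open>The new node is entered only after its link has been looked up. If the lookup fails, the
  new palindrome is a single letter and its link is the even root, of index 1.\<close>

definition create_node :: "bool \<Rightarrow> com" where
  "create_node d =
     Set 9 (Var 6) ;; search 9 ;;
     Set 9 (Arr NEXT (pair_e (Var 9) (Var 4))) ;;
     If_Eq (Var 9) (Const 0) (Set 9 (Const 1)) Skip ;;
     alloc 3 4 11 ;;
     init_node d ;;
     build"

definition ensure_node :: "bool \<Rightarrow> com" where
  "ensure_node d =
     Set 5 (pair_e (Var 6) (Var 4)) ;;
     Set 3 (Arr NEXT (Var 5)) ;;
     If_Eq (Var 3) (Const 0) (create_node d) Skip"

text \<open>A nonzero entry at the end of the new prefix belongs to the buried surface. Its end slot
  is overwritten; its start slot, found through its length, is cleared.\<close>

definition add_surface :: "bool \<Rightarrow> com" where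
  "add_surface d =
     Set 5 (Bin (move d) (Var 2) (Bin Sub (Arr LEN (Var 3)) (Const 2))) ;;
     Set 6 (Arr (near (\<not> d)) (Var 5)) ;;
     If_Eq (Var 6) (Const 0) Skip
       (Put REF (Var 6) (Bin Sub (Arr REF (Var 6)) (Const 1)) ;;
        Put (near d) (Bin (move (\<not> d)) (Var 5) (Bin Sub (Arr LEN (Var 6)) (Const 2))) (Const 0)) ;;
     Put (near (\<not> d)) (Var 5) (Var 3) ;;
     Put (near d) (Var 2) (Var 3) ;;
     Put REF (Var 3) (Bin Add (Arr REF (Var 3)) (Const 1))"

definition push :: "bool \<Rightarrow> com" where
  "push d =
     Set 1 (Arr 0 (Const 1)) ;;
     Set 2 (Arr 0 (Const (near d))) ;;
     Set 3 (Arr (near d) (Var 2)) ;;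
     Set 2 (Bin (move (\<not> d)) (Var 2) (Const 1)) ;;
     Put TEXT (Var 2) (Var 0) ;;
     count_char ;;
     find_center d ;;
     ensure_node d ;;
     add_surface d ;;
     Put 0 (Const 1) (Bin Add (Var 1) (Const 1)) ;;
     Put 0 (Const (near d)) (Var 2)"

definition drop_node :: com where
  "drop_node =
     If_Eq (Arr REF (Var 3)) (Const 0)
       (Put NEXT (Arr EDGE (Var 3)) (Const 0) ;;
        Put REF (Var 9) (Bin Sub (Arr REF (Var 9)) (Const 1)) ;;
        release 3 4 11)
       Skip"

text \<open>The test of \<open>buried_iff\<close>: the link is nonempty, that is, its
  \<open>LEN\<close> exceeds 1, and the slot of its start is empty.\<close>

definition unearth :: "bool \<Rightarrow> com" where
  "unearth d =
     If_Less (Const 1) (Arr LEN (Var 9))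
       (Set 6 (Bin (move (\<not> d)) (Var 5) (Bin Sub (Arr LEN (Var 9)) (Const 2))) ;;
        If_Eq (Arr (near d) (Var 6)) (Const 0)
          (Put (near d) (Var 6) (Var 9) ;;
           Put (near (\<not> d)) (Var 5) (Var 9) ;;
           Put REF (Var 9) (Bin Add (Arr REF (Var 9)) (Const 1)))
          Skip)
       Skip"

definition pop :: "bool \<Rightarrow> com" where
  "pop d =
     Set 1 (Arr 0 (Const 1)) ;;
     Set 2 (Arr 0 (Const (near d))) ;;
     Set 3 (Arr (near d) (Var 2)) ;;
     Set 0 (Arr TEXT (Var 2)) ;;
     Set 9 (Arr LINK (Var 3)) ;;
     Set 5 (Bin (move d) (Var 2) (Bin Sub (Arr LEN (Var 3)) (Const 2))) ;;
     Put (near d) (Var 2) (Const 0) ;;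
     Put (near (\<not> d)) (Var 5) (Const 0) ;;
     Put REF (Var 3) (Bin Sub (Arr REF (Var 3)) (Const 1)) ;;
     drop_node ;;
     unearth d ;;
     uncount_char ;;
     Put 0 (Const 1) (Bin Sub (Var 1) (Const 1)) ;;
     Put 0 (Const (near d)) (Bin (move d) (Var 2) (Const 1))"

text \<open>The last letter of the empty string is at position -1, one before the first.
  \<open>LEN\<close> is 1 for the even root, of length 0. All other entries of the roots are
  correctly zero.\<close>

definition init :: com where
  "init =
     Put 0 (Const 3) (Bin Sub (Const 0) (Const 1)) ;;
     Put 0 (Const 4) (Const 2) ;;
     Put 0 (Const 5) (Const 2) ;;
     Put LEN (Const 1) (Const 1) ;;
     Put 15 (Const 0) (Var 0)"

definition len_query :: com where
  "len_query = Set 0 (Bin Sub (Arr LEN (Bin Sub (Var 0) (Const 1))) (Const 1))"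

definition link_query :: com where
  "link_query = Set 0 (Bin Add (Arr LINK (Bin Sub (Var 0) (Const 1))) (Const 1))"

definition next_query :: com where
  "next_query =
     Set 2 (Bin Sub (Var 0) (Const 1)) ;;
     Set 0 (Var 1) ;;
     Set 0 (Arr NEXT (pair_e (Var 2) code_e)) ;;
     If_Eq (Var 0) (Const 0) Skip (Set 0 (Bin Add (Var 0) (Const 1)))"

definition alt :: "nat \<Rightarrow> nat node \<Rightarrow> nat node" where
  "alt i v = first_anc (\<lambda>x. x mod 2 ^ i = lab v mod 2 ^ i \<and> x mod 2 ^ Suc i \<noteq> lab v mod 2 ^ Suc i) (node_link v)"

definition code :: "arrays \<Rightarrow> nat \<Rightarrow> nat" where
  "code A c = 16 * A BUCK (c div 16) + c mod 16"

section \<open>Invariants of the stored structure\<close>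

context word_ram begin

text \<open>Nothing is required of indices outside the image of \<open>V\<close>, so the rows of
  deleted nodes need no cleaning.\<close>

definition nodes_inv :: "nat node set \<Rightarrow> (nat node \<Rightarrow> nat) \<Rightarrow> arrays \<Rightarrow> bool" where
  "nodes_inv V h A \<longleftrightarrow> h Odd = 0 \<and> h Even = 1 \<and> inj_on h V \<and>
     (\<forall>v\<in>V. h v < N + 2 \<and> A LEN (h v) = nat (node_len v + 1) \<and> A LINK (h v) = h (node_link v) \<and>
        A LAB (h v) = lab v \<and> (\<forall>i<bits. A ALT (pair (h v) i) = h (alt i v)))"

text \<open>\<open>EDGE\<close> remembers the address of the incoming edge, so that a deletion can
  clear it without knowing the centre. The equation for the graph excludes stale edges.\<close>

definition edges_inv :: "nat list set \<Rightarrow> (nat node \<Rightarrow> nat) \<Rightarrow> arrays \<Rightarrow> bool" where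
  "edges_inv S h A \<longleftrightarrow>
     graph R (A NEXT) = (\<lambda>(u, c). (pair (h u) (code A c), h (Pal (surround c u)))) ` {(u, c). surround c u \<in> S} \<and>
     (\<forall>u c. surround c u \<in> S \<longrightarrow> A EDGE (h (Pal (surround c u))) = pair (h u) (code A c))"

text \<open>A block that does not occur has number 0, so the codes of its letters are below 16,
  whereas those of letters in the string are at least 32.\<close>

definition bucket_inv :: "nat list \<Rightarrow> arrays \<Rightarrow> bool" where
  "bucket_inv s A \<longleftrightarrow>
     (\<forall>x<R. A COUNT x = length (filter (\<lambda>c. c div 16 = x) s)) \<and>
     (\<forall>x<R. A COUNT x = 0 \<longrightarrow> A BUCK x = 0) \<and>
     inj_on (A BUCK) ((\<lambda>c. c div 16) ` set s) \<and>
     free_list (A BUCK ` (\<lambda>c. c div 16) ` set s) (A 0 5) (A 14)"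

text \<open>Intervals are half-open, so the slot for the end is that of the last letter, at
  \<open>j - 1\<close>.\<close>

definition surf_inv :: "bool \<Rightarrow> nat list \<Rightarrow> (nat node \<Rightarrow> nat) \<Rightarrow> nat \<Rightarrow> arrays \<Rightarrow> bool" where
  "surf_inv d s h P A \<longleftrightarrow>
     graph R (A (near d)) = (\<lambda>(i, j). (pos d P i, h (Pal (factor s i j)))) ` surfaces s \<and>
     graph R (A (near (\<not> d))) = (\<lambda>(i, j). (pos d P (j - 1), h (Pal (factor s i j)))) ` surfaces s"

text \<open>The two end positions are tied together through the position one behind the last letter,
  computed from either side; this form also covers the empty string.\<close>

definition inv :: "bool \<Rightarrow> nat list \<Rightarrow> (nat node \<Rightarrow> nat) \<Rightarrow> arrays \<Rightarrow> bool" where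
  "inv d s h A \<longleftrightarrow> A 15 0 = \<sigma> \<and> A 0 1 = length s \<and> length s \<le> N \<and> set s \<subseteq> {..<\<sigma>} \<and>
     pos d (A 0 (near d)) (length s) = pos d (A 0 (near (\<not> d))) 1 \<and>
     (\<forall>i<length s. A TEXT (pos d (A 0 (near d)) i) = s ! i) \<and>
     surf_inv d s h (A 0 (near d)) A \<and>
     nodes_inv (eertree_nodes s) h A \<and> edges_inv (pals s) h A \<and>
     (\<forall>p\<in>pals s. A REF (h (Pal p)) = refs s p) \<and>
     free_list (h ` Pal ` pals s) (A 0 4) (A 11) \<and>
     bucket_inv s A"

lemma aval_pair_e:
  assumes "aval w a st < N + 2" "aval w b st < 16 * (N + 2) + 16 + w"
  shows "aval w (pair_e a b) st = pair (aval w a st) (aval w b st)"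
    and "pair (aval w a st) (aval w b st) mod R = pair (aval w a st) (aval w b st)"
proof -
  have less: "pair (aval w a st) (aval w b st) < R" using pair_less_R[OF assms] .
  then show "pair (aval w a st) (aval w b st) mod R = pair (aval w a st) (aval w b st)" by simp
  have "pair (aval w a st) (aval w b st) < 2 ^ w" using less R_less by linarith
  then show "aval w (pair_e a b) st = pair (aval w a st) (aval w b st)"
    unfolding pair_e_def aval.simps alu.simps
    by (simp add: pair_def mod_simps)
qed

text \<open>For \<open>Suc i = w\<close> the shifted modulus wraps to 0; since
  \<open>x mod 0 = x\<close>, whole words are compared, as intended.\<close>

lemma mod_shl:
  assumes "x < 2 ^ w" "i < w"
  shows "x mod alu w Shl (2 mod 2 ^ w) i = x mod 2 ^ Suc i"
proof (cases "Suc i = w")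
  case True
  then show ?thesis using assms by (simp add: mod_simps flip: True)
next
  case False
  then have "(2::nat) ^ Suc i < 2 ^ w" using assms by (intro power_strict_increasing) auto
  then show ?thesis by (simp add: mod_simps)
qed

section \<open>Bitwise search for direct links\<close>

definition agree :: "nat \<Rightarrow> nat \<Rightarrow> nat \<Rightarrow> bool" where
  "agree c i x \<longleftrightarrow> x mod 2 ^ i = c mod 2 ^ i"

lemma mod_Suc_power: "(x::nat) mod 2 ^ Suc i = 2 ^ i * (x div 2 ^ i mod 2) + x mod 2 ^ i"
  using mod_mult2_eq[of x "2 ^ i" 2] by (simp add: mult.commute)

lemma agree_Suc_imp: "agree c (Suc i) x \<Longrightarrow> agree c i x"
  unfolding agree_def by (metis le_add2 mod_mod_cancel le_imp_power_dvd plus_1_eq_Suc)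

text \<open>At bit \<open>i\<close> the letter \<open>y\<close> differs from \<open>c\<close>, so
  differing from \<open>y\<close> there is the same as agreeing with \<open>c\<close>. The left side
  does not mention \<open>c\<close> and can be precomputed.\<close>

lemma agree_flip:
  assumes "agree c i y" "\<not> agree c (Suc i) y"
  shows "x mod 2 ^ i = y mod 2 ^ i \<and> x mod 2 ^ Suc i \<noteq> y mod 2 ^ Suc i \<longleftrightarrow> agree c (Suc i) x"
proof -
  have b: "z div 2 ^ i mod 2 = 0 \<or> z div 2 ^ i mod 2 = 1" for z :: nat by auto
  show ?thesis
  proof (cases "x mod 2 ^ i = c mod 2 ^ i")
    case True
    then show ?thesis
      using assms b[of x] b[of y] b[of c] unfolding agree_def mod_Suc_power by auto
  next
    case False
    then show ?thesis using assms(1) agree_Suc_imp[of c i x] unfolding agree_def by metis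
  qed
qed

lemma first_anc_cases: "first_anc Q v = Odd \<or> Q (lab (first_anc Q v))"
proof (induction Q v rule: first_anc.induct)
  case (1 Q v)
  show ?case
  proof (cases "v = Odd \<or> Q (lab v)")
    case True
    then have "first_anc Q v = v" by (subst first_anc.simps) simp
    with True show ?thesis by auto
  next
    case False
    then have "first_anc Q v = first_anc Q (node_link v)" by (subst first_anc.simps) auto
    with 1[OF False] show ?thesis by simp
  qed
qed

text \<open>One round of the loop: by \<open>first_anc_mono\<close> the search for one more bit
  resumes at the node found so far, and by \<open>agree_flip\<close> the ancestor it needs is the
  stored \<open>alt\<close>.\<close>

lemma first_agree_Suc:
  fixes c i v
  defines "y \<equiv> first_anc (agree c i) v"
  shows "first_anc (agree c (Suc i)) v = (if lab y mod 2 ^ Suc i = c mod 2 ^ Suc i then y else alt i y)"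
proof -
  have *: "first_anc (agree c (Suc i)) v = first_anc (agree c (Suc i)) y"
    unfolding y_def by (rule first_anc_mono) (rule agree_Suc_imp)
  show ?thesis
  proof (cases "y = Odd")
    case True
    then show ?thesis using * by (simp add: alt_def)
  next
    case False
    then have y: "agree c i (lab y)" using first_anc_cases[of "agree c i" v] by (auto simp: y_def)
    show ?thesis
    proof (cases "agree c (Suc i) (lab y)")
      case True
      then show ?thesis using * by (simp add: first_anc.simps[of _ y]) (simp add: agree_def)
    next
      case F: False
      have "alt i y = first_anc (agree c (Suc i)) (node_link y)"
        unfolding alt_def agree_flip[OF y F] ..
      then show ?thesis using F \<open>y \<noteq> Odd\<close> * by (simp add: first_anc.simps[of _ y]) (simp add: agree_def)
    qed
  qed
qed

lemma first_anc_0: "first_anc (agree c 0) v = v"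
  by (simp add: first_anc.simps[of _ v] agree_def)

definition link_closed :: "nat node set \<Rightarrow> bool" where
  "link_closed V \<longleftrightarrow> Odd \<in> V \<and> Even \<in> V \<and> (\<forall>v\<in>V. node_link v \<in> V \<and> lab v < \<sigma>)"

lemma link_closed_first: "link_closed V \<Longrightarrow> v \<in> V \<Longrightarrow> first_anc Q v \<in> V"
proof (induction Q v rule: first_anc.induct)
  case (1 Q v)
  show ?case
  proof (cases "v = Odd \<or> Q (lab v)")
    case True
    then have "first_anc Q v = v" by (subst first_anc.simps) simp
    with 1 show ?thesis by simp
  next
    case False
    then have "first_anc Q v = first_anc Q (node_link v)" by (subst first_anc.simps) auto
    with 1 False show ?thesis by (simp add: link_closed_def)
  qed
qed

text \<open>Agreement in \<open>bits\<close> bits is equality only for numbers below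
  \<open>2 ^ bits\<close>; it suffices that all labels met on the chain are below
  \<open>\<sigma>\<close>.\<close>

lemma first_anc_cong:
  assumes "link_closed V" "v \<in> V" "\<And>x. x < \<sigma> \<Longrightarrow> Q x = Q' x"
  shows "first_anc Q v = first_anc Q' v"
  using assms
proof (induction Q v rule: first_anc.induct)
  case (1 Q v)
  have l: "lab v < \<sigma>" "node_link v \<in> V" using 1(2,3) by (auto simp: link_closed_def)
  show ?case
  proof (cases "v = Odd \<or> Q (lab v)")
    case True
    then have "first_anc Q v = v" by (subst first_anc.simps) simp
    moreover have "first_anc Q' v = v" using True 1(4)[OF l(1)] by (subst first_anc.simps) auto
    ultimately show ?thesis by simp
  next
    case False
    then have "first_anc Q v = first_anc Q (node_link v)" by (subst first_anc.simps) auto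
    moreover have "first_anc Q' v = first_anc Q' (node_link v)"
      using False 1(4)[OF l(1)] by (subst first_anc.simps) auto
    ultimately show ?thesis using 1(1)[OF False 1(2) l(2)] 1(4) by metis
  qed
qed

lemma lab_in_set: "v \<in> eertree_nodes s \<Longrightarrow> lab v = 0 \<or> lab v \<in> set s"
proof (cases v)
  case (Pal p)
  assume "v \<in> eertree_nodes s"
  with Pal have "sublist p s" by (simp add: Pal_in_nodes_iff)
  then have "set p \<subseteq> set s" by (rule set_mono_sublist)
  then show ?thesis using Pal length_lps_less[of p] nth_mem[of "length (lps p)" p]
    by (cases "p = []") (simp, metis lab.simps(2) subsetD)
qed simp

lemma link_closed_nodes: "set s \<subseteq> {..<\<sigma>} \<Longrightarrow> link_closed (eertree_nodes s)"
  using lab_in_set[of _ s] sigma_pos by (fastforce simp: link_closed_def node_link_in_nodes)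

lemma bits_less_idx: "i \<le> bits \<Longrightarrow> i < 16 * (N + 2) + 16 + w"
  using bits_le by simp

lemma bits_loop:
  assumes "snd st 15 0 = \<sigma>" "I 0 ((fst st)(r := \<sigma>), snd st)"
    "\<And>i \<rho> A. i < bits \<Longrightarrow> I i (\<rho>, A) \<Longrightarrow> I (Suc i) (exec w c (\<rho>(r := \<rho> r div 2), A))"
  shows "I bits (exec w (Bits r c) st)"
proof -
  have "i \<le> bits \<Longrightarrow> I i (((\<lambda>st. exec w c ((fst st)(r := fst st r div 2), snd st)) ^^ i) ((fst st)(r := \<sigma>), snd st))" for i
  proof (induction i)
    case (Suc i)
    let ?st = "((\<lambda>st. exec w c ((fst st)(r := fst st r div 2), snd st)) ^^ i) ((fst st)(r := \<sigma>), snd st)"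
    have "I i ?st" by (rule Suc.IH[OF Suc_leD[OF Suc.prems]])
    then have "I (Suc i) (exec w c ((fst ?st)(r := fst ?st r div 2), snd ?st))"
      using Suc.prems by (intro assms(3)) (simp_all only: prod.collapse Suc_le_eq)
    then show ?case by (simp only: funpow.simps(2) o_apply)
  qed (simp add: assms(2))
  then show ?thesis using assms(1) by (simp add: bits_def)
qed

lemma search_correct:
  assumes "nodes_inv V h A" "link_closed V" "v \<in> V" "A 15 0 = \<sigma>"
    "\<rho> q = h v" "c < \<sigma>" "\<rho> 0 = c" "q \<notin> {0, 7, 8}"
  shows "\<exists>\<rho>'. exec w (search q) (\<rho>, A) = (\<rho>', A) \<and> \<rho>' q = h (dlink c v) \<and>
    (\<forall>r. r \<notin> {q, 7, 8} \<longrightarrow> \<rho>' r = \<rho> r)"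
proof -
  note inv = assms(1)[unfolded nodes_inv_def]
  define y where "y i = first_anc (agree c i) v" for i
  define I where "I i st \<longleftrightarrow> snd st = A \<and> fst st q = h (y i) \<and> fst st 7 = i \<and>
      (\<forall>r. r \<notin> {q, 7, 8} \<longrightarrow> fst st r = \<rho> r)" for i and st :: store
  have cw: "c < 2 ^ w" using assms(6) sigma_less by linarith
  have y: "y i \<in> V" for i unfolding y_def using link_closed_first assms by blast
  have "I bits (exec w (Bits 8 (search_body q)) (\<rho>(7 := 0), A))"
  proof (rule bits_loop)
    show "I 0 ((fst (\<rho>(7 := 0), A))(8 := \<sigma>), snd (\<rho>(7 := 0), A))"
      using assms(5,8) by (simp add: I_def y_def first_anc_0)
  next
    fix i \<rho>' A' assume i': "i < bits" and I: "I i (\<rho>', A')"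
    then have r: "A' = A" "\<rho>' q = h (y i)" "\<rho>' 7 = i" "\<forall>r. r \<notin> {q, 7, 8} \<longrightarrow> \<rho>' r = \<rho> r"
      by (simp_all add: I_def)
    let ?\<rho> = "\<rho>'(8 := \<rho>' 8 div 2)"
    have i: "i < bits" "i < w" using i' bits_le by auto
    have hy: "h (y i) < N + 2" "A LAB (h (y i)) = lab (y i)" "A ALT (pair (h (y i)) i) = h (alt i (y i))"
      using inv y[of i] i by auto
    have lw: "lab (y i) < 2 ^ w" using y[of i] assms(2) sigma_less by (force simp: link_closed_def)
    have hR: "h (y i) mod R = h (y i)" using small_less_R[of "h (y i)"] hy(1) by simp
    have t: "aval w (Bin Mod (Arr LAB (Var q)) (Bin Shl (Const 2) (Var 7))) (?\<rho>, A) = lab (y i) mod 2 ^ Suc i"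
      "aval w (Bin Mod (Var 0) (Bin Shl (Const 2) (Var 7))) (?\<rho>, A) = c mod 2 ^ Suc i"
      using mod_shl[OF lw i(2)] mod_shl[OF cw i(2)] r assms(7,8) hR hy(2) by (auto simp del: power_Suc)
    have p: "aval w (Arr ALT (pair_e (Var q) (Var 7))) (?\<rho>, A) = h (alt i (y i))"
      using aval_pair_e[of "Var q" "(?\<rho>, A)" "Var 7"] r hy assms(8) bits_less_idx[of i] i by simp
    have s: "aval w (Bin Add (Var 7) (Const 1)) (\<rho>1, A) = Suc i" if "\<rho>1 7 = i" for \<rho>1
      using that small_less_word[of "Suc i"] i by simp
    have e: "exec w (search_body q) (?\<rho>, A) = (if lab (y i) mod 2 ^ Suc i = c mod 2 ^ Suc i
        then (?\<rho>(7 := Suc i), A) else (?\<rho>(q := h (alt i (y i)), 7 := Suc i), A))"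
      unfolding search_body_def exec.simps t p using s assms(8) r(3) by (simp del: aval.simps power_Suc)
    have "exec w (search_body q) (?\<rho>, A) = (?\<rho>(q := h (y (Suc i)), 7 := Suc i), A)"
    proof (cases "lab (y i) mod 2 ^ Suc i = c mod 2 ^ Suc i")
      case True
      then have "y (Suc i) = y i" using first_agree_Suc[of c i v] unfolding y_def by (metis (full_types))
      then have "?\<rho>(q := h (y (Suc i))) = ?\<rho>" using r(2) assms(8) by (simp add: fun_eq_iff)
      then show ?thesis unfolding e if_P[OF True] by (simp only:)
    next
      case False
      then have "y (Suc i) = alt i (y i)"
        using first_agree_Suc[of c i v] unfolding y_def by (metis (full_types))
      then show ?thesis unfolding e if_not_P[OF False] by (simp only:)
    qed
    then show "I (Suc i) (exec w (search_body q) (\<rho>'(8 := \<rho>' 8 div 2), A'))"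
      using r assms(8) by (simp add: I_def)
  qed (use assms(4) in simp)
  then obtain \<rho>' where
    r: "exec w (Bits 8 (search_body q)) (\<rho>(7 := 0), A) = (\<rho>', A)" "\<rho>' q = h (y bits)"
      "\<forall>r. r \<notin> {q, 7, 8} \<longrightarrow> \<rho>' r = \<rho> r" unfolding I_def by (metis prod.collapse)
  have eq: "y bits = first_anc (\<lambda>x. x = c) v"
    using assms(2,3) unfolding y_def
  proof (rule first_anc_cong)
    fix x assume "x < \<sigma>"
    then show "agree c bits x = (x = c)"
      using less_bits[of x] less_bits[OF assms(6)] by (auto simp: agree_def)
  qed
  have hR: "h (y bits) mod R = h (y bits)" "A LINK (h (y bits)) = h (dlink c v)"
    using small_less_R[of "h (y bits)"] inv y[of bits] by (auto simp: dlink_def eq)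
  have e0: "exec w (Set 7 (Const 0)) (\<rho>, A) = (\<rho>(7 := 0), A)" by simp
  have "exec w (search q) (\<rho>, A) = (\<rho>'(q := h (dlink c v)), A)"
    unfolding search_def exec.simps(4)[of w "Set 7 (Const 0)"] e0
    using r(1,2) hR by simp
  then show ?thesis using r by auto
qed

lemma build_correct:
  assumes "nodes_inv V h A" "link_closed V" "u \<in> V" "A 15 0 = \<sigma>"
    "\<rho> 9 = h u" "\<rho> 3 = k" "k < N + 2" "k \<notin> h ` V" "\<rho> 10 = b" "b < \<sigma>"
  shows "\<exists>\<rho>' A'. exec w build (\<rho>, A) = (\<rho>', A') \<and>
    (\<forall>r. r \<notin> {6, 7, 8} \<longrightarrow> \<rho>' r = \<rho> r) \<and> (\<forall>j. j \<noteq> ALT \<longrightarrow> A' j = A j) \<and>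
    (\<forall>x\<in>h ` V. \<forall>i. A' ALT (pair x i) = A ALT (pair x i)) \<and>
    (\<forall>i<bits. A' ALT (pair k i) = h (first_anc (\<lambda>x. x mod 2 ^ i = b mod 2 ^ i \<and> x mod 2 ^ Suc i \<noteq> b mod 2 ^ Suc i) u))"
proof -
  note inv = assms(1)[unfolded nodes_inv_def]
  define y where "y i = first_anc (agree b i) u" for i
  define z where "z i = first_anc (\<lambda>x. x mod 2 ^ i = b mod 2 ^ i \<and> x mod 2 ^ Suc i \<noteq> b mod 2 ^ Suc i) u" for i
  define I where "I i st \<longleftrightarrow> fst st 6 = h (y i) \<and> fst st 7 = i \<and>
      (\<forall>r. r \<notin> {6, 7, 8} \<longrightarrow> fst st r = \<rho> r) \<and> (\<forall>j. j \<noteq> ALT \<longrightarrow> snd st j = A j) \<and>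
      (\<forall>x\<in>h ` V. \<forall>i. snd st ALT (pair x i) = A ALT (pair x i)) \<and>
      (\<forall>i'<i. snd st ALT (pair k i') = h (z i'))" for i and st :: store
  have bw: "b < 2 ^ w" using assms(10) sigma_less by linarith
  have y: "y i \<in> V" for i unfolding y_def using link_closed_first assms by blast
  have z: "z i = (if lab (y i) mod 2 ^ Suc i = b mod 2 ^ Suc i then alt i (y i) else y i)" for i
  proof (cases "y i = Odd")
    case True
    have "z i = first_anc (\<lambda>x. x mod 2 ^ i = b mod 2 ^ i \<and> x mod 2 ^ Suc i \<noteq> b mod 2 ^ Suc i) (y i)"
      unfolding z_def y_def by (rule first_anc_mono) (simp add: agree_def)
    then show ?thesis using True by (simp add: alt_def)
  next
    case False
    then have ag: "lab (y i) mod 2 ^ i = b mod 2 ^ i"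
      using first_anc_cases[of "agree b i" u] by (auto simp: y_def agree_def)
    have "z i = first_anc (\<lambda>x. x mod 2 ^ i = b mod 2 ^ i \<and> x mod 2 ^ Suc i \<noteq> b mod 2 ^ Suc i) (y i)"
      unfolding z_def y_def by (rule first_anc_mono) (simp add: agree_def)
    also have "\<dots> = (if lab (y i) mod 2 ^ Suc i = b mod 2 ^ Suc i then alt i (y i) else y i)"
      using False ag by (simp add: first_anc.simps[of _ "y i"] alt_def del: power_Suc)
    finally show ?thesis .
  qed
  have "I bits (exec w (Bits 8 build_body) (\<rho>(6 := h u, 7 := 0), A))"
  proof (rule bits_loop)
    show "I 0 ((fst (\<rho>(6 := h u, 7 := 0), A))(8 := \<sigma>), snd (\<rho>(6 := h u, 7 := 0), A))"
      by (simp add: I_def y_def first_anc_0)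
  next
    fix i \<rho>' A' assume i': "i < bits" and I: "I i (\<rho>', A')"
    then have r: "\<rho>' 6 = h (y i)" "\<rho>' 7 = i" "\<forall>r. r \<notin> {6, 7, 8} \<longrightarrow> \<rho>' r = \<rho> r"
      "\<And>j. j \<noteq> ALT \<Longrightarrow> A' j = A j" "\<And>x i. x \<in> h ` V \<Longrightarrow> A' ALT (pair x i) = A ALT (pair x i)"
      "\<And>i'. i' < i \<Longrightarrow> A' ALT (pair k i') = h (z i')"
      unfolding I_def fst_conv snd_conv by blast+
    let ?\<rho> = "\<rho>'(8 := \<rho>' 8 div 2)"
    have i: "i < bits" "i < w" using i' bits_le by auto
    have hy: "h (y i) < N + 2" "A' LAB (h (y i)) = lab (y i)" "A' ALT (pair (h (y i)) i) = h (alt i (y i))"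
      using inv y[of i] i r(4)[of LAB] r(5)[of "h (y i)" i] by auto
    have lw: "lab (y i) < 2 ^ w" using y[of i] assms(2) sigma_less by (force simp: link_closed_def)
    have hR: "h (y i) mod R = h (y i)" using small_less_R[of "h (y i)"] hy(1) by simp
    have t: "aval w (Bin Mod (Arr LAB (Var 6)) (Bin Shl (Const 2) (Var 7))) (?\<rho>, A') = lab (y i) mod 2 ^ Suc i"
      "aval w (Bin Mod (Var 10) (Bin Shl (Const 2) (Var 7))) (?\<rho>, A') = b mod 2 ^ Suc i"
      using mod_shl[OF lw i(2)] mod_shl[OF bw i(2)] r assms(9) hR hy(2) by (auto simp del: power_Suc)
    have p: "aval w (Arr ALT (pair_e (Var 6) (Var 7))) (?\<rho>, A'') = A'' ALT (pair (h (y i)) i)" for A''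
      using aval_pair_e[of "Var 6" "(?\<rho>, A'')" "Var 7"] r hy bits_less_idx[of i] i by simp
    have p3: "aval w (pair_e (Var 3) (Var 7)) (?\<rho>, A') mod R = pair k i"
      using aval_pair_e[of "Var 3" "(?\<rho>, A')" "Var 7"] r assms(6,7) bits_less_idx[of i] i by simp
    have s: "aval w (Bin Add (Var 7) (Const 1)) (\<rho>1, A1) = Suc i" if "\<rho>1 7 = i" for \<rho>1 A1
      using that small_less_word[of "Suc i"] i by simp
    \<comment> \<open>The row being read and the row being written belong to different indices, so
      writing does not disturb the walk.\<close>
    have ne: "pair (h (y i)) i \<noteq> pair k i" using y[of i] assms(8) by auto
    have e: "exec w build_body (?\<rho>, A') = (if lab (y i) mod 2 ^ Suc i = b mod 2 ^ Suc i
        then (?\<rho>(7 := Suc i), put A' ALT (pair k i) (h (alt i (y i))))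
        else (?\<rho>(6 := h (alt i (y i)), 7 := Suc i), put A' ALT (pair k i) (h (y i))))"
      unfolding build_body_def exec.simps t p p3 snd_conv fst_conv using s r(1,2) hy(3) ne
      by (auto simp: p put_def simp del: aval.simps power_Suc) simp
    have "exec w build_body (?\<rho>, A') = (?\<rho>(6 := h (y (Suc i)), 7 := Suc i), put A' ALT (pair k i) (h (z i)))"
    proof (cases "lab (y i) mod 2 ^ Suc i = b mod 2 ^ Suc i")
      case True
      then have "y (Suc i) = y i" using first_agree_Suc[of b i u] unfolding y_def by (metis (full_types))
      then have "?\<rho>(6 := h (y (Suc i))) = ?\<rho>" using r(1) by (simp add: fun_eq_iff)
      then show ?thesis unfolding e z if_P[OF True] by (simp only:)
    next
      case False
      then have "y (Suc i) = alt i (y i)"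
        using first_agree_Suc[of b i u] unfolding y_def by (metis (full_types))
      then show ?thesis unfolding e z if_not_P[OF False] by (simp only:)
    qed
    then show "I (Suc i) (exec w build_body (\<rho>'(8 := \<rho>' 8 div 2), A'))"
      using r assms(8) unfolding I_def by (auto simp: put_def less_Suc_eq)
  qed (use assms(4) in simp)
  then have I: "I bits (exec w build (\<rho>, A))" by (simp add: build_def assms(5) del: exec.simps(6))
  then show ?thesis unfolding I_def z_def by (cases "exec w build (\<rho>, A)") auto
qed

section \<open>Small numbers, counters and free lists in word arithmetic\<close>

lemma w_pos [simp]: "0 < w" "4 < w" "\<not> w \<le> 4" using w5 by auto

lemma const_mod: "x \<le> 40 \<Longrightarrow> x mod 2 ^ w = x" "x \<le> 40 \<Longrightarrow> x mod R = x"
  using small_less_word[of x] small_less_R[of x] N2 by auto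

lemma less_N_word: "n < N \<Longrightarrow> Suc n < 2 ^ w"
proof -
  assume "n < N"
  moreover have "N \<le> 17 * (N + 2) + 16 + w" by simp
  ultimately have "Suc n \<le> 17 * (N + 2) + 16 + w" by (meson Suc_leI le_trans)
  then show ?thesis by (rule small_less_word)
qed

lemma filter_bucket: "length (filter (\<lambda>c. c div 16 = x) s) = 0 \<longleftrightarrow> x \<notin> (\<lambda>c. c div 16) ` set s" for s :: "nat list"
  by (induction s) auto

lemmas num_mod [simp] = const_mod[of "numeral k" for k] const_mod[of "Suc 0"]

lemma exec_alloc:
  assumes "A 0 (cell mod 2 ^ w mod R) < R" "nf \<noteq> 0"
  shows "exec w (alloc r cell nf) (\<rho>, A) = (\<rho>(r := A 0 (cell mod 2 ^ w mod R)),
     put A 0 (cell mod 2 ^ w mod R) ((A 0 (cell mod 2 ^ w mod R) + 1 + A nf (A 0 (cell mod 2 ^ w mod R))) mod 2 ^ w))"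
  using assms by (simp add: alloc_def mod_simps)

lemma exec_release:
  assumes "\<rho> r < R" "nf \<noteq> 0"
  shows "exec w (release r cell nf) (\<rho>, A) = (\<rho>,
     put (put A nf (\<rho> r) ((A 0 (cell mod 2 ^ w mod R) + 2 ^ w - (\<rho> r + 1) mod 2 ^ w) mod 2 ^ w))
       0 (cell mod 2 ^ w mod R) (\<rho> r))"
  using assms by (simp add: release_def mod_simps)

lemma put_apply [simp]: "put A j i v j = (A j)(i := v)" "j' \<noteq> j \<Longrightarrow> put A j i v j' = A j'"
  by (simp_all add: put_def)

section \<open>Renaming of letters by block numbers\<close>

lemma sigma_div_R: "c < \<sigma> \<Longrightarrow> c div 16 < R"
  using sigma_less unfolding word_eq by linarith

lemma bucket_less:
  assumes "bucket_inv s A" "x < R"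
  shows "A BUCK x < N + 2" "x \<in> (\<lambda>c. c div 16) ` set s \<Longrightarrow> 2 \<le> A BUCK x"
    "x \<notin> (\<lambda>c. c div 16) ` set s \<Longrightarrow> A BUCK x = 0"
proof -
  note inv = assms(1)[unfolded bucket_inv_def]
  have fl: "free_list (A BUCK ` (\<lambda>c. c div 16) ` set s) (A 0 5) (A 14)" using inv by blast
  show 1: "A BUCK x = 0" if "x \<notin> (\<lambda>c. c div 16) ` set s"
  proof -
    have "filter (\<lambda>c. c div 16 = x) s = []" using that by (auto simp: filter_empty_conv)
    then show ?thesis using inv assms(2) by fastforce
  qed
  show "2 \<le> A BUCK x" if "x \<in> (\<lambda>c. c div 16) ` set s"
    using free_list_bounds[OF fl] that by blast
  show "A BUCK x < N + 2"
    using 1 free_list_bounds[OF fl] by (cases "x \<in> (\<lambda>c. c div 16) ` set s") auto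
qed

lemma code_less:
  assumes "bucket_inv s A" "c < \<sigma>"
  shows "code A c < 16 * (N + 2)"
  using bucket_less(1)[OF assms(1) sigma_div_R[OF assms(2)]] by (simp add: code_def)

lemma aval_code_e:
  assumes "bucket_inv s A" "\<rho> 0 < \<sigma>"
  shows "aval w code_e (\<rho>, A) = code A (\<rho> 0)"
proof -
  let ?b = "A BUCK (\<rho> 0 div 16)"
  have "?b < N + 2" using bucket_less(1)[OF assms(1) sigma_div_R[OF assms(2)]] .
  then have "?b * 16 < 2 ^ w" "?b * 16 + \<rho> 0 mod 16 < 2 ^ w"
    by (auto intro!: small_less_word)
  then show ?thesis
    using sigma_div_R[OF assms(2)] by (simp add: code_e_def code_def)
qed

text \<open>The letter \<open>c\<close> may be absent from the string, so a lookup with it finds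
  nothing by accident: a letter of an absent block has a code below 16, while present blocks have
  numbers from 2 on.\<close>

lemma code_inj:
  assumes "bucket_inv s A" "c < \<sigma>" "a \<in> set s" "set s \<subseteq> {..<\<sigma>}" "code A c = code A a"
  shows "c = a"
proof -
  have "a < \<sigma>" using assms by auto
  note R = sigma_div_R[OF assms(2)] sigma_div_R[OF this]
  have "A BUCK (c div 16) = code A c div 16" "A BUCK (a div 16) = code A a div 16" by (simp_all add: code_def)
  then have b: "A BUCK (c div 16) = A BUCK (a div 16)" using assms(5) by simp
  have "c mod 16 = code A c mod 16" "a mod 16 = code A a mod 16" by (simp_all add: code_def)
  then have m: "c mod 16 = a mod 16" using assms(5) by simp
  have "2 \<le> A BUCK (a div 16)" using bucket_less(2)[OF assms(1) R(2)] assms(3) by blast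
  then have "c div 16 \<in> (\<lambda>c. c div 16) ` set s"
    using bucket_less(3)[OF assms(1) R(1)] b by force
  then have "c div 16 = a div 16"
    using assms(1,3) b unfolding bucket_inv_def inj_on_def by blast
  with m show ?thesis by (metis div_mult_mod_eq)
qed

lemma card_buckets_le: "card (A BUCK ` (\<lambda>c. c div 16) ` set s) \<le> length s"
  using card_image_le[of "(\<lambda>c. c div 16) ` set s" "A BUCK"] card_image_le[of "set s" "\<lambda>c. c div 16"]
    card_length[of s] by simp

text \<open>The last conjunct keeps the edge table valid: the number of a block does not change
  while a letter of the block is present.\<close>

lemma count_char_correct:
  assumes "bucket_inv s A" "c < \<sigma>" "length s < N" "\<rho> 0 = c" "set s \<subseteq> {..<\<sigma>}"
  shows "\<exists>\<rho>' A'. exec w count_char (\<rho>, A) = (\<rho>', A') \<and> (\<forall>r. r \<notin> {4, 5} \<longrightarrow> \<rho>' r = \<rho> r) \<and>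
    (\<forall>j. j \<notin> {0, COUNT, BUCK} \<longrightarrow> A' j = A j) \<and> (\<forall>i. i \<noteq> 5 \<longrightarrow> A' 0 i = A 0 i) \<and>
    bucket_inv (c # s) A' \<and> \<rho>' 4 = code A' c \<and> (\<forall>a\<in>set s. code A' a = code A a)"
proof -
  let ?x = "c div 16"
  let ?B = "\<lambda>s. (\<lambda>c. c div 16) ` set s"
  let ?n = "A COUNT ?x"
  note inv = assms(1)[unfolded bucket_inv_def]
  note x = sigma_div_R[OF assms(2)]
  have n: "?n = length (filter (\<lambda>c. c div 16 = ?x) s)" using inv x by blast
  then have "?n \<le> length s" by (metis length_filter_le)
  then have n1: "Suc ?n < 2 ^ w" using less_N_word[OF le_less_trans[OF _ assms(3)]] by blast
  define A1 where "A1 = (if ?n = 0 then put (put A 0 5 ((A 0 5 + 1 + A 14 (A 0 5)) mod 2 ^ w)) BUCK ?x (A 0 5) else A)"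
  define A' where "A' = put A1 COUNT ?x (Suc ?n)"
  define \<rho>1 where "\<rho>1 = (if ?n = 0 then \<rho>(4 := ?x, 5 := A 0 5) else \<rho>(4 := ?x))"
  have fl: "free_list (A BUCK ` ?B s) (A 0 5) (A 14)" using inv by blast
  have "card (A BUCK ` ?B s) < N" using card_buckets_le assms(3) by (rule le_less_trans)
  note al = free_list_alloc[OF fl this]
  have f: "A 0 5 < R" using al(3) by (intro small_less_R) simp
  have A1C: "A1 COUNT = A COUNT" by (simp add: A1_def)
  have e1: "exec w (If_Eq (Arr COUNT (Var 4)) (Const 0) (alloc 5 5 14 ;; Put BUCK (Var 4) (Var 5)) Skip)
      (\<rho>(4 := ?x), A) = (\<rho>1, A1)"
    using x f by (simp add: exec_alloc A1_def \<rho>1_def)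
  have \<rho>1: "\<rho>1 4 = ?x" "\<rho>1 0 = c" "\<And>r. r \<notin> {4, 5} \<Longrightarrow> \<rho>1 r = \<rho> r"
    using assms(4) by (auto simp: \<rho>1_def)
  have B: "?B (c # s) = insert ?x (?B s)" by simp
  have old: "A' BUCK y = A BUCK y" if "y \<in> ?B s" for y
  proof -
    from that have "?n = 0 \<Longrightarrow> y \<noteq> ?x" unfolding n filter_bucket by metis
    then show ?thesis by (simp add: A'_def A1_def)
  qed
  have inv': "bucket_inv (c # s) A'"
    unfolding bucket_inv_def
  proof (intro conjI allI impI)
    show "A' COUNT y = length (filter (\<lambda>c. c div 16 = y) (c # s))" if "y < R" for y
      using inv that n by (auto simp: A'_def A1C)
    show "A' BUCK y = 0" if "y < R" "A' COUNT y = 0" for y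
      using inv that by (auto simp: A'_def A1C A1_def split: if_splits)
    have "inj_on (A' BUCK) (?B (c # s)) \<and> free_list (A' BUCK ` ?B (c # s)) (A' 0 5) (A' 14)"
    proof (cases "?n = 0")
      case True
      have nx: "?x \<notin> ?B s" using True unfolding n filter_bucket .
      have bx: "A' BUCK ?x = A 0 5" using True by (simp add: A'_def A1_def)
      have im: "A' BUCK ` ?B s = A BUCK ` ?B s" using old by (intro image_cong) auto
      have "inj_on (A' BUCK) (?B s)" using inv old by (metis (no_types, lifting) inj_on_cong)
      then have "inj_on (A' BUCK) (?B (c # s))"
        unfolding B using al(1) bx im nx by (simp add: inj_on_insert)
      moreover have "A' BUCK ` ?B (c # s) = insert (A 0 5) (A BUCK ` ?B s)"
        unfolding B using bx im by simp
      moreover have "A' 0 5 = (A 0 5 + 1 + A 14 (A 0 5)) mod 2 ^ w" "A' 14 = A 14"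
        using True by (simp_all add: A'_def A1_def)
      ultimately show ?thesis using al(4) by simp
    next
      case False
      then have "?x \<in> ?B s" unfolding n filter_bucket by blast
      then have "?B (c # s) = ?B s" unfolding B by blast
      moreover have "A' BUCK = A BUCK" "A' 0 5 = A 0 5" "A' 14 = A 14"
        using False by (simp_all add: A'_def A1_def)
      ultimately show ?thesis using inv by simp
    qed
    then show "inj_on (A' BUCK) (?B (c # s))" "free_list (A' BUCK ` ?B (c # s)) (A' 0 5) (A' 14)" by auto
  qed
  have e2: "exec w (Put COUNT (Var 4) (Bin Add (Arr COUNT (Var 4)) (Const 1))) (\<rho>1, A1) = (\<rho>1, A')"
    using x n1 \<rho>1 by (simp add: A'_def A1C)
  have e3: "exec w (Set 4 code_e) (\<rho>1, A') = (\<rho>1(4 := code A' c), A')"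
    using aval_code_e[OF inv', of \<rho>1] \<rho>1 assms(2) by simp
  have "exec w count_char (\<rho>, A) = (\<rho>1(4 := code A' c), A')"
    unfolding count_char_def exec.simps(4) using e1 e2 e3 assms(4) by simp
  moreover have "code A' a = code A a" if "a \<in> set s" for a
    using old[of "a div 16"] that by (simp add: code_def)
  ultimately show ?thesis
    using \<rho>1 inv' by (intro exI[of _ "\<rho>1(4 := code A' c)"] exI[of _ A']) (auto simp: A'_def A1_def)
qed

lemma uncount_char_correct:
  assumes "bucket_inv (c # s) A" "c < \<sigma>" "length s < N" "\<rho> 0 = c"
  shows "\<exists>\<rho>' A'. exec w uncount_char (\<rho>, A) = (\<rho>', A') \<and> (\<forall>r. r \<notin> {4, 5} \<longrightarrow> \<rho>' r = \<rho> r) \<and>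
    (\<forall>j. j \<notin> {0, COUNT, BUCK, 14} \<longrightarrow> A' j = A j) \<and> (\<forall>i. i \<noteq> 5 \<longrightarrow> A' 0 i = A 0 i) \<and>
    bucket_inv s A' \<and> (\<forall>a\<in>set s. code A' a = code A a)"
proof -
  let ?x = "c div 16"
  let ?B = "\<lambda>s. (\<lambda>c. c div 16) ` set s"
  note inv = assms(1)[unfolded bucket_inv_def]
  note x = sigma_div_R[OF assms(2)]
  let ?n = "length (filter (\<lambda>c. c div 16 = ?x) s)"
  have n: "A COUNT ?x = Suc ?n" using inv x by simp
  have "?n \<le> length s" by (rule length_filter_le)
  then have n1: "Suc ?n < 2 ^ w" using less_N_word[OF le_less_trans[OF _ assms(3)]] by blast
  have dec: "(Suc ?n + 2 ^ w - 1) mod 2 ^ w = ?n" using n1 by simp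
  let ?k = "A BUCK ?x"
  define A1 where "A1 = put A COUNT ?x ?n"
  define A' where "A' = (if ?n = 0 then put (put (put A1 14 ?k
     ((A 0 5 + 2 ^ w - (?k + 1) mod 2 ^ w) mod 2 ^ w)) 0 5 ?k) BUCK ?x 0 else A1)"
  have fl: "free_list (A BUCK ` ?B (c # s)) (A 0 5) (A 14)" using inv by blast
  have kU: "?k \<in> A BUCK ` ?B (c # s)" by simp
  have k: "?k < R" using bucket_less(1)[OF assms(1) x] by (intro small_less_R) simp
  have ex: "exec w uncount_char (\<rho>, A) = (if ?n = 0 then \<rho>(4 := ?x, 5 := ?k) else \<rho>(4 := ?x), A')"
    using x n dec k assms(4)
    by (simp add: uncount_char_def exec_release A'_def A1_def del: exec.simps(5)) (simp add: exec_release)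
  have nx: "?x \<notin> ?B s \<longleftrightarrow> ?n = 0"
    unfolding filter_bucket ..
  have old: "A' BUCK y = A BUCK y" if "y \<in> ?B s" for y
  proof -
    from that have "?n = 0 \<Longrightarrow> y \<noteq> ?x" unfolding filter_bucket by metis
    then show ?thesis by (simp add: A'_def A1_def)
  qed
  have inv': "bucket_inv s A'"
    unfolding bucket_inv_def
  proof (intro conjI allI impI)
    show "A' COUNT y = length (filter (\<lambda>c. c div 16 = y) s)" if "y < R" for y
    proof -
      have "A COUNT y = length (filter (\<lambda>c. c div 16 = y) (c # s))" using inv that by blast
      then show ?thesis by (auto simp: A'_def A1_def)
    qed
    show "A' BUCK y = 0" if "y < R" "A' COUNT y = 0" for y
    proof (cases "y = ?x")
      case True
      then show ?thesis using that(2) by (auto simp: A'_def A1_def split: if_splits)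
    next
      case False
      then have "A COUNT y = 0" using that(2) by (auto simp: A'_def A1_def split: if_splits)
      then have "A BUCK y = 0" using inv that(1) by blast
      then show ?thesis using False by (auto simp: A'_def A1_def)
    qed
    have inj: "inj_on (A BUCK) (?B (c # s))" using inv by blast
    have im: "A' BUCK ` ?B s = A BUCK ` ?B s" using old by (intro image_cong) auto
    have "inj_on (A BUCK) (?B s)" by (rule inj_on_subset[OF inj]) auto
    then show "inj_on (A' BUCK) (?B s)" using old by (metis (no_types, lifting) inj_on_cong)
    show "free_list (A' BUCK ` ?B s) (A' 0 5) (A' 14)"
    proof (cases "?n = 0")
      case True
      then have "?x \<notin> ?B s" using nx by blast
      moreover have "inj_on (A BUCK) (insert ?x (?B s))" using inj by simp
      ultimately have "?k \<notin> A BUCK ` ?B s" unfolding inj_on_insert by (metis Diff_empty Diff_insert0)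
      then have "A BUCK ` ?B s = A BUCK ` ?B (c # s) - {?k}" by simp
      moreover have "A' 0 5 = ?k" "A' 14 = (A 14)(?k := (A 0 5 + 2 ^ w - (?k + 1) mod 2 ^ w) mod 2 ^ w)"
        using True by (simp_all add: A'_def A1_def fun_upd_def)
      ultimately show ?thesis
        using free_list_release[OF fl kU free_list_head_less[OF fl]] im by (simp only:)
    next
      case False
      then have "?x \<in> ?B s" using nx by blast
      then have "?B (c # s) = ?B s" by auto
      moreover have "A' 0 5 = A 0 5" "A' 14 = A 14" using False by (simp_all add: A'_def A1_def)
      ultimately show ?thesis using im fl by simp
    qed
  qed
  have "code A' a = code A a" if "a \<in> set s" for a
    using old[of "a div 16"] that by (simp add: code_def)
  then show ?thesis using ex inv' unfolding A'_def A1_def by auto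
qed

section \<open>Correctness of a push\<close>

lemma length_lpp_le: "length (lpp s) \<le> length s"
  using prefix_lpp prefix_length_le by blast

lemma node_len_surround: "int (length (surround c u)) = node_len u + 2"
  by (cases u) auto

lemma nodes_inv_less: "nodes_inv V h A \<Longrightarrow> v \<in> V \<Longrightarrow> h v < R"
proof -
  assume "nodes_inv V h A" "v \<in> V"
  then have "h v < N + 2" by (auto simp: nodes_inv_def)
  then show ?thesis by (intro small_less_R) simp
qed

lemma nodes_inv_ge2:
  assumes "nodes_inv (eertree_nodes s) h A" "p \<in> pals s"
  shows "2 \<le> h (Pal p)"
proof -
  have p: "Pal p \<in> eertree_nodes s" "p \<noteq> []" using assms(2) by (auto simp: nodes_pals pals_def)
  have "h (Pal p) \<noteq> h Odd" "h (Pal p) \<noteq> h Even"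
    using assms(1) p unfolding nodes_inv_def by (metis Odd_in_nodes inj_on_contraD node.distinct(1))
      (metis assms(1) p Even_in_nodes inj_on_contraD node.inject nodes_inv_def)
  then show ?thesis using assms(1) unfolding nodes_inv_def by auto
qed

lemma find_center_correct:
  assumes "nodes_inv (eertree_nodes s) h A" "set s \<subseteq> {..<\<sigma>}" "A 15 0 = \<sigma>" "c < \<sigma>" "length s < N"
    "\<And>i. i \<le> length s \<Longrightarrow> A TEXT (pos d P i) = (c # s) ! i"
    "\<rho> 0 = c" "\<rho> 1 = length s" "\<rho> 2 = P" "\<rho> 3 = h (lpn s)"
  shows "\<exists>\<rho>'. exec w (find_center d) (\<rho>, A) = (\<rho>', A) \<and> \<rho>' 6 = h (center c s) \<and>
    (\<forall>r. r \<notin> {6, 7, 8} \<longrightarrow> \<rho>' r = \<rho> r)"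
proof -
  let ?v = "lpn s"
  have v: "?v \<in> eertree_nodes s" by (rule lpn_in_nodes)
  obtain \<rho>1 where r1: "exec w (search 6) (\<rho>(6 := h ?v), A) = (\<rho>1, A)" "\<rho>1 6 = h (dlink c ?v)"
    "\<forall>r. r \<notin> {6, 7, 8} \<longrightarrow> \<rho>1 r = (\<rho>(6 := h ?v)) r"
    using search_correct[OF assms(1) link_closed_nodes[OF assms(2)] v assms(3), of "\<rho>(6 := h ?v)" 6 c] assms
    by auto
  have len: "A LEN (h ?v) = nat (node_len ?v + 1)" "h ?v mod R = h ?v"
    using assms(1) v nodes_inv_less[OF assms(1) v] by (auto simp: nodes_inv_def)
  have le: "nat (node_len ?v + 1) \<le> Suc (length s)" using length_lpp_le[of s] by (simp add: lpn_def nat_add_distrib)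
  then have lw: "nat (node_len ?v + 1) \<le> 2 ^ w" using less_N_word[OF assms(5)] by linarith
  have cond: "node_len ?v + 1 \<le> int (length s) \<longleftrightarrow> \<not> length s < nat (node_len ?v + 1)" by linarith
  let ?T = "If_Less (Var 1) (Arr LEN (Var 3)) Skip
       (If_Eq (Arr TEXT (Bin (move d) (Var 2) (Arr LEN (Var 3)))) (Var 0) (Set 6 (Var 3)) Skip)"
  have "exec w ?T (\<rho>1, A) = (if length s < nat (node_len ?v + 1) then (\<rho>1, A)
      else if (c # s) ! nat (node_len ?v + 1) = c then (\<rho>1(6 := h ?v), A) else (\<rho>1, A))"
    using r1(3) assms(6)[of "nat (node_len ?v + 1)"] assms(7-10) len alu_move_mod[OF lw, of d P]
    by (auto simp: not_less)
  moreover have "exec w (find_center d) (\<rho>, A) = exec w ?T (\<rho>1, A)"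
    unfolding find_center_def using r1(1) assms(10) by simp
  ultimately have "exec w (find_center d) (\<rho>, A) = (\<rho>1(6 := h (center c s)), A)"
    unfolding center_def cond using r1(2) by (auto simp: fun_eq_iff)
  then show ?thesis using r1 by (intro exI[of _ "\<rho>1(6 := h (center c s))"]) auto
qed

text \<open>Two strings occur because a push counts the letter before its node exists: at that time
  the nodes belong to \<open>s\<close> and the block numbers to \<open>c # s\<close>.\<close>

lemma edge_lookup:
  assumes "nodes_inv (eertree_nodes s) h A" "edges_inv (pals s) h A" "bucket_inv s' A"
    "set s \<subseteq> set s'" "set s' \<subseteq> {..<\<sigma>}" "u \<in> eertree_nodes s" "c < \<sigma>"
  shows "A NEXT (pair (h u) (code A c)) = (if surround c u \<in> pals s then h (Pal (surround c u)) else 0)"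
    and "(pair (h u) (code A c), k) \<in> graph R (A NEXT) \<longleftrightarrow> surround c u \<in> pals s \<and> k = h (Pal (surround c u))"
    and "pair (h u) (code A c) < R"
proof -
  have "h u < N + 2" using assms(1,6) by (auto simp: nodes_inv_def)
  moreover have "code A c < 16 * (N + 2)" using code_less[OF assms(3,7)] .
  ultimately show less: "pair (h u) (code A c) < R" by (intro pair_less_R) auto
  have inj: "inj_on h (eertree_nodes s)" using assms(1) by (simp add: nodes_inv_def)
  have uniq: "u' = u \<and> a = c" if "surround a u' \<in> pals s" "pair (h u') (code A a) = pair (h u) (code A c)" for u' a
  proof -
    have ua: "u' \<in> eertree_nodes s" "a \<in> set s" using surround_in_pals[OF that(1)] by auto
    have eq: "h u' = h u" "code A a = code A c" using that(2) by simp_all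
    have "u' = u" using inj_onD[OF inj eq(1) ua(1) assms(6)] .
    moreover have "c = a" using code_inj[OF assms(3,7) _ assms(5)] ua(2) assms(4) eq(2) by (metis subsetD)
    ultimately show ?thesis by simp
  qed
  have G: "(pair (h u) (code A c), k) \<in> graph R (A NEXT) \<longleftrightarrow> surround c u \<in> pals s \<and> k = h (Pal (surround c u))" for k
  proof
    assume "(pair (h u) (code A c), k) \<in> graph R (A NEXT)"
    then obtain u' a where "surround a u' \<in> pals s" "pair (h u) (code A c) = pair (h u') (code A a)"
        "k = h (Pal (surround a u'))"
      using assms(2) unfolding edges_inv_def by auto
    then show "surround c u \<in> pals s \<and> k = h (Pal (surround c u))" using uniq by metis
  next
    assume "surround c u \<in> pals s \<and> k = h (Pal (surround c u))"
    then show "(pair (h u) (code A c), k) \<in> graph R (A NEXT)"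
      using assms(2) unfolding edges_inv_def by (auto intro!: image_eqI[of _ _ "(u, c)"])
  qed
  then show "(pair (h u) (code A c), k) \<in> graph R (A NEXT) \<longleftrightarrow> surround c u \<in> pals s \<and> k = h (Pal (surround c u))" .
  show "A NEXT (pair (h u) (code A c)) = (if surround c u \<in> pals s then h (Pal (surround c u)) else 0)"
    using G less by (auto simp: graph_iff)
qed

lemma init_node_exec:
  assumes "\<rho> 3 < R" "\<rho> 9 < R" "\<rho> 6 < R" "\<rho> 5 < R" "A LEN (\<rho> 6) + 2 < 2 ^ w"
    "\<rho> 9 \<noteq> \<rho> 3" "A LEN (\<rho> 9) = Suc l" "Suc l < 2 ^ w" "A TEXT (pos d (\<rho> 2) l) = b"
  shows "exec w (init_node d) (\<rho>, A) =
    (\<rho>(10 := b), put (put (put (put (put (put (put A LEN (\<rho> 3) (A LEN (\<rho> 6) + 2)) LINK (\<rho> 3) (\<rho> 9))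
       LAB (\<rho> 3) b) EDGE (\<rho> 3) (\<rho> 5)) NEXT (\<rho> 5) (\<rho> 3)) REF (\<rho> 3) 0)
       REF (\<rho> 9) ((A REF (\<rho> 9) + 1) mod 2 ^ w))"
proof -
  have sub: "(Suc l + 2 ^ w - Suc 0) mod 2 ^ w = l" using assms(8) by simp
  have mv: "alu w (move d) (\<rho> 2) l mod R = pos d (\<rho> 2) l"
    using assms(8) by (intro alu_move_mod) simp
  show ?thesis
    unfolding init_node_def
    using assms mv sub by (simp del: alu.simps(1,2) add: alu.simps(1)[of w _ 2] alu.simps(1)[of w _ "Suc 0"]
      alu.simps(2)[of w _ "Suc 0"])
qed

lemma create_node_correct:
  fixes c s
  defines "v \<equiv> lpp (c # s)" and "u \<equiv> center c s"
  assumes nodes: "nodes_inv (eertree_nodes s) h A" and edges: "edges_inv (pals s) h A"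
    and bucket: "bucket_inv (c # s) A" and free: "free_list (h ` Pal ` pals s) (A 0 4) (A 11)"
    and refs: "\<And>p. p \<in> pals s \<Longrightarrow> A REF (h (Pal p)) = refs s p"
    and letters: "\<And>i. i \<le> length s \<Longrightarrow> A TEXT (pos d P i) = (c # s) ! i"
    and sigma: "A 15 0 = \<sigma>" "set (c # s) \<subseteq> {..<\<sigma>}" and len: "length s < N" and new: "v \<notin> pals s"
    and regs: "\<rho> 0 = c" "\<rho> 2 = P" "\<rho> 4 = code A c" "\<rho> 5 = pair (h u) (code A c)" "\<rho> 6 = h u"
  defines "k \<equiv> A 0 4"
  defines "h' \<equiv> h(Pal v := k)"
  shows "\<exists>\<rho>' A'. exec w (create_node d) (\<rho>, A) = (\<rho>', A') \<and> \<rho>' 3 = k \<and> (\<forall>r\<in>{0, 1, 2}. \<rho>' r = \<rho> r) \<and>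
    (\<forall>j. j \<notin> {0, LEN, LINK, LAB, ALT, EDGE, NEXT, REF} \<longrightarrow> A' j = A j) \<and> (\<forall>i. i \<noteq> 4 \<longrightarrow> A' 0 i = A 0 i) \<and>
    nodes_inv (eertree_nodes (c # s)) h' A' \<and> edges_inv (pals (c # s)) h' A' \<and>
    (\<forall>p\<in>pals (c # s). A' REF (h' (Pal p)) = refs s p + (if p = lps v then 1 else 0)) \<and>
    free_list (h' ` Pal ` pals (c # s)) (A' 0 4) (A' 11)"
proof -
  let ?V = "eertree_nodes s"
  have s\<sigma>: "set s \<subseteq> {..<\<sigma>}" "c < \<sigma>" "set s \<subseteq> set (c # s)" using sigma by auto
  note lc = link_closed_nodes[OF s\<sigma>(1)]
  have uV: "u \<in> ?V" unfolding u_def by (rule center_in_nodes)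
  have vu: "v = surround c u" unfolding v_def u_def by (rule lpp_Cons)
  have pal_v: "palindrome v" "v \<noteq> []" "prefix v (c # s)"
    using pal_lpp prefix_lpp lpp_nonempty by (auto simp: v_def)
  define t where "t = dlink c u"
  have tV: "t \<in> ?V" unfolding t_def dlink_def using node_link_in_nodes first_anc_in_nodes uV by blast
  define l where "l = Pal (lps v)"
  have "lps v \<noteq> v" using length_lps_less[OF pal_v(2)] by auto
  \<comment> \<open>The only new palindrome is \<open>v\<close>, and its link is different from it,
    so the link is already a node.\<close>
  have lV: "l \<in> ?V"
  proof (cases "lps v = []")
    case False
    have "v \<in> pals (c # s)" by (simp add: pals_Cons v_def)
    then have "lps v \<in> pals (c # s)" using lps_in_pals False by blast
    with \<open>lps v \<noteq> v\<close> show ?thesis by (auto simp: pals_Cons v_def nodes_pals l_def)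
  qed (simp add: l_def)
  have card: "card (h ` Pal ` pals s) < N"
    using card_image_le[of "Pal ` pals s" h] card_image_le[of "pals s" Pal] card_pals_le[of s] len by simp
  note al = free_list_alloc[OF free card, folded k_def]
  have kV: "k \<notin> h ` ?V"
    using al(1,2) nodes by (auto simp: nodes_pals nodes_inv_def)
  have hu: "h u < R" "h l < R" "k < R" using nodes_inv_less[OF nodes] uV lV al(3) by (auto intro: small_less_R)
  have lk: "h l \<noteq> k" using kV lV by blast
  note look = edge_lookup[OF nodes edges bucket s\<sigma>(3) sigma(2) _ s\<sigma>(2)]
  \<comment> \<open>With centre \<open>Odd\<close> the lookup asks for \<open>[c]\<close>, the new
    palindrome itself, and finds nothing. With any other centre the link of \<open>v\<close> has the
    form \<open>surround c t\<close> and is present.\<close>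
  have lkup: "(if A NEXT (pair (h t) (code A c)) = 0 then 1 else A NEXT (pair (h t) (code A c))) = h l"
  proof (cases u)
    case Odd
    then have "t = Odd" "v = [c]" by (simp_all add: t_def vu)
    then show ?thesis using look(1)[OF tV] new nodes by (simp add: l_def nodes_inv_def)
  next
    case (Pal p)
    have "palindrome p" using pal_v(1) vu Pal by simp
    then have eq: "lps v = surround c t" using vu Pal lps_surround[of p c] by (simp add: t_def)
    then have "lps v \<noteq> []" by (cases t) auto
    then have "surround c t \<in> pals s" using lV eq by (auto simp: l_def nodes_pals)
    moreover from this have "h (Pal (surround c t)) \<noteq> 0" using nodes_inv_ge2[OF nodes] by fastforce
    ultimately show ?thesis using look(1)[OF tV] eq by (simp add: l_def)
  qed
  obtain \<rho>1 where r1: "exec w (search 9) (\<rho>(9 := h u), A) = (\<rho>1, A)" "\<rho>1 9 = h t"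
    "\<forall>r. r \<notin> {9, 7, 8} \<longrightarrow> \<rho>1 r = (\<rho>(9 := h u)) r"
    using search_correct[OF nodes lc uV sigma(1), of "\<rho>(9 := h u)" 9 c] regs s\<sigma>(2)
    by (auto simp: t_def)
  have pr: "aval w (pair_e (Var 9) (Var 4)) (\<rho>1, A) = pair (h t) (code A c)"
    using aval_pair_e(1)[of "Var 9" "(\<rho>1, A)" "Var 4"] r1 regs nodes tV code_less[OF bucket s\<sigma>(2)]
    by (auto simp: nodes_inv_def)
  have prR: "pair (h t) (code A c) mod R = pair (h t) (code A c)" using look(3)[OF tV] by simp
  define \<rho>2 where "\<rho>2 = \<rho>1(9 := h l)"
  have e2: "exec w (If_Eq (Var 9) (Const 0) (Set 9 (Const 1)) Skip)
      (exec w (Set 9 (Arr NEXT (pair_e (Var 9) (Var 4)))) (\<rho>1, A)) = (\<rho>2, A)"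
    using lkup by (simp add: pr prR \<rho>2_def split: if_splits)
  let ?A1 = "put A 0 4 ((k + 1 + A 11 k) mod 2 ^ w)"
  have e3: "exec w (alloc 3 4 11) (\<rho>2, A) = (\<rho>2(3 := k), ?A1)"
    using hu(3) by (simp add: exec_alloc k_def)
  define b where "b = lab (Pal v)"
  have ll: "length (lps v) < length v" using length_lps_less[OF pal_v(2)] .
  have lv: "length v \<le> Suc (length s)" using pal_v(3) prefix_length_le by fastforce
  have Llen: "A LEN (h l) = Suc (length (lps v))" "A LEN (h u) + 2 = Suc (length v)"
  proof -
    show "A LEN (h l) = Suc (length (lps v))" using nodes lV by (auto simp: nodes_inv_def l_def)
    have "A LEN (h u) = nat (node_len u + 1)" using nodes uV by (auto simp: nodes_inv_def)
    moreover have "int (length v) = node_len u + 2" using node_len_surround vu by metis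
    moreover have "node_len u \<ge> - 1" by (cases u) auto
    ultimately show "A LEN (h u) + 2 = Suc (length v)" by linarith
  qed
  have bt: "A TEXT (pos d P (length (lps v))) = b"
  proof -
    have "(c # s) ! length (lps v) = v ! length (lps v)"
      using pal_v(3) ll by (metis nth_append prefix_def)
    then show ?thesis using letters[of "length (lps v)"] ll lv pal_v(2) by (simp add: b_def)
  qed
  have big: "Suc (length v) < 2 ^ w" using lv len by (intro small_less_word) simp
  let ?A2 = "put (put (put (put (put (put (put ?A1 LEN k (Suc (length v))) LINK k (h l))
       LAB k b) EDGE k (pair (h u) (code A c))) NEXT (pair (h u) (code A c)) k) REF k 0)
       REF (h l) ((A REF (h l) + 1) mod 2 ^ w)"
  have e4: "exec w (init_node d) (\<rho>2(3 := k), ?A1) = (\<rho>2(3 := k, 10 := b), ?A2)"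
    using init_node_exec[of "\<rho>2(3 := k)" ?A1 "length (lps v)" d b] hu lk r1(3) regs look(3)[OF uV]
      Llen big bt ll by (simp add: \<rho>2_def)
  have frame2: "?A2 j = A j" if "j \<notin> {0, LEN, LINK, LAB, EDGE, NEXT, REF}" for j
    using that by simp
  have old: "?A2 LEN (h x) = A LEN (h x) \<and> ?A2 LINK (h x) = A LINK (h x) \<and> ?A2 LAB (h x) = A LAB (h x)
      \<and> ?A2 EDGE (h x) = A EDGE (h x)" if "x \<in> ?V" for x
  proof -
    have "h x \<noteq> k" using kV that by blast
    then show ?thesis by simp
  qed
  have nodes2: "nodes_inv ?V h ?A2"
    using nodes old frame2[of ALT] unfolding nodes_inv_def by auto
  have b\<sigma>: "b < \<sigma>"
  proof -
    have "Pal v \<in> eertree_nodes (c # s)" by (simp add: nodes_Cons v_def)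
    then have "b = 0 \<or> b \<in> set (c # s)" unfolding b_def by (rule lab_in_set)
    then show ?thesis using sigma(2) sigma_pos by auto
  qed
  obtain \<rho>' A' where e5: "exec w build (\<rho>2(3 := k, 10 := b), ?A2) = (\<rho>', A')"
    and r5: "\<forall>r. r \<notin> {6, 7, 8} \<longrightarrow> \<rho>' r = (\<rho>2(3 := k, 10 := b)) r"
    and A5: "\<forall>j. j \<noteq> ALT \<longrightarrow> A' j = ?A2 j" "\<forall>x\<in>h ` ?V. \<forall>i. A' ALT (pair x i) = ?A2 ALT (pair x i)"
    and row: "\<forall>i<bits. A' ALT (pair k i) =
      h (first_anc (\<lambda>x. x mod 2 ^ i = b mod 2 ^ i \<and> x mod 2 ^ Suc i \<noteq> b mod 2 ^ Suc i) l)"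
    using build_correct[OF nodes2 lc lV, of "\<rho>2(3 := k, 10 := b)" k b] sigma(1) al(3) kV b\<sigma>
    by (auto simp: \<rho>2_def)
  have ex: "exec w (create_node d) (\<rho>, A) = (\<rho>', A')"
    unfolding create_node_def exec.simps(4) using regs(5) r1(1) e2 e3 e4 e5
    by (simp del: exec.simps(2-6) add: exec.simps(2)[of w 9 "Var 6"])
  have A'eq: "A' LEN = (A LEN)(k := Suc (length v))" "A' LINK = (A LINK)(k := h l)" "A' LAB = (A LAB)(k := b)"
    "A' EDGE = (A EDGE)(k := pair (h u) (code A c))" "A' NEXT = (A NEXT)(pair (h u) (code A c) := k)"
    "A' REF = (A REF)(k := 0, h l := (A REF (h l) + 1) mod 2 ^ w)" "A' 0 = (A 0)(4 := (k + 1 + A 11 k) mod 2 ^ w)"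
    "A' 11 = A 11" "A' BUCK = A BUCK"
    using A5(1) by (simp_all add: fun_eq_iff)
  have V': "eertree_nodes (c # s) = insert (Pal v) ?V" by (simp add: nodes_Cons v_def)
  have vV: "Pal v \<notin> ?V" using new by (auto simp: nodes_pals pals_def pal_v)
  have h': "h' x = h x" if "x \<in> ?V" for x using that vV by (auto simp: h'_def)
  have hv: "h' (Pal v) = k" by (simp add: h'_def)
  have nodes': "nodes_inv (eertree_nodes (c # s)) h' A'"
    unfolding nodes_inv_def V'
  proof (intro conjI ballI)
    show "h' Odd = 0" "h' Even = 1" using h'[of Odd] h'[of Even] nodes by (auto simp: nodes_inv_def)
    have "inj_on h' ?V" using nodes h' by (metis inj_on_cong nodes_inv_def)
    moreover have "h' ` ?V = h ` ?V" using h' by (intro image_cong) auto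
    ultimately show "inj_on h' (insert (Pal v) ?V)" using kV hv vV by (simp add: inj_on_insert)
  next
    fix x assume "x \<in> insert (Pal v) ?V"
    then consider "x = Pal v" | "x \<in> ?V" by blast
    then have "h' x < N + 2 \<and> A' LEN (h' x) = nat (node_len x + 1) \<and> A' LINK (h' x) = h' (node_link x) \<and>
        A' LAB (h' x) = lab x \<and> (\<forall>i<bits. A' ALT (pair (h' x) i) = h' (alt i x))"
    proof cases
      case 1
      have lx: "node_link (Pal v) = l" using pal_v by (simp add: l_def)
      moreover have "h' (alt i x) = h (first_anc (\<lambda>x. x mod 2 ^ i = b mod 2 ^ i \<and> x mod 2 ^ Suc i \<noteq> b mod 2 ^ Suc i) l)" for i
        unfolding alt_def 1 lx b_def by (rule h') (rule first_anc_in_nodes[OF lV])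
      ultimately show ?thesis
        using 1 lx hv al(3) row h'[OF lV] by (simp add: A'eq b_def nat_add_distrib del: node_link.simps)
    next
      case 2
      have "h x \<noteq> k" using kV 2 by blast
      moreover have "alt i x \<in> ?V" for i unfolding alt_def using node_link_in_nodes first_anc_in_nodes 2 by blast
      ultimately show ?thesis
        using nodes 2 h'[OF 2] h'[OF node_link_in_nodes[OF 2]] h' A5(2) frame2[of ALT]
        by (auto simp: nodes_inv_def A'eq)
    qed
    then show "h' x < N + 2" "A' LEN (h' x) = nat (node_len x + 1)" "A' LINK (h' x) = h' (node_link x)"
      "A' LAB (h' x) = lab x" "\<forall>i<bits. A' ALT (pair (h' x) i) = h' (alt i x)" by auto
  qed
  have code': "code A' a = code A a" for a by (simp add: code_def A'eq)
  have P': "pals (c # s) = insert v (pals s)" by (simp add: pals_Cons v_def)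
  let ?E = "{(u, c). surround c u \<in> pals s}"
  have E': "{(x, a). surround a x \<in> pals (c # s)} = insert (u, c) ?E"
    using surround_inj[of _ _ c u] unfolding P' vu by auto
  have hold: "h' x = h x \<and> h' (Pal (surround a x)) = h (Pal (surround a x))" if "surround a x \<in> pals s" for a x
    using surround_in_pals(1)[OF that] that h' by (auto simp: nodes_pals)
  have edges': "edges_inv (pals (c # s)) h' A'"
    unfolding edges_inv_def
  proof (intro conjI allI impI)
    have "(pair (h u) (code A c), z) \<notin> graph R (A NEXT)" for z
      using look(2)[OF uV] new vu by blast
    then have "{y \<in> graph R (A NEXT). fst y \<noteq> pair (h u) (code A c)} = graph R (A NEXT)" by auto
    moreover have "k \<noteq> 0" using al(2) by simp
    ultimately have "graph R (A' NEXT) = insert (pair (h u) (code A c), k) (graph R (A NEXT))"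
      unfolding A'eq using graph_upd[OF look(3)[OF uV]] by simp
    also have "graph R (A NEXT) = (\<lambda>(u, c). (pair (h u) (code A c), h (Pal (surround c u)))) ` ?E"
      using edges by (simp add: edges_inv_def)
    also have "\<dots> = (\<lambda>(u, c). (pair (h' u) (code A' c), h' (Pal (surround c u)))) ` ?E"
      using hold by (intro image_cong) (auto simp: code')
    finally show "graph R (A' NEXT) = (\<lambda>(u, c). (pair (h' u) (code A' c), h' (Pal (surround c u)))) `
        {(x, a). surround a x \<in> pals (c # s)}"
      unfolding E' using h'[OF uV] hv vu by (simp add: code')
  next
    fix x a assume "surround a x \<in> pals (c # s)"
    then consider "x = u" "a = c" | "surround a x \<in> pals s" using surround_inj[of a x c u] P' vu by auto
    then show "A' EDGE (h' (Pal (surround a x))) = pair (h' x) (code A' a)"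
    proof cases
      case 1
      then show ?thesis using hv vu h'[OF uV] by (simp add: A'eq code')
    next
      case 2
      then have "h (Pal (surround a x)) \<noteq> k" using kV by (auto simp: nodes_pals)
      then show ?thesis using edges 2 hold[OF 2] by (simp add: A'eq code' edges_inv_def)
    qed
  qed
  have refs': "A' REF (h' (Pal p)) = refs s p + (if p = lps v then 1 else 0)" if "p \<in> pals (c # s)" for p
  proof (cases "p = v")
    case True
    have "refs s v = 0" using refs_eq_0[OF new pal_v(2)] .
    then show ?thesis using True hv lk \<open>lps v \<noteq> v\<close> by (simp add: A'eq)
  next
    case False
    then have p: "p \<in> pals s" using that P' by simp
    then have pV: "Pal p \<in> ?V" by (simp add: nodes_pals)
    then have hp: "h' (Pal p) = h (Pal p)" "h (Pal p) \<noteq> k" using h' kV by auto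
    have "refs s p + 1 < 2 ^ w" using refs_le[of s p] len by (intro small_less_word) simp
    moreover have "h (Pal p) = h l \<longleftrightarrow> p = lps v"
      using nodes pV lV inj_on_eq_iff[of h ?V "Pal p" l] by (simp add: nodes_inv_def l_def)
    ultimately show ?thesis using hp refs[OF p] by (auto simp: A'eq)
  qed
  have "h' ` Pal ` pals (c # s) = insert k (h ` Pal ` pals s)"
  proof -
    have "h' ` Pal ` pals s = h ` Pal ` pals s" using h' by (intro image_cong) (auto simp: nodes_pals)
    then show ?thesis by (simp add: P' hv)
  qed
  then have free': "free_list (h' ` Pal ` pals (c # s)) (A' 0 4) (A' 11)" using al(4) by (simp add: A'eq)
  have "\<forall>j. j \<notin> {0, LEN, LINK, LAB, ALT, EDGE, NEXT, REF} \<longrightarrow> A' j = A j"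
    using A5(1) frame2 by auto
  moreover have "\<forall>i. i \<noteq> 4 \<longrightarrow> A' 0 i = A 0 i" by (simp add: A'eq)
  moreover have "\<rho>' 3 = k \<and> (\<forall>r\<in>{0, 1, 2}. \<rho>' r = \<rho> r)" using r5 r1(3) by (simp add: \<rho>2_def)
  ultimately show ?thesis using ex nodes' edges' refs' free' by blast
qed

lemma less_N_R: "n < N \<Longrightarrow> Suc n < R"
proof -
  assume "n < N"
  moreover have "N \<le> 17 * (N + 2) + 16 + w" by simp
  ultimately have "Suc n \<le> 17 * (N + 2) + 16 + w" by (meson Suc_leI le_trans)
  then show ?thesis by (rule small_less_R)
qed

lemma near_neq [simp]: "0 < near d" "near d \<noteq> 0" "near d \<noteq> Suc 0" "Suc 0 \<noteq> near d" "near (\<not> d) \<noteq> near d" "near d \<noteq> near (\<not> d)"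
  "(3::nat) < numeral k \<Longrightarrow> near d \<noteq> numeral k" "(3::nat) < numeral k \<Longrightarrow> numeral k \<noteq> near d"
  by (auto simp: near_def)

lemma near_mod [simp]: "near d mod 2 ^ w = near d" "near d mod R = near d"
  by (auto simp: near_def)

lemma mod_pred: "0 < k \<Longrightarrow> k < M \<Longrightarrow> (k + M - 1) mod M = k - 1" for k M :: nat
  by (cases k) auto

lemma mod_pred2: "0 < k \<Longrightarrow> Suc k < M \<Longrightarrow> (Suc k + M - 2) mod M = k - 1" for k M :: nat
  by (cases k) auto

lemma ensure_node_correct:
  fixes c s
  defines "v \<equiv> lpp (c # s)" and "u \<equiv> center c s"
  assumes nodes: "nodes_inv (eertree_nodes s) h A" and edges: "edges_inv (pals s) h A"
    and bucket: "bucket_inv (c # s) A" and free: "free_list (h ` Pal ` pals s) (A 0 4) (A 11)"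
    and refs: "\<And>p. p \<in> pals s \<Longrightarrow> A REF (h (Pal p)) = refs s p"
    and letters: "\<And>i. i \<le> length s \<Longrightarrow> A TEXT (pos d P i) = (c # s) ! i"
    and sigma: "A 15 0 = \<sigma>" "set (c # s) \<subseteq> {..<\<sigma>}" and len: "length s < N"
    and regs: "\<rho> 0 = c" "\<rho> 2 = P" "\<rho> 4 = code A c" "\<rho> 6 = h u"
  shows "\<exists>h' \<rho>' A'. exec w (ensure_node d) (\<rho>, A) = (\<rho>', A') \<and> \<rho>' 3 = h' (Pal v) \<and> (\<forall>r\<in>{0, 1, 2}. \<rho>' r = \<rho> r) \<and>
    (\<forall>j. j \<notin> {0, LEN, LINK, LAB, ALT, EDGE, NEXT, REF} \<longrightarrow> A' j = A j) \<and> (\<forall>i. i \<noteq> 4 \<longrightarrow> A' 0 i = A 0 i) \<and>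
    nodes_inv (eertree_nodes (c # s)) h' A' \<and> edges_inv (pals (c # s)) h' A' \<and>
    (\<forall>p\<in>pals (c # s). A' REF (h' (Pal p)) = refs s p + (if v \<notin> pals s \<and> p = lps v then 1 else 0)) \<and>
    free_list (h' ` Pal ` pals (c # s)) (A' 0 4) (A' 11) \<and> (\<forall>x\<in>eertree_nodes s. h' x = h x)"
proof -
  have uV: "u \<in> eertree_nodes s" unfolding u_def by (rule center_in_nodes)
  have vu: "v = surround c u" unfolding v_def u_def by (rule lpp_Cons)
  have c: "c < \<sigma>" "set s \<subseteq> set (c # s)" using sigma by auto
  note look = edge_lookup[OF nodes edges bucket c(2) sigma(2) uV c(1)]
  let ?e = "pair (h u) (code A c)"
  let ?\<rho> = "\<rho>(5 := ?e, 3 := A NEXT ?e)"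
  have "aval w (pair_e (Var 6) (Var 4)) (\<rho>, A) = ?e"
    using aval_pair_e(1)[of "Var 6" "(\<rho>, A)" "Var 4"] regs nodes uV code_less[OF bucket c(1)]
    by (auto simp: nodes_inv_def)
  then have ex: "exec w (ensure_node d) (\<rho>, A) =
      exec w (If_Eq (Var 3) (Const 0) (create_node d) Skip) (?\<rho>, A)"
    using look(3) by (simp add: ensure_node_def)
  show ?thesis
  proof (cases "v \<in> pals s")
    case True
    have e: "A NEXT ?e = h (Pal v)" "h (Pal v) \<noteq> 0"
      using look(1) True vu nodes_inv_ge2[OF nodes True] by auto
    then have "exec w (ensure_node d) (\<rho>, A) = (?\<rho>, A)" unfolding ex by simp
    moreover have "pals (c # s) = pals s" "eertree_nodes (c # s) = eertree_nodes s"
      using True by (auto simp: pals_Cons nodes_Cons v_def nodes_pals)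
    ultimately show ?thesis using True e nodes edges free refs
      by (intro exI[of _ h] exI[of _ ?\<rho>] exI[of _ A]) simp
  next
    case False
    then have "A NEXT ?e = 0" using look(1) vu by simp
    then have ex': "exec w (ensure_node d) (\<rho>, A) = exec w (create_node d) (?\<rho>, A)" unfolding ex by simp
    define h1 where "h1 = h(Pal v := A 0 4)"
    have h1: "\<forall>x\<in>eertree_nodes s. h1 x = h x" "h1 (Pal v) = A 0 4"
      using False lpp_nonempty[of "c # s"] by (auto simp: nodes_pals v_def h1_def)
    obtain \<rho>' A' where "exec w (create_node d) (?\<rho>, A) = (\<rho>', A')" "\<rho>' 3 = A 0 4" "\<forall>r\<in>{0, 1, 2}. \<rho>' r = ?\<rho> r"
      "\<forall>j. j \<notin> {0, LEN, LINK, LAB, ALT, EDGE, NEXT, REF} \<longrightarrow> A' j = A j" "\<forall>i. i \<noteq> 4 \<longrightarrow> A' 0 i = A 0 i"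
      "nodes_inv (eertree_nodes (c # s)) h1 A'" "edges_inv (pals (c # s)) h1 A'"
      "\<forall>p\<in>pals (c # s). A' REF (h1 (Pal p)) = refs s p + (if p = lps v then 1 else 0)"
      "free_list (h1 ` Pal ` pals (c # s)) (A' 0 4) (A' 11)"
      using create_node_correct[OF nodes edges bucket free refs letters sigma len, of ?\<rho>] False regs
      unfolding v_def[symmetric] u_def[symmetric] h1_def[symmetric] by auto
    then show ?thesis unfolding ex' using False h1
      by (intro exI[of _ h1] exI[of _ \<rho>'] exI[of _ A']) simp
  qed
qed

text \<open>The longest palindromic prefix is a surface. For the empty string the slot is 0, the
  index of \<open>Odd\<close>.\<close>

lemma surf_first:
  assumes "surf_inv d s h P A" "nodes_inv (eertree_nodes s) h A"
  shows "A (near d) (P mod R) = h (lpn s)"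
proof (cases s)
  case Nil
  have "(P mod R, A (near d) (P mod R)) \<notin> graph R (A (near d))"
    using assms(1) Nil by (simp add: surf_inv_def)
  then show ?thesis using Nil assms(2) by (simp add: graph_iff lpn_def nodes_inv_def)
next
  case (Cons c t)
  have "(0, length (lpp s)) \<in> surfaces s" unfolding Cons surfaces_Cons by simp
  then have "(pos d P 0, h (Pal (factor s 0 (length (lpp s))))) \<in> graph R (A (near d))"
    using assms(1) unfolding surf_inv_def by force
  then show ?thesis using Cons by (simp add: graph_iff pos_0 factor_prefix take_lpp lpn_def)
qed

lemma surf_shift:
  assumes "surf_inv d s h P0 A" "P = alu w (move (\<not> d)) P0 1" "\<And>x. x \<in> eertree_nodes s \<Longrightarrow> h' x = h x"
  shows "graph R (A (near d)) = (\<lambda>(i, j). (pos d P (Suc i), h' (Pal (factor s i j)))) ` surfaces s"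
    and "graph R (A (near (\<not> d))) = (\<lambda>(i, j). (pos d P j, h' (Pal (factor s i j)))) ` surfaces s"
proof -
  have h': "h' (Pal (factor s i j)) = h (Pal (factor s i j))" if "(i, j) \<in> surfaces s" for i j
    using factor_in_pals[OF that] assms(3) by (auto simp: nodes_pals)
  show "graph R (A (near d)) = (\<lambda>(i, j). (pos d P (Suc i), h' (Pal (factor s i j)))) ` surfaces s"
    using assms(1) unfolding surf_inv_def assms(2)
    by (auto simp: pos_back[unfolded One_nat_def] h' intro!: image_cong)
  have "pos d P j = pos d P0 (j - 1)" if "(i, j) \<in> surfaces s" for i j
    using surfacesD[OF that] pos_back[of d P0 "j - 1"] assms(2) by simp
  then show "graph R (A (near (\<not> d))) = (\<lambda>(i, j). (pos d P j, h' (Pal (factor s i j)))) ` surfaces s"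
    using assms(1) unfolding surf_inv_def
    by (auto simp: h' intro!: image_cong)
qed

lemma add_surface_correct:
  fixes c s
  defines "v \<equiv> lpp (c # s)"
  assumes surf: "surf_inv d s h P0 A" and P: "P = alu w (move (\<not> d)) P0 1"
    and h': "\<And>x. x \<in> eertree_nodes s \<Longrightarrow> h' x = h x"
    and nodes: "nodes_inv (eertree_nodes (c # s)) h' A"
    and refs: "\<And>p. p \<in> pals (c # s) \<Longrightarrow> A REF (h' (Pal p)) = refs s p + (if v \<notin> pals s \<and> p = lps v then 1 else 0)"
    and len: "length s < N" and regs: "\<rho> 2 = P" "\<rho> 3 = h' (Pal v)"
  shows "\<exists>\<rho>' A'. exec w (add_surface d) (\<rho>, A) = (\<rho>', A') \<and> (\<forall>r\<in>{0, 1, 2}. \<rho>' r = \<rho> r) \<and>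
    (\<forall>j. j \<notin> {2, 3, REF} \<longrightarrow> A' j = A j) \<and> surf_inv d (c # s) h' P A' \<and>
    (\<forall>p\<in>pals (c # s). A' REF (h' (Pal p)) = refs (c # s) p)"
proof -
  let ?L = "length v" and ?k = "length (lps v)"
  let ?V = "eertree_nodes (c # s)"
  have v: "v \<noteq> []" "?L \<le> Suc (length s)" using lpp_nonempty length_lpp_le[of "c # s"] by (auto simp: v_def)
  have kL: "?k < ?L" using length_lps_less[OF v(1)] .
  have vV: "Pal v \<in> ?V" by (simp add: nodes_Cons v_def)
  have lV: "Pal (lps v) \<in> ?V" using node_link_in_nodes[OF vV] v by simp
  have hv: "h' (Pal v) < R" "h' (Pal v) \<noteq> 0" "A LEN (h' (Pal v)) = Suc ?L" "h' (Pal (lps v)) < R"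
    "A LEN (h' (Pal (lps v))) = Suc ?k"
    using nodes vV lV nodes_inv_less[OF nodes] nodes_inv_ge2[OF nodes, of v]
    by (auto simp: nodes_inv_def pals_Cons v_def)
  have Rn: "Suc (length s) < R" by (rule less_N_R[OF len])
  have Lw: "Suc ?L < 2 ^ w" "Suc ?k < 2 ^ w" "?L - 1 \<le> 2 ^ w" "?k - 1 \<le> 2 ^ w" using v(2) kL Rn R_less by linarith+
  have inj: "pos d P i = pos d P j \<longleftrightarrow> i = j" if "i \<le> Suc (length s)" "j \<le> Suc (length s)" for i j
    using pos_inj[of i j d P] that Rn by simp
  have G: "graph R (A (near d)) = (\<lambda>(i, j). (pos d P (Suc i), h' (Pal (factor s i j)))) ` surfaces s"
    "graph R (A (near (\<not> d))) = (\<lambda>(i, j). (pos d P j, h' (Pal (factor s i j)))) ` surfaces s"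
    by (rule surf_shift[OF surf P], erule h')+
  let ?g = "\<lambda>(i, j). (pos d P (Suc i), h' (Pal (factor s i j)))"
  let ?f = "\<lambda>(i, j). (pos d P j, h' (Pal (factor s i j)))"
  let ?S = "{(i, j) \<in> surfaces s. Suc j \<noteq> ?L}"
  let ?e = "pos d P (?L - 1)"
  define E where "E = alu w (move d) P (?L - 1)"
  have ER: "E mod R = ?e" unfolding E_def by (rule alu_move_mod[OF Lw(3)])
  define t where "t = A (near (\<not> d)) ?e"
  \<comment> \<open>Distinct ends have distinct slots, so this slot is occupied exactly if a surface
    is buried, and then holds the node of the link.\<close>
  have tb: "t = (if buried c s then h' (Pal (lps v)) else 0)"
  proof (cases "buried c s")
    case True
    then obtain i j where ij: "(i, j) \<in> surfaces s" "Suc j = ?L" by (auto simp: buried_def v_def)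
    have "(?e, h' (Pal (lps v))) \<in> graph R (A (near (\<not> d)))"
    proof -
      have "factor s i j = lps v" using ij buried_length(2)[of i j s c] by (simp add: v_def)
      moreover have "?L - 1 = j" using ij(2) by simp
      moreover have "?f (i, j) \<in> ?f ` surfaces s" using ij(1) by (rule imageI)
      ultimately show ?thesis using G(2) by (simp only: prod.case)
    qed
    then show ?thesis using True by (simp add: graph_iff t_def)
  next
    case False
    have "(?e, t) \<notin> graph R (A (near (\<not> d)))"
    proof
      assume "(?e, t) \<in> graph R (A (near (\<not> d)))"
      then obtain i j where ij: "(i, j) \<in> surfaces s" "pos d P (?L - 1) = pos d P j" unfolding G(2) by auto
      then have "?L - 1 = j" using inj[of "?L - 1" j] surfacesD[OF ij(1)] v by auto
      then have "Suc j = ?L" using kL by simp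
      then show False using False ij by (auto simp: buried_def v_def)
    qed
    then show ?thesis using False by (simp add: graph_iff t_def)
  qed
  have tk: "lps v \<noteq> []" if "buried c s"
  proof -
    from that obtain i j where "(i, j) \<in> surfaces s" "Suc j = length (lpp (c # s))"
      unfolding buried_def by blast
    then show ?thesis unfolding v_def by (rule buried_length(3))
  qed
  define A1 where "A1 = (if t = 0 then A else put (put A REF t ((A REF t + 2 ^ w - 1) mod 2 ^ w)) (near d) (pos d P (?L - ?k)) 0)"
  define A' where "A' = put (put (put A1 (near (\<not> d)) ?e (h' (Pal v))) (near d) (pos d P 0) (h' (Pal v)))
     REF (h' (Pal v)) ((A1 REF (h' (Pal v)) + 1) mod 2 ^ w)"
  have ex: "exec w (add_surface d) (\<rho>, A) = (\<rho>(5 := E, 6 := t), A')"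
  proof -
    have s1: "(Suc ?L + 2 ^ w - 2) mod 2 ^ w = ?L - 1"
      by (rule mod_pred2) (use kL Lw(1) in linarith)+
    have e1: "exec w (Set 5 (Bin (move d) (Var 2) (Bin Sub (Arr LEN (Var 3)) (Const 2)))) (\<rho>, A) = (\<rho>(5 := E), A)"
      using regs hv s1 by (simp add: E_def)
    have e2: "exec w (Set 6 (Arr (near (\<not> d)) (Var 5))) (\<rho>(5 := E), A) = (\<rho>(5 := E, 6 := t), A)"
      using ER by (simp add: t_def)
    let ?I = "If_Eq (Var 6) (Const 0) Skip
       (Put REF (Var 6) (Bin Sub (Arr REF (Var 6)) (Const 1)) ;;
        Put (near d) (Bin (move (\<not> d)) (Var 5) (Bin Sub (Arr LEN (Var 6)) (Const 2))) (Const 0))"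
    have e3: "exec w ?I (\<rho>(5 := E, 6 := t), A) = (\<rho>(5 := E, 6 := t), A1)"
    proof (cases "t = 0")
      case False
      then have b: "buried c s" "t = h' (Pal (lps v))" using tb by (auto split: if_splits)
      then have k: "0 < ?k" using tk by simp
      then have s2: "(Suc ?k + 2 ^ w - 2) mod 2 ^ w = ?k - 1" using Lw(2) by (rule mod_pred2)
      have "alu w (move (\<not> d)) E (?k - 1) mod R = pos (\<not> d) E (?k - 1)" by (rule alu_move_mod[OF Lw(4)])
      also have "\<dots> = pos d P (?L - 1 - (?k - 1))" unfolding E_def using kL Lw by (intro pos_return) auto
      also have "?L - 1 - (?k - 1) = ?L - ?k" using k by simp
      finally show ?thesis using False hv s2 b(2) by (simp add: A1_def)
    qed (simp add: A1_def)
    have e4: "exec w (Put (near (\<not> d)) (Var 5) (Var 3) ;; Put (near d) (Var 2) (Var 3) ;;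
        Put REF (Var 3) (Bin Add (Arr REF (Var 3)) (Const 1))) (\<rho>(5 := E, 6 := t), A1) = (\<rho>(5 := E, 6 := t), A')"
      using regs hv ER by (simp add: A'_def pos_0)
    show ?thesis unfolding add_surface_def exec.simps(4) e1 e2 e3 e4[unfolded exec.simps(4)] ..
  qed
  have near1: "graph R (A1 (near d)) = ?g ` ?S"
  proof (cases "buried c s")
    case True
    then obtain i0 j0 where ij: "(i0, j0) \<in> surfaces s" "Suc j0 = ?L" by (auto simp: buried_def v_def)
    have Si: "Suc i0 = ?L - ?k" using buried_length(1)[of i0 j0 s c] ij by (simp add: v_def)
    have "t \<noteq> 0" using True tb nodes_inv_ge2[OF nodes, of "lps v"] tk lV by (auto simp: nodes_pals)
    then have "A1 (near d) = (A (near d))(pos d P (Suc i0) := 0)" using Si by (simp add: A1_def fun_upd_def)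
    then have "graph R (A1 (near d)) = {y \<in> ?g ` surfaces s. fst y \<noteq> pos d P (Suc i0)}"
      unfolding G(1)[symmetric] by (simp only: graph_upd_0)
    also have "\<dots> = ?g ` {(i, j) \<in> surfaces s. i \<noteq> i0}"
    proof -
      have "pos d P (Suc i) = pos d P (Suc i0) \<longleftrightarrow> i = i0" if "(i, j) \<in> surfaces s" for i j
        using inj[of "Suc i" "Suc i0"] surfacesD[OF that] surfacesD[OF ij(1)] by auto
      then show ?thesis by force
    qed
    also have "{(i, j) \<in> surfaces s. i \<noteq> i0} = ?S"
    proof -
      have "i = i0 \<longleftrightarrow> Suc j = ?L" if "(i, j) \<in> surfaces s" for i j
        using that ij surfaces_fst_inj[OF ij(1), of j] surfaces_snd_inj[OF ij(1), of i] by (metis nat.inject)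
      then show ?thesis by auto
    qed
    finally show ?thesis .
  next
    case False
    then have "?S = surfaces s" by (auto simp: buried_def v_def)
    then show ?thesis using False tb G(1) by (simp add: A1_def)
  qed
  have far1: "graph R (A1 (near (\<not> d))) = ?f ` surfaces s" using G(2) by (simp add: A1_def)
  have S': "surfaces (c # s) = insert (0, ?L) ((\<lambda>(i, j). (Suc i, Suc j)) ` ?S)"
    unfolding surfaces_Cons v_def by auto
  have fv: "factor (c # s) 0 ?L = v" unfolding v_def by (simp add: factor_prefix take_lpp)
  have surf': "surf_inv d (c # s) h' P A'"
    unfolding surf_inv_def
  proof
    have "A' (near d) = (A1 (near d))(pos d P 0 := h' (Pal v))" by (simp add: A'_def fun_upd_def)
    then have "graph R (A' (near d)) = insert (pos d P 0, h' (Pal v)) {y \<in> ?g ` ?S. fst y \<noteq> pos d P 0}"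
      using graph_upd[OF pos_less hv(2)] near1 by (simp only:)
    also have "{y \<in> ?g ` ?S. fst y \<noteq> pos d P 0} = ?g ` ?S"
    proof -
      have "pos d P (Suc i) \<noteq> pos d P 0" if "(i, j) \<in> surfaces s" for i j
        using inj[of "Suc i" 0] surfacesD[OF that] by auto
      then show ?thesis by force
    qed
    finally show "graph R (A' (near d)) = (\<lambda>(i, j). (pos d P i, h' (Pal (factor (c # s) i j)))) ` surfaces (c # s)"
      unfolding S' using fv by (simp add: image_image case_prod_beta)
    have "A' (near (\<not> d)) = (A1 (near (\<not> d)))(?e := h' (Pal v))" by (simp add: A'_def fun_upd_def)
    then have "graph R (A' (near (\<not> d))) = insert (?e, h' (Pal v)) {y \<in> ?f ` surfaces s. fst y \<noteq> ?e}"
      using graph_upd[OF pos_less hv(2)] far1 by (simp only:)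
    also have "{y \<in> ?f ` surfaces s. fst y \<noteq> ?e} = ?f ` ?S"
    proof -
      have "pos d P j = ?e \<longleftrightarrow> Suc j = ?L" if "(i, j) \<in> surfaces s" for i j
        using inj[of j "?L - 1"] surfacesD[OF that] v kL by auto
      then show ?thesis by force
    qed
    finally show "graph R (A' (near (\<not> d))) = (\<lambda>(i, j). (pos d P (j - 1), h' (Pal (factor (c # s) i j)))) ` surfaces (c # s)"
      unfolding S' using fv by (simp add: image_image case_prod_beta)
  qed
  have refs': "A' REF (h' (Pal p)) = refs (c # s) p" if p: "p \<in> pals (c # s)" for p
  proof -
    define r where "r = refs s p + (if v \<notin> pals s \<and> p = lps v then 1 else 0)"
    have rc: "refs (c # s) p + (if buried c s \<and> p = lps v then 1 else 0) = r + (if p = v then 1 else 0)"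
      unfolding v_def r_def using refs_Cons[of c s p] by (simp only: ac_simps)
    have "r + 1 \<le> 2 * length s + 2" using refs_le[of s p] by (auto simp: r_def)
    also have "\<dots> < 2 ^ w" using len by (intro small_less_word) simp
    finally have bnd: "r + 1 < 2 ^ w" .
    have pV: "Pal p \<in> ?V" using p by (simp add: nodes_pals)
    have ne: "lps v \<noteq> v" using kL by auto
    have hinj: "h' (Pal p) = h' (Pal v) \<longleftrightarrow> p = v" "h' (Pal p) = h' (Pal (lps v)) \<longleftrightarrow> p = lps v"
      using nodes pV vV lV inj_on_eq_iff[of h' ?V] by (auto simp: nodes_inv_def)
    have t0: "t = 0 \<longleftrightarrow> \<not> buried c s"
      using tb nodes_inv_ge2[OF nodes, of "lps v"] tk lV by (auto simp: nodes_pals)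
    have rp: "A REF (h' (Pal p)) = r" unfolding r_def by (rule refs[OF p])
    have A1r: "A1 REF (h' (Pal p)) = (if buried c s \<and> p = lps v then (r + 2 ^ w - 1) mod 2 ^ w else r)"
    proof (cases "buried c s")
      case True
      have "A1 REF (h' (Pal p)) = (if h' (Pal p) = t then (A REF (h' (Pal p)) + 2 ^ w - 1) mod 2 ^ w else A REF (h' (Pal p)))"
        using True t0 by (simp add: A1_def)
      then show ?thesis unfolding rp using True tb hinj(2) by (simp only: if_True simp_thms)
    next
      case False
      then show ?thesis using t0 rp by (simp add: A1_def)
    qed
    have "A' REF (h' (Pal p)) = (if p = v then (A1 REF (h' (Pal p)) + 1) mod 2 ^ w else A1 REF (h' (Pal p)))"
      using hinj(1) by (auto simp: A'_def)
    also have "\<dots> = refs (c # s) p"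
    proof (cases "buried c s \<and> p = lps v")
      case True
      then have pv: "p \<noteq> v" using ne by metis
      have r1: "refs (c # s) p + 1 = r" using rc unfolding if_P[OF True] if_not_P[OF pv] by linarith
      then have "(r + 2 ^ w - 1) mod 2 ^ w = r - 1" using bnd by (intro mod_pred) linarith+
      then show ?thesis unfolding A1r if_P[OF True] if_not_P[OF pv] using r1 by linarith
    next
      case False
      have "refs (c # s) p = r + (if p = v then 1 else 0)" using rc unfolding if_not_P[OF False] by linarith
      then show ?thesis unfolding A1r if_not_P[OF False] using bnd by (cases "p = v") simp_all
    qed
    finally show ?thesis .
  qed
  have "\<forall>j. j \<notin> {2, 3, REF} \<longrightarrow> A' j = A j"
    by (auto simp: A'_def A1_def near_def)
  then show ?thesis using ex surf' refs' by auto
qed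

theorem push_correct:
  assumes inv: "inv d s h A" and c: "c < \<sigma>" and len: "length s < N" and r0: "\<rho> 0 = c"
  shows "\<exists>h'. inv d (c # s) h' (snd (exec w (push d) (\<rho>, A)))"
proof -
  note I = inv[unfolded inv_def]
  let ?n = "length s" and ?P0 = "A 0 (near d)"
  define P where "P = alu w (move (\<not> d)) ?P0 1"
  have nodes: "nodes_inv (eertree_nodes s) h A" and edges: "edges_inv (pals s) h A"
    and surf: "surf_inv d s h ?P0 A" and free: "free_list (h ` Pal ` pals s) (A 0 4) (A 11)"
    and bucket: "bucket_inv s A" and sigma: "A 15 0 = \<sigma>" "set s \<subseteq> {..<\<sigma>}"
    and refs: "\<And>p. p \<in> pals s \<Longrightarrow> A REF (h (Pal p)) = refs s p" and n: "A 0 1 = ?n"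
    and far: "pos d ?P0 ?n = pos d (A 0 (near (\<not> d))) 1"
    and letters: "\<And>i. i < ?n \<Longrightarrow> A TEXT (pos d ?P0 i) = s ! i"
    using I by blast+
  have n1: "Suc ?n < 2 ^ w" by (rule less_N_word[OF len])
  have Rn: "Suc ?n < R" by (rule less_N_R[OF len])
  let ?\<rho>1 = "\<rho>(1 := ?n, 3 := h (lpn s), 2 := P)"
  let ?A1 = "put A TEXT (P mod R) c"
  have start: "exec w (push d) (\<rho>, A) = exec w (count_char ;; find_center d ;; ensure_node d ;; add_surface d ;;
     Put 0 (Const 1) (Bin Add (Var 1) (Const 1)) ;; Put 0 (Const (near d)) (Var 2)) (?\<rho>1, ?A1)"
    using n surf_first[OF surf nodes] r0
    by (simp add: push_def P_def fun_upd_twist)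
  have bucket1: "bucket_inv s ?A1" using bucket by (simp add: bucket_inv_def)
  have code1: "code ?A1 = code A" by (simp add: code_def fun_eq_iff)
  obtain \<rho>2 A2 where e2: "exec w count_char (?\<rho>1, ?A1) = (\<rho>2, A2)"
    and r2: "\<forall>r. r \<notin> {4, 5} \<longrightarrow> \<rho>2 r = ?\<rho>1 r"
    and A2: "\<forall>j. j \<notin> {0, COUNT, BUCK} \<longrightarrow> A2 j = ?A1 j" "\<forall>i. i \<noteq> 5 \<longrightarrow> A2 0 i = ?A1 0 i"
    and bucket2: "bucket_inv (c # s) A2" and r24: "\<rho>2 4 = code A2 c"
    and code2: "\<forall>a\<in>set s. code A2 a = code ?A1 a"
    using count_char_correct[OF bucket1 c len, of ?\<rho>1] r0 sigma(2) by auto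
  have nodes2: "nodes_inv (eertree_nodes s) h A2"
    using nodes A2(1) by (simp add: nodes_inv_def)
  have edges2: "edges_inv (pals s) h A2"
  proof -
    have "code A2 a = code A a" if "surround a u \<in> pals s" for a u
      using surround_in_pals(2)[OF that] code2 code1 by simp
    then show ?thesis using edges A2(1) by (auto simp: edges_inv_def intro!: image_cong)
  qed
  have letters2: "A2 TEXT (pos d P i) = (c # s) ! i" if "i \<le> ?n" for i
  proof -
    have "pos d P i = P mod R \<longleftrightarrow> i = 0" using pos_inj[of i 0 d P] that Rn by (simp add: pos_0)
    moreover have "pos d P (Suc j) = pos d ?P0 j" for j unfolding P_def by (rule pos_back)
    ultimately show ?thesis using A2(1) letters[of "i - 1"] that by (cases i) auto
  qed
  have sigma2: "A2 15 0 = \<sigma>" "set (c # s) \<subseteq> {..<\<sigma>}" using A2(1) sigma c by auto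
  have refs2: "A2 REF (h (Pal p)) = refs s p" if "p \<in> pals s" for p using refs[OF that] A2(1) by simp
  have free2: "free_list (h ` Pal ` pals s) (A2 0 4) (A2 11)" using free A2 by simp
  obtain \<rho>3 where e3: "exec w (find_center d) (\<rho>2, A2) = (\<rho>3, A2)" and r36: "\<rho>3 6 = h (center c s)"
    and r3: "\<forall>r. r \<notin> {6, 7, 8} \<longrightarrow> \<rho>3 r = \<rho>2 r"
    using find_center_correct[OF nodes2 sigma(2) sigma2(1) c len letters2, of \<rho>2] r2 r0 by auto
  obtain h' \<rho>4 A4 where e4: "exec w (ensure_node d) (\<rho>3, A2) = (\<rho>4, A4)" and r43: "\<rho>4 3 = h' (Pal (lpp (c # s)))"
    and r4: "\<forall>r\<in>{0, 1, 2}. \<rho>4 r = \<rho>3 r"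
    and A4: "\<forall>j. j \<notin> {0, LEN, LINK, LAB, ALT, EDGE, NEXT, REF} \<longrightarrow> A4 j = A2 j" "\<forall>i. i \<noteq> 4 \<longrightarrow> A4 0 i = A2 0 i"
    and nodes4: "nodes_inv (eertree_nodes (c # s)) h' A4" and edges4: "edges_inv (pals (c # s)) h' A4"
    and refs4: "\<forall>p\<in>pals (c # s). A4 REF (h' (Pal p)) =
      refs s p + (if lpp (c # s) \<notin> pals s \<and> p = lps (lpp (c # s)) then 1 else 0)"
    and free4: "free_list (h' ` Pal ` pals (c # s)) (A4 0 4) (A4 11)" and h': "\<forall>x\<in>eertree_nodes s. h' x = h x"
    using ensure_node_correct[OF nodes2 edges2 bucket2 free2 refs2 letters2 sigma2 len, of \<rho>3] r3 r2 r0 r24 r36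
    by auto
  have "A4 (near d) = A (near d)" "A4 (near (\<not> d)) = A (near (\<not> d))" using A4(1) A2(1) by auto
  then have surf4: "surf_inv d s h ?P0 A4" using surf by (simp add: surf_inv_def)
  have regs4: "\<rho>4 2 = P" "\<rho>4 1 = ?n" using r4 r3 r2 by auto
  obtain \<rho>5 A5 where e5: "exec w (add_surface d) (\<rho>4, A4) = (\<rho>5, A5)"
    and r5: "\<forall>r\<in>{0, 1, 2}. \<rho>5 r = \<rho>4 r" and A5: "\<forall>j. j \<notin> {2, 3, REF} \<longrightarrow> A5 j = A4 j"
    and surf5: "surf_inv d (c # s) h' P A5" and refs5: "\<forall>p\<in>pals (c # s). A5 REF (h' (Pal p)) = refs (c # s) p"
    using add_surface_correct[OF surf4 P_def _ nodes4 _ len regs4(1) r43] h' refs4 by auto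
  define A6 where "A6 = put (put A5 0 1 (Suc ?n)) 0 (near d) P"
  have "snd (exec w (push d) (\<rho>, A)) = A6"
    unfolding start exec.simps(4) e2 e3 e4 e5 using r5 regs4 n1 by (simp add: A6_def)
  moreover have "inv d (c # s) h' A6"
    unfolding inv_def
  proof (intro conjI)
    have A60: "A6 0 x = A 0 x" if "x \<notin> {1, near d, 4, 5}" for x
      using that A5 A4(2) A2(2) by (auto simp: A6_def)
    have A6j: "A6 j = A5 j" if "j \<noteq> 0" for j using that by (simp add: A6_def)
    show "A6 15 0 = \<sigma>" using A6j A5 A4(1) sigma2 by simp
    show "A6 0 1 = length (c # s)" by (simp add: A6_def)
    show "length (c # s) \<le> N" using len by simp
    show "set (c # s) \<subseteq> {..<\<sigma>}" by (rule sigma2)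
    have P6: "A6 0 (near d) = P" by (simp add: A6_def)
    have "near (\<not> d) \<notin> {1, near d, 4, 5}" by simp
    then have F6: "A6 0 (near (\<not> d)) = A 0 (near (\<not> d))" by (rule A60)
    show "pos d (A6 0 (near d)) (length (c # s)) = pos d (A6 0 (near (\<not> d))) 1"
      unfolding P6 F6 using far by (simp add: P_def pos_back[unfolded One_nat_def])
    show "\<forall>i<length (c # s). A6 TEXT (pos d (A6 0 (near d)) i) = (c # s) ! i"
      unfolding P6 using letters2 A6j[of TEXT] A5 A4(1) by (simp add: less_Suc_eq_le)
    show "surf_inv d (c # s) h' (A6 0 (near d)) A6"
      unfolding P6 using surf5 A6j by (simp add: surf_inv_def)
    show "nodes_inv (eertree_nodes (c # s)) h' A6"
      using nodes4 A6j A5 by (simp add: nodes_inv_def)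
    have "code A6 = code A4" using A6j A5 by (simp add: code_def fun_eq_iff)
    then show "edges_inv (pals (c # s)) h' A6"
      using edges4 A6j A5 by (simp add: edges_inv_def)
    show "\<forall>p\<in>pals (c # s). A6 REF (h' (Pal p)) = refs (c # s) p"
      using refs5 A6j by simp
    have "A6 0 4 = A4 0 4" "A6 0 5 = A2 0 5" using A5 A4(2) by (simp_all add: A6_def)
    then show "free_list (h' ` Pal ` pals (c # s)) (A6 0 4) (A6 11)" "bucket_inv (c # s) A6"
      using free4 bucket2 A6j A5 A4(1) by (simp_all add: bucket_inv_def)
  qed
  ultimately show ?thesis by blast
qed

section \<open>Correctness of a pop\<close>

lemma nodes_inv_subset: "nodes_inv V h A \<Longrightarrow> V' \<subseteq> V \<Longrightarrow> nodes_inv V' h A"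
  unfolding nodes_inv_def by (auto intro: inj_on_subset)

text \<open>With the surface of \<open>v\<close> already subtracted, the counter of \<open>v\<close>
  equals \<open>refs s v\<close>, so it is zero exactly if \<open>v\<close> does not occur in
  \<open>s\<close>. A surface that reappears is counted again only afterwards.\<close>

lemma drop_node_correct:
  fixes c s
  defines "v \<equiv> lpp (c # s)"
  assumes nodes: "nodes_inv (eertree_nodes (c # s)) h A" and edges: "edges_inv (pals (c # s)) h A"
    and bucket: "bucket_inv (c # s) A" and free: "free_list (h ` Pal ` pals (c # s)) (A 0 4) (A 11)"
    and sigma: "set (c # s) \<subseteq> {..<\<sigma>}" and len: "length s < N"
    and refs: "\<And>p. p \<in> pals (c # s) \<Longrightarrow> A REF (h (Pal p)) + (if p = v then 1 else 0) = refs (c # s) p"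
    and regs: "\<rho> 3 = h (Pal v)" "\<rho> 9 = h (Pal (lps v))"
  shows "\<exists>A'. exec w drop_node (\<rho>, A) = (\<rho>, A') \<and>
    (\<forall>j. j \<notin> {0, NEXT, REF, 11} \<longrightarrow> A' j = A j) \<and> (\<forall>i. i \<noteq> 4 \<longrightarrow> A' 0 i = A 0 i) \<and>
    edges_inv (pals s) h A' \<and> free_list (h ` Pal ` pals s) (A' 0 4) (A' 11) \<and>
    (\<forall>p\<in>pals s. A' REF (h (Pal p)) + (if buried c s \<and> p = lps v then 1 else 0) = refs s p)"
proof -
  let ?V = "eertree_nodes (c # s)"
  have v: "v \<noteq> []" using lpp_nonempty[of "c # s"] by (simp add: v_def)
  have vP: "v \<in> pals (c # s)" by (simp add: pals_Cons v_def)
  have ne: "lps v \<noteq> v" using length_lps_less[OF v] by auto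
  have vV: "Pal v \<in> ?V" by (simp add: nodes_Cons v_def)
  have lV: "Pal (lps v) \<in> ?V" using node_link_in_nodes[OF vV] v by simp
  have hR: "h (Pal v) < R" "h (Pal (lps v)) < R" using nodes_inv_less[OF nodes] vV lV by auto
  have rc: "refs (c # s) p + (if buried c s \<and> p = lps v then 1 else 0) =
      refs s p + (if p = v then 1 else 0) + (if v \<notin> pals s \<and> p = lps v then 1 else 0)" for p
    unfolding v_def by (rule refs_Cons)
  have rv: "A REF (h (Pal v)) = refs s v" using refs[OF vP] rc[of v] ne by auto
  have hinj: "h (Pal p) = h (Pal v) \<longleftrightarrow> p = v" "h (Pal p) = h (Pal (lps v)) \<longleftrightarrow> p = lps v"
    if "p \<in> pals (c # s)" for p
  proof -
    have "Pal p \<in> ?V" using that by (simp add: nodes_pals)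
    then show "h (Pal p) = h (Pal v) \<longleftrightarrow> p = v" "h (Pal p) = h (Pal (lps v)) \<longleftrightarrow> p = lps v"
      using nodes vV lV inj_on_eq_iff[of h ?V] by (auto simp: nodes_inv_def)
  qed
  show ?thesis
  proof (cases "v \<in> pals s")
    case True
    then have "A REF (h (Pal v)) \<noteq> 0" using rv refs_pos by (metis less_irrefl)
    then have "exec w drop_node (\<rho>, A) = (\<rho>, A)" using regs hR by (simp add: drop_node_def)
    moreover have ps: "pals (c # s) = pals s" using True by (auto simp: pals_Cons v_def)
    moreover have "A REF (h (Pal p)) + (if buried c s \<and> p = lps v then 1 else 0) = refs s p" if "p \<in> pals s" for p
      using refs[of p] rc[of p] that ps True by auto
    ultimately show ?thesis using edges free by (intro exI[of _ A]) simp
  next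
    case False
    define u where "u = center c s"
    have vu: "v = surround c u" unfolding v_def u_def by (rule lpp_Cons)
    have uV: "u \<in> ?V" unfolding u_def using center_in_nodes[of c s] by (simp add: nodes_Cons)
    have c\<sigma>: "c < \<sigma>" using sigma by simp
    let ?e = "pair (h u) (code A c)"
    note look = edge_lookup[OF nodes edges bucket subset_refl sigma uV c\<sigma>]
    have edge: "A EDGE (h (Pal v)) = ?e" using edges vP vu by (simp add: edges_inv_def)
    have "A REF (h (Pal v)) = 0" using rv refs_eq_0[OF False v] by simp
    let ?k = "h (Pal v)" and ?l = "h (Pal (lps v))"
    define A' where "A' = put (put (put (put A NEXT ?e 0) REF ?l ((A REF ?l + 2 ^ w - 1) mod 2 ^ w))
      11 ?k ((A 0 4 + 2 ^ w - (?k + 1) mod 2 ^ w) mod 2 ^ w)) 0 4 ?k"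
    have ex: "exec w drop_node (\<rho>, A) = (\<rho>, A')"
      using regs hR \<open>A REF (h (Pal v)) = 0\<close> edge look(3)
      by (simp add: drop_node_def exec_release A'_def)
    have ps: "pals (c # s) = insert v (pals s)" by (simp add: pals_Cons v_def)
    have edges': "edges_inv (pals s) h A'"
      unfolding edges_inv_def
    proof (intro conjI allI impI)
      have code': "code A' = code A" by (simp add: A'_def code_def fun_eq_iff)
      let ?F = "\<lambda>(u, c). (pair (h u) (code A c), h (Pal (surround c u)))"
      have G: "graph R (A NEXT) = ?F ` {(x, a). surround a x \<in> pals (c # s)}"
        using edges by (simp add: edges_inv_def)
      have "A' NEXT = (A NEXT)(?e := 0)" by (simp add: A'_def fun_upd_def)
      then have "graph R (A' NEXT) = {y \<in> graph R (A NEXT). fst y \<noteq> ?e}" by (simp only: graph_upd_0)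
      also have "\<dots> = ?F ` {(u, c). surround c u \<in> pals s}"
      proof (intro set_eqI iffI)
        fix y assume y: "y \<in> {y \<in> graph R (A NEXT). fst y \<noteq> ?e}"
        then obtain x a where xa: "surround a x \<in> pals (c # s)" "y = ?F (x, a)" unfolding G by auto
        have "surround a x \<noteq> v" using surround_inj[of a x c u] xa(2) y vu by auto
        then have "surround a x \<in> pals s" using xa(1) ps by auto
        then show "y \<in> ?F ` {(u, c). surround c u \<in> pals s}" using xa(2) by force
      next
        fix y assume "y \<in> ?F ` {(u, c). surround c u \<in> pals s}"
        then obtain x a where xa: "surround a x \<in> pals s" "y = ?F (x, a)" by auto
        then have yG: "y \<in> graph R (A NEXT)" unfolding G using ps by force
        have "fst y \<noteq> ?e"
        proof
          assume "fst y = ?e"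
          then have "snd y = h (Pal v)" using look(2)[of "snd y"] yG vu by (metis prod.collapse)
          then have "h (Pal (surround a x)) = h (Pal v)" using xa(2) by simp
          then have "surround a x = v" using hinj(1)[of "surround a x"] xa(1) ps by blast
          then show False using xa(1) False by simp
        qed
        then show "y \<in> {y \<in> graph R (A NEXT). fst y \<noteq> ?e}" using yG by simp
      qed
      finally show "graph R (A' NEXT) = (\<lambda>(u, c). (pair (h u) (code A' c), h (Pal (surround c u)))) ` {(u, c). surround c u \<in> pals s}"
        unfolding code' .
      fix x a assume "surround a x \<in> pals s"
      then show "A' EDGE (h (Pal (surround a x))) = pair (h x) (code A' a)"
        unfolding code' using edges ps by (simp add: A'_def edges_inv_def)
    qed
    have free': "free_list (h ` Pal ` pals s) (A' 0 4) (A' 11)"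
    proof -
      have "h ` Pal ` pals s = h ` Pal ` pals (c # s) - {?k}"
        using hinj(1) False unfolding ps by auto
      moreover have "?k \<in> h ` Pal ` pals (c # s)" using vP by blast
      moreover have "A' 0 4 = ?k" "A' 11 = (A 11)(?k := (A 0 4 + 2 ^ w - (?k + 1) mod 2 ^ w) mod 2 ^ w)"
        by (simp_all add: A'_def fun_upd_def)
      ultimately show ?thesis using free_list_release[OF free _ free_list_head_less[OF free], of ?k] by (simp only:)
    qed
    have refs': "A' REF (h (Pal p)) + (if buried c s \<and> p = lps v then 1 else 0) = refs s p" if p: "p \<in> pals s" for p
    proof -
      have pP: "p \<in> pals (c # s)" and pv: "p \<noteq> v" using p False ps by auto
      have Ap: "A REF (h (Pal p)) = refs (c # s) p" using refs[OF pP] pv by simp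
      show ?thesis
      proof (cases "p = lps v")
        case True
        have r: "refs (c # s) p + (if buried c s then 1 else 0) = refs s p + 1"
          using rc[of p] pv True False by auto
        have "refs s p > 0" using refs_pos[OF p] .
        then have pos: "0 < refs (c # s) p" using r by (cases "buried c s") auto
        have "refs (c # s) p \<le> 2 * length s + 2" using refs_le[of "c # s" p] by simp
        also have "\<dots> < 2 ^ w" using len by (intro small_less_word) simp
        finally have "(refs (c # s) p + 2 ^ w - 1) mod 2 ^ w = refs (c # s) p - 1"
          by (rule mod_pred[OF pos])
        moreover have "A' REF (h (Pal p)) = (A REF (h (Pal p)) + 2 ^ w - 1) mod 2 ^ w"
          using True by (simp add: A'_def)
        ultimately show ?thesis using r pos Ap True by auto
      next
        case F: False
        then have "A' REF (h (Pal p)) = A REF (h (Pal p))" using hinj(2)[OF pP] by (simp add: A'_def)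
        then show ?thesis using rc[of p] Ap pv F by auto
      qed
    qed
    have "\<forall>j. j \<notin> {0, NEXT, REF, 11} \<longrightarrow> A' j = A j" "\<forall>i. i \<noteq> 4 \<longrightarrow> A' 0 i = A 0 i"
      by (auto simp: A'_def)
    then show ?thesis using ex edges' free' refs' by blast
  qed
qed

text \<open>No node is renumbered: the same \<open>h\<close> serves the shorter string.\<close>

theorem pop_correct:
  assumes inv: "inv d (c # s) h A"
  shows "inv d s h (snd (exec w (pop d) (\<rho>, A)))"
proof -
  note I = inv[unfolded inv_def]
  let ?n = "length s" and ?P = "A 0 (near d)"
  define v where "v = lpp (c # s)"
  let ?L = "length v" and ?k = "length (lps v)"
  let ?V = "eertree_nodes (c # s)"
  have nodes: "nodes_inv ?V h A" and edges: "edges_inv (pals (c # s)) h A"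
    and surf: "surf_inv d (c # s) h ?P A" and free: "free_list (h ` Pal ` pals (c # s)) (A 0 4) (A 11)"
    and bucket: "bucket_inv (c # s) A" and sigma: "A 15 0 = \<sigma>" "set (c # s) \<subseteq> {..<\<sigma>}"
    and refs: "\<And>p. p \<in> pals (c # s) \<Longrightarrow> A REF (h (Pal p)) = refs (c # s) p" and n: "A 0 1 = length (c # s)"
    and far: "pos d ?P (length (c # s)) = pos d (A 0 (near (\<not> d))) 1"
    and letters: "\<And>i. i < length (c # s) \<Longrightarrow> A TEXT (pos d ?P i) = (c # s) ! i" and len: "?n < N"
    using I by auto
  have n1: "Suc ?n < 2 ^ w" by (rule less_N_word[OF len])
  have Rn: "Suc ?n < R" by (rule less_N_R[OF len])
  have v: "v \<noteq> []" "?L \<le> Suc ?n" using lpp_nonempty length_lpp_le[of "c # s"] by (auto simp: v_def)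
  have kL: "?k < ?L" using length_lps_less[OF v(1)] .
  have vP: "v \<in> pals (c # s)" by (simp add: pals_Cons v_def)
  have vV: "Pal v \<in> ?V" by (simp add: nodes_Cons v_def)
  have lV: "Pal (lps v) \<in> ?V" using node_link_in_nodes[OF vV] v by simp
  have hv: "h (Pal v) < R" "A LEN (h (Pal v)) = Suc ?L" "A LINK (h (Pal v)) = h (Pal (lps v))"
    "h (Pal (lps v)) < R" "A LEN (h (Pal (lps v))) = Suc ?k"
    using nodes vV lV nodes_inv_less[OF nodes] v by (auto simp: nodes_inv_def)
  have Lw: "Suc ?L < 2 ^ w" "Suc ?k < 2 ^ w" "?L - 1 \<le> 2 ^ w" "?k - 1 \<le> 2 ^ w"
    using v(2) kL Rn R_less by linarith+
  have inj: "pos d ?P i = pos d ?P j \<longleftrightarrow> i = j" if "i \<le> Suc ?n" "j \<le> Suc ?n" for i j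
    using pos_inj[of i j d ?P] that Rn by simp
  let ?e = "pos d ?P (?L - 1)"
  define E where "E = alu w (move d) ?P (?L - 1)"
  have ER: "E mod R = ?e" unfolding E_def by (rule alu_move_mod[OF Lw(3)])
  have first: "A (near d) (?P mod R) = h (Pal v)"
    using surf_first[OF surf nodes] by (simp add: lpn_def v_def)
  have c0: "A TEXT (?P mod R) = c" using letters[of 0] by (simp add: pos_0)
  have s1: "(Suc ?L + 2 ^ w - 2) mod 2 ^ w = ?L - 1"
    by (rule mod_pred2) (use kL Lw(1) in linarith)+
  let ?\<rho>1 = "\<rho>(1 := Suc ?n, 2 := ?P, 3 := h (Pal v), 0 := c, 9 := h (Pal (lps v)), 5 := E)"
  define A1 where "A1 = put (put (put A (near d) (pos d ?P 0) 0) (near (\<not> d)) ?e 0) REF (h (Pal v))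
     ((A REF (h (Pal v)) + 2 ^ w - 1) mod 2 ^ w)"
  have start: "exec w (pop d) (\<rho>, A) = exec w (drop_node ;; unearth d ;; uncount_char ;;
     Put 0 (Const 1) (Bin Sub (Var 1) (Const 1)) ;;
     Put 0 (Const (near d)) (Bin (move d) (Var 2) (Const 1))) (?\<rho>1, A1)"
    using n first c0 hv s1 ER by (simp add: pop_def A1_def E_def pos_0)
  have nodes1: "nodes_inv ?V h A1" using nodes by (simp add: A1_def nodes_inv_def)
  have "code A1 = code A" by (simp add: A1_def code_def fun_eq_iff)
  then have edges1: "edges_inv (pals (c # s)) h A1" using edges by (simp add: A1_def edges_inv_def)
  have bucket1: "bucket_inv (c # s) A1" using bucket by (simp add: A1_def bucket_inv_def)
  have free1: "free_list (h ` Pal ` pals (c # s)) (A1 0 4) (A1 11)" using free by (simp add: A1_def)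
  have refs1: "A1 REF (h (Pal p)) + (if p = v then 1 else 0) = refs (c # s) p" if p: "p \<in> pals (c # s)" for p
  proof (cases "p = v")
    case True
    have pos: "0 < refs (c # s) v" using refs_pos[OF vP] .
    have "refs (c # s) v \<le> 2 * ?n + 2" using refs_le[of "c # s" v] by simp
    also have "\<dots> < 2 ^ w" using len by (intro small_less_word) simp
    finally have "(refs (c # s) v + 2 ^ w - 1) mod 2 ^ w = refs (c # s) v - 1" by (rule mod_pred[OF pos])
    then show ?thesis using True pos refs[OF vP] by (simp add: A1_def)
  next
    case False
    then have "h (Pal p) \<noteq> h (Pal v)"
      using nodes vV p inj_on_eq_iff[of h ?V "Pal p" "Pal v"] by (auto simp: nodes_inv_def nodes_pals)
    then show ?thesis using False refs[OF p] by (simp add: A1_def)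
  qed
  obtain A2 where e2: "exec w drop_node (?\<rho>1, A1) = (?\<rho>1, A2)"
    and A2: "\<forall>j. j \<notin> {0, NEXT, REF, 11} \<longrightarrow> A2 j = A1 j" "\<forall>i. i \<noteq> 4 \<longrightarrow> A2 0 i = A1 0 i"
    and edges2: "edges_inv (pals s) h A2" and free2: "free_list (h ` Pal ` pals s) (A2 0 4) (A2 11)"
    and refs2: "\<forall>p\<in>pals s. A2 REF (h (Pal p)) + (if buried c s \<and> p = lps v then 1 else 0) = refs s p"
    using drop_node_correct[OF nodes1 edges1 bucket1 free1 sigma(2) len, of ?\<rho>1] refs1 by (auto simp: v_def)
  let ?g = "\<lambda>(i, j). (pos d ?P (Suc i), h (Pal (factor s i j)))"
  let ?f = "\<lambda>(i, j). (pos d ?P j, h (Pal (factor s i j)))"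
  let ?S = "{(i, j) \<in> surfaces s. Suc j \<noteq> ?L}"
  have S': "surfaces (c # s) = insert (0, ?L) ((\<lambda>(i, j). (Suc i, Suc j)) ` ?S)"
    unfolding surfaces_Cons v_def by auto
  have near2: "graph R (A2 (near d)) = ?g ` ?S"
  proof -
    have "A2 (near d) = (A (near d))(pos d ?P 0 := 0)" using A2(1) by (simp add: A1_def fun_upd_def)
    then have "graph R (A2 (near d)) = {y \<in> graph R (A (near d)). fst y \<noteq> pos d ?P 0}"
      by (simp only: graph_upd_0)
    also have "graph R (A (near d)) = insert (pos d ?P 0, h (Pal (factor (c # s) 0 ?L))) (?g ` ?S)"
      using surf unfolding surf_inv_def S' by (simp add: image_image case_prod_beta)
    also have "{y \<in> insert (pos d ?P 0, h (Pal (factor (c # s) 0 ?L))) (?g ` ?S). fst y \<noteq> pos d ?P 0} = ?g ` ?S"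
    proof -
      have "pos d ?P (Suc i) \<noteq> pos d ?P 0" if "(i, j) \<in> surfaces s" for i j
        using inj[of "Suc i" 0] surfacesD[OF that] by auto
      then show ?thesis by force
    qed
    finally show ?thesis .
  qed
  have far2: "graph R (A2 (near (\<not> d))) = ?f ` ?S"
  proof -
    have "A2 (near (\<not> d)) = (A (near (\<not> d)))(?e := 0)" using A2(1) by (simp add: A1_def fun_upd_def)
    then have "graph R (A2 (near (\<not> d))) = {y \<in> graph R (A (near (\<not> d))). fst y \<noteq> ?e}"
      by (simp only: graph_upd_0)
    also have "graph R (A (near (\<not> d))) = insert (?e, h (Pal (factor (c # s) 0 ?L))) (?f ` ?S)"
      using surf unfolding surf_inv_def S' by (simp add: image_image case_prod_beta)
    also have "{y \<in> insert (?e, h (Pal (factor (c # s) 0 ?L))) (?f ` ?S). fst y \<noteq> ?e} = ?f ` ?S"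
    proof -
      have "pos d ?P j \<noteq> ?e" if "(i, j) \<in> surfaces s" "Suc j \<noteq> ?L" for i j
        using inj[of j "?L - 1"] surfacesD[OF that(1)] that(2) v kL by auto
      then show ?thesis by force
    qed
    finally show ?thesis .
  qed
  let ?b = "pos d ?P (?L - ?k)" and ?l = "h (Pal (lps v))"
  \<comment> \<open>\<open>buried_iff\<close> refers to the surfaces of \<open>c # s\<close>, while
    the surface of \<open>v\<close> is already erased in \<open>A2\<close>. It starts at 0 and the
    slot tested lies further right, so the test is not affected.\<close>
  have buried: "buried c s \<longleftrightarrow> 0 < ?k \<and> A2 (near d) ?b = 0"
  proof (cases "0 < ?k")
    case True
    have "A2 (near d) ?b = 0 \<longleftrightarrow> (\<nexists>j. (?L - ?k, j) \<in> surfaces (c # s))"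
    proof -
      have iff: "(?b, x) \<in> graph R (A2 (near d)) \<longleftrightarrow> (\<exists>i j. (i, j) \<in> ?S \<and> Suc i = ?L - ?k \<and> x = h (Pal (factor s i j)))" for x
      proof -
        have "pos d ?P (Suc i) = ?b \<longleftrightarrow> Suc i = ?L - ?k" if "(i, j) \<in> surfaces s" for i j
          using inj[of "Suc i" "?L - ?k"] surfacesD[OF that] v by auto
        then show ?thesis unfolding near2 by force
      qed
      have "(\<exists>j. (?L - ?k, j) \<in> surfaces (c # s)) \<longleftrightarrow> (\<exists>i j. (i, j) \<in> ?S \<and> Suc i = ?L - ?k)"
        unfolding S' using kL by force
      also have "\<dots> \<longleftrightarrow> (\<exists>x. (?b, x) \<in> graph R (A2 (near d)))" unfolding iff by blast
      finally show ?thesis by (simp add: graph_iff)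
    qed
    then show ?thesis using True buried_iff[of c s] by (simp add: v_def)
  next
    case False
    then show ?thesis using buried_iff[of c s] by (simp add: v_def)
  qed
  define A3 where "A3 = (if buried c s then put (put (put A2 (near d) ?b ?l) (near (\<not> d)) ?e ?l) REF ?l
     ((A2 REF ?l + 1) mod 2 ^ w) else A2)"
  have e3: "\<exists>\<rho>3. exec w (unearth d) (?\<rho>1, A2) = (\<rho>3, A3) \<and> (\<forall>r. r \<noteq> 6 \<longrightarrow> \<rho>3 r = ?\<rho>1 r)"
  proof (cases "0 < ?k")
    case True
    have lenl: "A2 LEN ?l = Suc ?k" using A2(1) hv by (simp add: A1_def)
    have s2: "(Suc ?k + 2 ^ w - 2) mod 2 ^ w = ?k - 1" using True Lw(2) by (rule mod_pred2)
    have "alu w (move (\<not> d)) E (?k - 1) mod R = pos (\<not> d) E (?k - 1)" by (rule alu_move_mod[OF Lw(4)])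
    also have "\<dots> = pos d ?P (?L - 1 - (?k - 1))" unfolding E_def using kL Lw by (intro pos_return) auto
    also have "?L - 1 - (?k - 1) = ?L - ?k" using True by simp
    finally have b: "alu w (move (\<not> d)) E (?k - 1) mod R = ?b" .
    have "exec w (unearth d) (?\<rho>1, A2) = (?\<rho>1(6 := alu w (move (\<not> d)) E (?k - 1)), A3)"
      using True buried lenl s2 b hv ER by (simp add: unearth_def A3_def)
    then show ?thesis by simp
  next
    case False
    have lenl: "A2 LEN ?l = Suc ?k" using A2(1) hv by (simp add: A1_def)
    have "exec w (unearth d) (?\<rho>1, A2) = (?\<rho>1, A3)"
      using False buried lenl hv by (simp add: unearth_def A3_def)
    then show ?thesis by simp
  qed
  then obtain \<rho>3 where e3: "exec w (unearth d) (?\<rho>1, A2) = (\<rho>3, A3)" and r3: "\<forall>r. r \<noteq> 6 \<longrightarrow> \<rho>3 r = ?\<rho>1 r"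
    by blast
  have A3: "A3 j = A2 j" if "j \<notin> {2, 3, REF}" for j using that by (auto simp: A3_def near_def)
  have bur: "\<exists>i0 j0. (i0, j0) \<in> surfaces s \<and> Suc j0 = ?L \<and> Suc i0 = ?L - ?k \<and> factor s i0 j0 = lps v \<and>
      surfaces s = insert (i0, j0) ?S" if b: "buried c s"
  proof -
    obtain i0 j0 where ij: "(i0, j0) \<in> surfaces s" "Suc j0 = ?L" using b by (auto simp: buried_def v_def)
    note bl = buried_length[OF ij(1) ij(2)[unfolded v_def], folded v_def]
    have S: "surfaces s = insert (i0, j0) ?S"
    proof (intro set_eqI iffI)
      fix x assume x: "x \<in> surfaces s"
      show "x \<in> insert (i0, j0) ?S"
      proof (cases "Suc (snd x) = ?L")
        case True
        then have "snd x = j0" using ij(2) by linarith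
        then obtain i where xi: "x = (i, j0)" by (cases x) simp
        then have "i0 = i" using x surfaces_snd_inj[OF ij(1)] by blast
        then show ?thesis using xi by blast
      qed (use x in auto)
    qed (use ij in auto)
    have "Suc i0 = ?L - ?k" using bl(1) by simp
    then show ?thesis using ij bl(2) S by (intro exI conjI)
  qed
  have l0: "?l \<noteq> 0" if "buried c s"
  proof -
    have "lps v \<noteq> []" using buried that by auto
    then show ?thesis using nodes_inv_ge2[OF nodes, of "lps v"] lV by (auto simp: nodes_pals)
  qed
  have near3: "graph R (A3 (near d)) = ?g ` surfaces s"
  proof (cases "buried c s")
    case True
    obtain i0 j0 where ij: "Suc i0 = ?L - ?k" "factor s i0 j0 = lps v" "surfaces s = insert (i0, j0) ?S"
      using bur[OF True] by blast
    have "A3 (near d) = (A2 (near d))(?b := ?l)" using True by (simp add: A3_def fun_upd_def)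
    then have "graph R (A3 (near d)) = insert (?b, ?l) {y \<in> graph R (A2 (near d)). fst y \<noteq> ?b}"
      using graph_upd[OF pos_less l0[OF True]] by (simp only:)
    also have "{y \<in> graph R (A2 (near d)). fst y \<noteq> ?b} = graph R (A2 (near d))"
      using True buried by (auto simp: graph_def)
    also have "insert (?b, ?l) (graph R (A2 (near d))) = ?g ` insert (i0, j0) ?S"
      unfolding near2 image_insert prod.case ij(1,2) ..
    finally show ?thesis using ij(3) by (simp only:)
  next
    case False
    then have "?S = surfaces s" by (auto simp: buried_def v_def)
    then show ?thesis using near2 False by (simp add: A3_def)
  qed
  have far3: "graph R (A3 (near (\<not> d))) = ?f ` surfaces s"
  proof (cases "buried c s")
    case True
    obtain i0 j0 where ij: "Suc j0 = ?L" "factor s i0 j0 = lps v" "surfaces s = insert (i0, j0) ?S"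
      using bur[OF True] by blast
    have e: "?e = pos d ?P j0" using ij(1) by (simp flip: ij(1))
    have "A3 (near (\<not> d)) = (A2 (near (\<not> d)))(?e := ?l)" using True by (simp add: A3_def fun_upd_def)
    then have "graph R (A3 (near (\<not> d))) = insert (?e, ?l) {y \<in> graph R (A2 (near (\<not> d))). fst y \<noteq> ?e}"
      using graph_upd[OF pos_less l0[OF True]] by (simp only:)
    also have "{y \<in> graph R (A2 (near (\<not> d))). fst y \<noteq> ?e} = graph R (A2 (near (\<not> d)))"
      using A2(1) by (auto simp: graph_def A1_def)
    also have "insert (?e, ?l) (graph R (A2 (near (\<not> d)))) = ?f ` insert (i0, j0) ?S"
      unfolding far2 image_insert prod.case ij(2) e ..
    finally show ?thesis using ij(3) by (simp only:)
  next
    case False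
    then have "?S = surfaces s" by (auto simp: buried_def v_def)
    then show ?thesis using far2 False by (simp add: A3_def)
  qed
  have refs3: "A3 REF (h (Pal p)) = refs s p" if p: "p \<in> pals s" for p
  proof -
    have r2: "A2 REF (h (Pal p)) + (if buried c s \<and> p = lps v then 1 else 0) = refs s p" using refs2 p by blast
    have "Pal p \<in> ?V" using p by (simp add: nodes_pals pals_Cons)
    then have hl: "h (Pal p) = ?l \<longleftrightarrow> p = lps v"
      using nodes lV inj_on_eq_iff[of h ?V "Pal p" "Pal (lps v)"] by (auto simp: nodes_inv_def)
    show ?thesis
    proof (cases "buried c s \<and> p = lps v")
      case True
      have "refs s p \<le> 2 * ?n" by (rule refs_le)
      also have "\<dots> < 2 ^ w" using len by (intro small_less_word) simp
      finally show ?thesis using True r2 by (simp add: A3_def)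
    next
      case False
      then have "A3 REF (h (Pal p)) = A2 REF (h (Pal p))" using hl by (auto simp: A3_def)
      then show ?thesis using r2 False by auto
    qed
  qed
  have bucket3: "bucket_inv (c # s) A3"
    using bucket1 A3 A2 by (simp add: bucket_inv_def)
  have r30: "\<rho>3 0 = c" using r3 by simp
  have c\<sigma>: "c < \<sigma>" using sigma by simp
  obtain \<rho>4 A4 where e4: "exec w uncount_char (\<rho>3, A3) = (\<rho>4, A4)" and r4: "\<forall>r. r \<notin> {4, 5} \<longrightarrow> \<rho>4 r = \<rho>3 r"
    and A4: "\<forall>j. j \<notin> {0, COUNT, BUCK, 14} \<longrightarrow> A4 j = A3 j" "\<forall>i. i \<noteq> 5 \<longrightarrow> A4 0 i = A3 0 i"
    and bucket4: "bucket_inv s A4" and code4: "\<forall>a\<in>set s. code A4 a = code A3 a"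
    using uncount_char_correct[of c s A3 \<rho>3, OF bucket3 c\<sigma> len r30] by blast
  define P where "P = alu w (move d) ?P 1"
  define A5 where "A5 = put (put A4 0 1 ?n) 0 (near d) P"
  have "snd (exec w (pop d) (\<rho>, A)) = A5"
    unfolding start exec.simps(4) e2 e3 e4 using r4 r3 n1 by (simp add: A5_def P_def)
  moreover have "inv d s h A5"
    unfolding inv_def
  proof (intro conjI)
    have A5j: "A5 j = A4 j" if "j \<noteq> 0" for j using that by (simp add: A5_def)
    have keep: "A5 j = A1 j" if "j \<notin> {0, 2, 3, NEXT, REF, 11, COUNT, BUCK, 14}" for j
      using that A5j[of j] A4(1) A3[of j] A2(1) by simp
    have keepA: "A5 j = A j" if "j \<notin> {0, 2, 3, NEXT, REF, 11, COUNT, BUCK, 14}" for j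
      using keep[OF that] that by (auto simp: A1_def near_def)
    have P5: "A5 0 (near d) = P" by (simp add: A5_def)
    have Pf: "pos d P i = pos d ?P (Suc i)" for i unfolding P_def by (rule pos_forth)
    show "A5 15 0 = \<sigma>" using keepA sigma by simp
    show "A5 0 1 = length s" by (simp add: A5_def)
    show "length s \<le> N" using len by simp
    show "set s \<subseteq> {..<\<sigma>}" using sigma by simp
    have F5: "A5 0 (near (\<not> d)) = A 0 (near (\<not> d))"
      using A4(2) A3[of 0] A2(2) by (simp add: A5_def A1_def)
    show "pos d (A5 0 (near d)) (length s) = pos d (A5 0 (near (\<not> d))) 1"
      unfolding P5 F5 using far by (simp add: Pf)
    show "\<forall>i<length s. A5 TEXT (pos d (A5 0 (near d)) i) = s ! i"
      unfolding P5 Pf using letters keepA[of TEXT] by force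
    show "surf_inv d s h (A5 0 (near d)) A5"
      unfolding P5 surf_inv_def
    proof
      have "A5 (near d) = A3 (near d)" using A5j A4(1) by (auto simp: near_def)
      then show "graph R (A5 (near d)) = (\<lambda>(i, j). (pos d P i, h (Pal (factor s i j)))) ` surfaces s"
        unfolding Pf using near3 by simp
      have "A5 (near (\<not> d)) = A3 (near (\<not> d))" using A5j A4(1) by (auto simp: near_def)
      moreover have "pos d P (j - 1) = pos d ?P j" if "(i, j) \<in> surfaces s" for i j
        using surfacesD[OF that] Pf[of "j - 1"] by simp
      ultimately show "graph R (A5 (near (\<not> d))) = (\<lambda>(i, j). (pos d P (j - 1), h (Pal (factor s i j)))) ` surfaces s"
        using far3 by (auto intro!: image_cong)
    qed
    have "nodes_inv ?V h A5" using nodes keepA by (simp add: nodes_inv_def)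
    then show "nodes_inv (eertree_nodes s) h A5" by (rule nodes_inv_subset) (auto simp: nodes_Cons)
    have "code A5 a = code A2 a" if "surround a u \<in> pals s" for a u
      using surround_in_pals(2)[OF that] code4 A5j A3 by (simp add: code_def)
    then show "edges_inv (pals s) h A5"
      using edges2 A5j A4(1) A3 by (auto simp: edges_inv_def intro!: image_cong)
    show "\<forall>p\<in>pals s. A5 REF (h (Pal p)) = refs s p"
      using refs3 A5j A4(1) by simp
    have "A5 0 4 = A2 0 4" "A5 11 = A2 11" using A5j A4 A3 by (simp_all add: A5_def)
    then show "free_list (h ` Pal ` pals s) (A5 0 4) (A5 11)" using free2 by simp
    have "A5 0 5 = A4 0 5" by (simp add: A5_def)
    then show "bucket_inv s A5" using bucket4 A5j by (simp add: bucket_inv_def)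
  qed
  ultimately show ?thesis by simp
qed

section \<open>Reversal of the string\<close>

lemma pos_far:
  assumes "pos d P n = pos d Q 1" "int a + x = int n - 1"
  shows "pos (\<not> d) Q a = nat ((if d then int P + x else int P - x) mod int R)"
proof -
  have "(if d then int P + int n else int P - int n) mod int R = (if d then int Q + 1 else int Q - 1) mod int R"
    using assms(1) int_pos[of d P n] int_pos[of d Q 1] by simp
  then have dv: "int R dvd (if d then (int P + int n) - (int Q + 1) else (int P - int n) - (int Q - 1))"
    unfolding mod_eq_dvd_iff by (auto simp: mod_eq_dvd_iff split: if_splits)
  have "(if \<not> d then int Q + int a else int Q - int a) - (if d then int P + x else int P - x)
      = - (if d then (int P + int n) - (int Q + 1) else (int P - int n) - (int Q - 1))"
    using assms(2) by simp
  then have "int R dvd (if \<not> d then int Q + int a else int Q - int a) - (if d then int P + x else int P - x)"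
    using dv by (simp only: dvd_minus_iff)
  then show ?thesis unfolding pos_def mod_eq_dvd_iff[symmetric] by simp
qed

lemma pos_far_index: "pos d P n = pos d Q 1 \<Longrightarrow> i < n \<Longrightarrow> pos (\<not> d) Q i = pos d P (n - 1 - i)"
  using pos_far[of d P n Q i "int (n - 1 - i)"] by (simp add: pos_def of_nat_diff)

text \<open>The position in front of the first letter, which is why \<open>pos_far\<close> admits
  the integer -1.\<close>

lemma pos_far_swap: "pos d P n = pos d Q 1 \<Longrightarrow> pos (\<not> d) Q n = pos (\<not> d) P 1"
  using pos_far[of d P n Q n "- 1"] by (simp add: pos_def)

text \<open>A change of direction needs no instruction: the same memory with the same indices
  represents the reversed string, the two surface arrays exchanging their roles.\<close>

lemma inv_rev:
  assumes "inv d s h A"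
  shows "inv (\<not> d) (rev s) h A"
proof -
  note I = assms[unfolded inv_def]
  let ?n = "length s" and ?P = "A 0 (near d)" and ?Q = "A 0 (near (\<not> d))"
  have far: "pos d ?P ?n = pos d ?Q 1" using I by blast
  have fac: "factor (rev s) (?n - j) (?n - i) = factor s i j" if "(i, j) \<in> surfaces s" for i j
    using surfacesD[OF that] factor_rev[of i j s] by (auto simp: palindrome_def)
  have "surf_inv (\<not> d) (rev s) h ?Q A"
    unfolding surf_inv_def surfaces_rev image_image not_not
  proof
    have G: "graph R (A (near d)) = (\<lambda>(i, j). (pos d ?P i, h (Pal (factor s i j)))) ` surfaces s"
      "graph R (A (near (\<not> d))) = (\<lambda>(i, j). (pos d ?P (j - 1), h (Pal (factor s i j)))) ` surfaces s"
      using I unfolding surf_inv_def by blast+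
    show "graph R (A (near (\<not> d))) = (\<lambda>x. case case x of (i, j) \<Rightarrow> (?n - j, ?n - i) of
        (i, j) \<Rightarrow> (pos (\<not> d) ?Q i, h (Pal (factor (rev s) i j)))) ` surfaces s"
      unfolding G(2)
    proof (rule image_cong[OF refl])
      fix x assume "x \<in> surfaces s"
      then obtain i j where x: "x = (i, j)" "(i, j) \<in> surfaces s" by (cases x) auto
      have "pos (\<not> d) ?Q (?n - j) = pos d ?P (?n - 1 - (?n - j))"
        using surfacesD[OF x(2)] by (intro pos_far_index[OF far]) auto
      moreover have "?n - 1 - (?n - j) = j - 1" using surfacesD[OF x(2)] by auto
      ultimately show "(case x of (i, j) \<Rightarrow> (pos d ?P (j - 1), h (Pal (factor s i j)))) =
        (case case x of (i, j) \<Rightarrow> (?n - j, ?n - i) of (i, j) \<Rightarrow> (pos (\<not> d) ?Q i, h (Pal (factor (rev s) i j))))"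
        using fac[OF x(2)] x(1) by simp
    qed
    show "graph R (A (near d)) = (\<lambda>x. case case x of (i, j) \<Rightarrow> (?n - j, ?n - i) of
        (i, j) \<Rightarrow> (pos (\<not> d) ?Q (j - 1), h (Pal (factor (rev s) i j)))) ` surfaces s"
      unfolding G(1)
    proof (rule image_cong[OF refl])
      fix x assume "x \<in> surfaces s"
      then obtain i j where x: "x = (i, j)" "(i, j) \<in> surfaces s" by (cases x) auto
      have "pos (\<not> d) ?Q (?n - i - 1) = pos d ?P (?n - 1 - (?n - i - 1))"
        using surfacesD[OF x(2)] by (intro pos_far_index[OF far]) auto
      moreover have "?n - 1 - (?n - i - 1) = i" using surfacesD[OF x(2)] by auto
      ultimately show "(case x of (i, j) \<Rightarrow> (pos d ?P i, h (Pal (factor s i j)))) =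
        (case case x of (i, j) \<Rightarrow> (?n - j, ?n - i) of (i, j) \<Rightarrow> (pos (\<not> d) ?Q (j - 1), h (Pal (factor (rev s) i j))))"
        using fac[OF x(2)] x(1) by simp
    qed
  qed
  moreover have "bucket_inv (rev s) A" using I by (simp add: bucket_inv_def flip: rev_filter)
  moreover have "A TEXT (pos (\<not> d) ?Q i) = rev s ! i" if "i < ?n" for i
    using pos_far_index[OF far that] I that by (simp add: rev_nth)
  ultimately show ?thesis using I pos_far_swap[OF far] unfolding inv_def by simp
qed

lemma inv_cong:
  assumes "inv d s h A" "\<And>j. j < 16 \<Longrightarrow> A j = B j"
  shows "inv d s h B"
proof -
  have n: "near d < 16" for d by (simp add: near_def)
  have "code A = code B" using assms(2) by (simp add: code_def fun_eq_iff)
  then show ?thesis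
    using assms(1) assms(2)[OF n] assms(2)
    by (simp add: inv_def surf_inv_def nodes_inv_def edges_inv_def bucket_inv_def)
qed

section \<open>Initialisation, operations and queries\<close>

abbreviation arrays_of :: "(nat \<Rightarrow> nat) \<Rightarrow> arrays" where
  "arrays_of m \<equiv> (\<lambda>j i. m (16 * i + j))"

lemma free_list_empty: "free_list {} 2 (\<lambda>_. 0)"
  unfolding free_list_def by (intro exI[of _ "[]"] exI[of _ 2]) auto

lemma init_correct:
  "\<exists>h. inv True [] h (snd (exec w init (initial [\<sigma>] (\<lambda>_. 0))))"
proof -
  define h :: "nat node \<Rightarrow> nat" where "h v = (if v = Odd then 0 else 1)" for v
  define A where "A = put (put (put (put (put (\<lambda>j i. 0) 0 3 (2 ^ w - 1)) 0 4 2) 0 5 2) LEN 1 1) 15 0 \<sigma>"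
  have "snd (exec w init (initial [\<sigma>] (\<lambda>_. 0))) = A"
    by (simp add: init_def initial_def A_def)
  moreover have "inv True [] h A"
    unfolding inv_def
  proof (intro conjI)
    have A: "A 0 2 = 0" "A 0 3 = 2 ^ w - 1" "A 0 4 = 2" "A 0 5 = 2" "A 2 = (\<lambda>_. 0)" "A 3 = (\<lambda>_. 0)"
      "A NEXT = (\<lambda>_. 0)" "A COUNT = (\<lambda>_. 0)" "A BUCK = (\<lambda>_. 0)" "A 11 = (\<lambda>_. 0)" "A 14 = (\<lambda>_. 0)"
      "A LINK = (\<lambda>_. 0)" "A LAB = (\<lambda>_. 0)" "A ALT = (\<lambda>_. 0)" "A LEN = (\<lambda>_. 0)(1 := 1)"
      by (simp_all add: A_def fun_upd_def)
    have g: "graph R (\<lambda>_. 0) = {}" by (auto simp: graph_def)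
    show "A 15 0 = \<sigma>" "A 0 1 = length []" by (simp_all add: A_def)
    show "pos True (A 0 (near True)) (length []) = pos True (A 0 (near (\<not> True))) 1"
    proof (rule pos_cong)
      have "int R dvd 2 ^ w" using word_eq by (metis dvd_triv_right of_nat_mult of_nat_numeral of_nat_power)
      then show "(if True then int (A 0 (near True)) + int (length []) else int (A 0 (near True)) - int (length [])) mod int R =
        (if True then int (A 0 (near (\<not> True))) + int 1 else int (A 0 (near (\<not> True))) - int 1) mod int R"
        by (simp add: A near_def of_nat_diff)
    qed
    show "surf_inv True [] h (A 0 (near True)) A" using g by (simp add: surf_inv_def near_def A)
    show "nodes_inv (eertree_nodes []) h A"
      using N2 by (auto simp: nodes_inv_def nodes_Nil h_def A alt_def)
    show "edges_inv (pals []) h A" using g by (simp add: edges_inv_def A)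
    show "free_list (h ` Pal ` pals []) (A 0 4) (A 11)" using free_list_empty by (simp add: A)
    show "bucket_inv [] A" using free_list_empty by (simp add: bucket_inv_def A)
  qed (simp_all)
  ultimately show ?thesis by auto
qed

end

definition eertree_programs :: eertree_impl where
  "eertree_programs =
     \<lparr>init_code = compile init 0,
      push_back_code = compile (push False) 0,
      push_front_code = compile (push True) 0,
      pop_back_code = compile (pop False) 0,
      pop_front_code = compile (pop True) 0,
      even_code = compile (Set 0 (Const 2)) 0,
      odd_code = compile (Set 0 (Const 1)) 0,
      len_code = compile len_query 0,
      link_code = compile link_query 0,
      next_code = compile next_query 0\<rparr>"

lemma near_less [simp]: "near d < 16" "near d \<noteq> 15" "15 \<noteq> near d" by (simp_all add: near_def)

lemma push_ok: "com_ok (push d)" "15 \<notin> puts (push d)"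
  by (simp_all add: push_def count_char_def find_center_def ensure_node_def create_node_def init_node_def
      add_surface_def search_def search_body_def build_def build_body_def alloc_def code_e_def pair_e_def)

lemma pop_ok: "com_ok (pop d)" "15 \<notin> puts (pop d)" "loop_free (pop d)"
  by (simp_all add: pop_def drop_node_def unearth_def uncount_char_def release_def)

lemma init_ok: "com_ok init" "loop_free init"
  by (simp_all add: init_def)

text \<open>The constants are generous; unfolding turns \<open>cost\<close> into an explicit linear
  term in \<open>L\<close>.\<close>

lemma push_cost: "cost L (push d) \<le> 1000 * L + 1000"
  by (simp add: push_def count_char_def find_center_def ensure_node_def create_node_def init_node_def
      add_surface_def search_def search_body_def build_def build_body_def alloc_def code_e_def pair_e_def)

lemma pop_cost: "cost L (pop d) \<le> 1000"
  by (simp add: pop_def drop_node_def unearth_def uncount_char_def release_def)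

lemma init_cost: "cost L init \<le> 1000"
  by (simp add: init_def)

context word_ram begin

text \<open>An operation at the back is one at the front of the reversed string;
  \<open>inv_rev\<close> is applied before and after it.\<close>

lemma op_correct:
  assumes inv: "inv True s h (arrays_of m)" and app: "applicable \<sigma> f s" and len: "length (apply_op f s) \<le> N"
    and run: "runs w (op_code eertree_programs f) (op_args f) m time space y"
  shows "\<exists>h'. inv True (apply_op f s) h' (arrays_of (mem y))"
proof -
  define c where "c = (case f of Push_Back _ \<Rightarrow> push False | Push_Front _ \<Rightarrow> push True | Pop_Back \<Rightarrow> pop False | Pop_Front \<Rightarrow> pop True)"
  have code: "op_code eertree_programs f = compile c 0"
    by (cases f) (simp_all add: c_def eertree_programs_def)
  have ok: "com_ok c" "15 \<notin> puts c" by (cases f; simp add: c_def push_ok pop_ok)+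
  let ?st = "initial (op_args f) m"
  have "represents y (exec w c ?st)"
    using runs_exec[OF w5 ok(1) _ run[unfolded code]] ok(2) by blast
  then have A: "j < 16 \<Longrightarrow> snd (exec w c ?st) j = arrays_of (mem y) j" for j
    by (auto simp: represents_def fun_eq_iff)
  have "\<exists>h'. inv True (apply_op f s) h' (snd (exec w c ?st))"
  proof (cases f)
    case (Push_Back a)
    have "\<exists>h'. inv False (a # rev s) h' (snd (exec w (push False) (fst ?st, arrays_of m)))"
      by (rule push_correct) (use inv_rev[OF inv] app len Push_Back in \<open>auto simp: initial_def\<close>)
    then obtain h' where "inv False (a # rev s) h' (snd (exec w c ?st))"
      using Push_Back by (auto simp: c_def initial_def)
    from inv_rev[OF this] show ?thesis using Push_Back by auto
  next
    case (Push_Front a)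
    have "\<exists>h'. inv True (a # s) h' (snd (exec w (push True) (fst ?st, arrays_of m)))"
      by (rule push_correct) (use inv app len Push_Front in \<open>auto simp: initial_def\<close>)
    then show ?thesis using Push_Front by (auto simp: c_def initial_def)
  next
    case Pop_Back
    then have "s = butlast s @ [last s]" using app by simp
    then have "rev s = last s # rev (butlast s)" by (metis rev.simps(2) rev_rev_ident rev_swap)
    then have "inv False (last s # rev (butlast s)) h (arrays_of m)"
      using inv_rev[OF inv] by (simp only: not_True_eq_False)
    then have "inv False (rev (butlast s)) h (snd (exec w (pop False) (fst ?st, arrays_of m)))"
      by (rule pop_correct)
    from inv_rev[OF this] show ?thesis using Pop_Back by (auto simp: c_def initial_def)
  next
    case Pop_Front
    then have "s = hd s # tl s" using app by simp
    then have "inv True (hd s # tl s) h (arrays_of m)" using inv by simp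
    then have "inv True (tl s) h (snd (exec w (pop True) (fst ?st, arrays_of m)))"
      by (rule pop_correct)
    then show ?thesis using Pop_Front by (auto simp: c_def initial_def)
  qed
  then show ?thesis using inv_cong A by meson
qed

lemma initial_simps:
  "fst (initial [x] m) 0 = x" "fst (initial [x, y] m) 0 = x" "fst (initial [x, y] m) (Suc 0) = y"
  "snd (initial args m) = arrays_of m"
  by (simp_all add: initial_def)

lemma queries_correct:
  assumes inv: "inv True s h (arrays_of m)" and C: "1000 \<le> C" and T: "1000 \<le> T" "1000 \<le> S"
  shows "provides_eertree eertree_programs \<sigma> w C T S s m"
proof -
  note I = inv[unfolded inv_def]
  let ?A = "arrays_of m" and ?h = "\<lambda>v. h v + 1"
  have nodes: "nodes_inv (eertree_nodes s) h ?A" and edges: "edges_inv (pals s) h ?A"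
    and bucket: "bucket_inv s ?A" and sigma: "set s \<subseteq> {..<\<sigma>}" and len: "length s \<le> N" using I by blast+
  note D = nodes[unfolded nodes_inv_def]
  have hw: "h v + 1 < 2 ^ w" if "v \<in> eertree_nodes s" for v
    using D that by (intro small_less_word) auto
  have hs: "(h v + 1 + 2 ^ w - 1) mod 2 ^ w = h v" "h v mod R = h v" if "v \<in> eertree_nodes s" for v
    using hw[OF that] nodes_inv_less[OF nodes that] by auto
  note ans = answers_compile[OF w5]
  have lenq: "answers w (compile len_query 0) [?h v] m C C (nat (node_len v mod 2 ^ w))" if v: "v \<in> eertree_nodes s" for v
  proof (rule ans)
    have "?A LEN (h v) = nat (node_len v + 1)" using D v by blast
    then have "fst (exec w len_query (initial [?h v] m)) 0 = (nat (node_len v + 1) + 2 ^ w - 1) mod 2 ^ w"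
      using hs[OF v] by (simp add: len_query_def initial_simps)
    \<comment> \<open>\<open>LEN\<close> is the length plus 1, so subtracting 1 modulo
      \<open>2 ^ w\<close> yields the two's complement, also for the length -1.\<close>
    also have "\<dots> = nat (node_len v mod 2 ^ w)"
    proof -
      have ge: "node_len v \<ge> - 1" by (cases v) auto
      have "int (nat (node_len v + 1) + 2 ^ w - 1) = int (nat (node_len v + 1)) + 2 ^ w - 1"
        by (subst of_nat_diff) (auto simp: trans_le_add2)
      also have "\<dots> = node_len v + 2 ^ w" using ge by simp
      finally have "int ((nat (node_len v + 1) + 2 ^ w - 1) mod 2 ^ w) = (node_len v + 2 ^ w) mod 2 ^ w"
        by (simp only: of_nat_mod of_nat_power of_nat_numeral)
      then have "int ((nat (node_len v + 1) + 2 ^ w - 1) mod 2 ^ w) = node_len v mod 2 ^ w" by simp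
      then show ?thesis by (metis nat_int)
    qed
    finally show "fst (exec w len_query (initial [?h v] m)) 0 = nat (node_len v mod 2 ^ w)" .
  qed (use C in \<open>simp_all add: len_query_def\<close>)
  have linkq: "answers w (compile link_query 0) [?h v] m C C (?h (node_link v))" if v: "v \<in> eertree_nodes s" for v
  proof (rule ans)
    have "?A LINK (h v) = h (node_link v)" using D v by blast
    then show "fst (exec w link_query (initial [?h v] m)) 0 = ?h (node_link v)"
      using hs[OF v] hw[OF node_link_in_nodes[OF v]] by (simp add: link_query_def initial_simps)
  qed (use C in \<open>simp_all add: link_query_def\<close>)
  have nextq: "answers w (compile next_query 0) [?h v, c] m T S
      (case node_next s v c of None \<Rightarrow> 0 | Some u \<Rightarrow> ?h u)" if v: "v \<in> eertree_nodes s" and c: "c < \<sigma>" for v c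
  proof (rule ans)
    note look = edge_lookup[OF nodes edges bucket subset_refl sigma v c]
    let ?\<rho> = "(fst (initial [?h v, c] m))(2 := h v, 0 := c)"
    have ce: "aval w code_e (?\<rho>, ?A) = code ?A c"
      using aval_code_e[OF bucket, of ?\<rho>] c by simp
    have "aval w (pair_e (Var 2) code_e) (?\<rho>, ?A) = pair (h v) (code ?A c)"
      using aval_pair_e(1)[of "Var 2" "(?\<rho>, ?A)" code_e] ce D v code_less[OF bucket c] by simp
    then have e: "aval w (Arr NEXT (pair_e (Var 2) code_e)) (?\<rho>, ?A) =
        (if surround c v \<in> pals s then h (Pal (surround c v)) else 0)"
      using look(1,3) by simp
    have i: "initial [?h v, c] m = (fst (initial [?h v, c] m), ?A)" by (simp add: initial_def)
    have s1: "exec w (Set 0 (Var 1)) (exec w (Set 2 (Bin Sub (Var 0) (Const 1))) (initial [?h v, c] m)) = (?\<rho>, ?A)"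
      using hs[OF v] by (simp add: initial_simps)
    have nx: "node_next s v c = (if surround c v \<in> pals s then Some (Pal (surround c v)) else None)"
      by (cases v) (auto simp: node_next_def nodes_pals pals_def)
    show "fst (exec w next_query (initial [?h v, c] m)) 0 = (case node_next s v c of None \<Rightarrow> 0 | Some u \<Rightarrow> ?h u)"
    proof (cases "surround c v \<in> pals s")
      case True
      then have "h (Pal (surround c v)) \<noteq> 0" "h (Pal (surround c v)) + 1 < 2 ^ w"
        using nodes_inv_ge2[OF nodes True] hw[of "Pal (surround c v)"] by (auto simp: nodes_pals)
      then show ?thesis
        unfolding next_query_def exec.simps(4) s1 using True e nx by (simp del: aval.simps(4))
    next
      case False
      then show ?thesis
        unfolding next_query_def exec.simps(4) s1 using e nx by (simp del: aval.simps(4))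
    qed
  qed (use T in \<open>simp_all add: next_query_def code_e_def pair_e_def\<close>)
  have evenq: "answers w (compile (Set 0 (Const 2)) 0) [] m C C (?h Even)"
    by (rule ans) (use C D in simp_all)
  have oddq: "answers w (compile (Set 0 (Const 1)) 0) [] m C C (?h Odd)"
    by (rule ans) (use C D in simp_all)
  show ?thesis
    unfolding provides_eertree_def
  proof (intro exI[of _ ?h] conjI ballI allI impI)
    show "inj_on ?h (eertree_nodes s)" using D by (auto simp: inj_on_def)
  qed (use hw lenq linkq nextq evenq oddq in \<open>simp_all add: eertree_programs_def\<close>)
qed

end

section \<open>Word size\<close>

text \<open>The invariant needs one bound \<open>N\<close> for the whole run. As the word size is
  fixed while the length varies, the bound is taken from \<open>w\<close> alone.\<close>

definition capacity :: "nat \<Rightarrow> nat" where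
  "capacity w = nat \<lfloor>2 powr (real w / 100)\<rfloor>"

lemma word_size_ok_100: "word_size_ok 100 w n \<Longrightarrow> 100 \<le> w"
proof -
  assume "word_size_ok 100 w n"
  moreover have "1 \<le> log 2 (real n + 2)" by simp
  ultimately have "100 \<le> real w" unfolding word_size_ok_def by linarith
  then show ?thesis by simp
qed

lemma word_size_ok_capacity: "word_size_ok 100 w n \<Longrightarrow> n + 2 \<le> capacity w"
proof -
  assume "word_size_ok 100 w n"
  then have "log 2 (real n + 2) \<le> real w / 100" by (simp add: word_size_ok_def)
  then have "2 powr (log 2 (real n + 2)) \<le> 2 powr (real w / 100)" by (intro powr_mono) auto
  then have "real n + 2 \<le> 2 powr (real w / 100)" by simp
  then show ?thesis unfolding capacity_def by (simp add: le_nat_iff le_floor_iff)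
qed

text \<open>With \<open>x = 2 powr (w / 100)\<close>, the room required is quadratic in
  \<open>x\<close>, while an array has \<open>x ^ 100 / 16\<close> entries.\<close>

lemma word_ram_capacity:
  assumes "100 \<le> w" "1 \<le> \<sigma>" "\<sigma> < 2 ^ w"
  shows "word_ram w \<sigma> (capacity w)"
proof
  define x where "x = 2 powr (real w / 100)"
  let ?N = "capacity w"
  have "2 powr 1 \<le> x" unfolding x_def using assms(1) by (intro powr_mono) auto
  then have x2: "2 \<le> x" by simp
  have N: "real ?N \<le> x" using x2 by (simp add: capacity_def x_def)
  show "2 \<le> capacity w" using x2 by (simp add: capacity_def x_def le_nat_iff le_floor_iff)
  show "5 \<le> w" "1 \<le> \<sigma>" "\<sigma> < 2 ^ w" using assms by auto
  \<comment> \<open>From \<open>1 / 2 <= ln 2\<close> and \<open>t <= exp t\<close>.\<close>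
  have wx: "real w \<le> 200 * x"
  proof -
    have "real w / 100 * (1 / 2) \<le> real w / 100 * ln 2"
      using ln_le_minus_one[of "1 / 2"] by (intro mult_left_mono) (auto simp: ln_div)
    also have "\<dots> \<le> exp (real w / 100 * ln 2)" using exp_ge_add_one_self[of "real w / 100 * ln 2"] by linarith
    also have "\<dots> = x" by (simp add: x_def powr_def)
    finally show ?thesis by simp
  qed
  define M where "M = 17 * (?N + 2) + 16 + w"
  have "real M \<le> 250 * x" using N wx x2 by (simp add: M_def)
  then have "real M * real M \<le> (250 * x) * (250 * x)" by (intro mult_mono) auto
  moreover have "real ?N + 2 \<le> 2 * (x * x)"
  proof -
    have "2 * x \<le> x * x" using x2 by (intro mult_right_mono) auto
    then show ?thesis using N x2 by linarith
  qed
  \<comment> \<open>The constant is \<open>250 ^ 2 + 2\<close>.\<close>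
  ultimately have "real (M * M + (?N + 2)) \<le> 62502 * x ^ 2"
    by (simp add: power2_eq_square)
  also have "\<dots> < 2 ^ 16 * x ^ 2" using x2 by simp
  also have "\<dots> \<le> x ^ 16 * x ^ 2" using x2 by (intro mult_right_mono power_mono) auto
  also have "\<dots> = x ^ 18" by (simp flip: power_add)
  also have "\<dots> \<le> x ^ 96" using x2 by (intro power_increasing) auto
  also have "x ^ 96 \<le> 2 ^ (w - 4)"
  proof -
    have "2 ^ 4 * x ^ 96 \<le> x ^ 4 * x ^ 96" using x2 by (intro mult_right_mono power_mono) auto
    also have "\<dots> = x ^ 100" by (simp flip: power_add)
    also have "\<dots> = 2 powr real w" by (simp add: x_def powr_power)
    also have "\<dots> = 2 ^ w" by (simp add: powr_realpow)
    also have "(2::real) ^ w = 2 ^ (4 + (w - 4))" using assms(1) by simp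
    also have "\<dots> = 2 ^ 4 * 2 ^ (w - 4)" by (rule power_add)
    finally show ?thesis by simp
  qed
  finally have "real (M * M + (?N + 2)) < real (2 ^ (w - 4))" by simp
  then have "M * M + (?N + 2) < 2 ^ (w - 4)" unfolding of_nat_less_iff .
  then show "(17 * (?N + 2) + 16 + w) * (17 * (?N + 2) + 16 + w) + (?N + 2) < 2 ^ (w - 4)"
    unfolding M_def .
qed

lemma reachable_inv:
  assumes "reachable eertree_programs 100 \<sigma> w s m" "1 \<le> \<sigma>" "\<sigma> < 2 ^ w"
  shows "100 \<le> w \<and> (\<exists>h. word_ram.inv w \<sigma> (capacity w) True s h (\<lambda>j i. m (16 * i + j)))"
  using assms(1)
proof induction
  case (init time space y)
  then have w: "100 \<le> w" using word_size_ok_100 by blast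
  interpret word_ram w \<sigma> "capacity w" using word_ram_capacity[OF w assms(2,3)] .
  have run: "runs w (compile init 0) [\<sigma>] (\<lambda>_. 0) time space y"
    using init(2) by (simp add: eertree_programs_def)
  have "represents y (exec w init (initial [\<sigma>] (\<lambda>_. 0)))"
    using runs_exec[OF w5 init_ok(1) _ run] init_ok(2) by blast
  then have "j < 16 \<Longrightarrow> snd (exec w init (initial [\<sigma>] (\<lambda>_. 0))) j = arrays_of (mem y) j" for j
    by (auto simp: represents_def fun_eq_iff)
  then show ?case using w init_correct inv_cong by meson
next
  case (op s m f time space y)
  then have w: "100 \<le> w" by blast
  interpret word_ram w \<sigma> "capacity w" using word_ram_capacity[OF w assms(2,3)] .
  obtain h where "inv True s h (arrays_of m)" using op.IH by blast
  moreover have "length (apply_op f s) \<le> capacity w" using word_size_ok_capacity[OF op.hyps(3)] by simp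
  ultimately show ?case using op_correct op.hyps w by blast
qed

section \<open>Asymptotics and the final bounds\<close>

lemma bitlen_log: "2 \<le> n \<Longrightarrow> real (bitlen n) \<le> log 2 (real n) + 1"
proof -
  have *: "0 < n \<Longrightarrow> 2 ^ bitlen n \<le> 2 * n" for n
  proof (induction n rule: bitlen.induct)
    case (1 n)
    show ?case
    proof (cases "n div 2 = 0")
      case True
      then have "n = 1" using 1(2) by linarith
      then show ?thesis by (simp add: bitlen.simps)
    next
      case False
      then have "2 ^ bitlen (n div 2) \<le> 2 * (n div 2)" using 1 by simp
      then show ?thesis using 1(2) by (simp add: bitlen.simps[of n])
    qed
  qed
  assume n: "2 \<le> n"
  then have "2 ^ bitlen n \<le> 2 * n" using * by simp
  then have "2 powr real (bitlen n) \<le> 2 * real n"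
    by (simp add: powr_realpow) (metis of_nat_le_iff of_nat_mult of_nat_numeral of_nat_power)
  then have "real (bitlen n) \<le> log 2 (2 * real n)" using n by (simp add: le_log_iff)
  then show ?thesis using n by (simp add: log_mult)
qed

lemma bitlen_bigo: "(\<lambda>n. real (1000 * bitlen n + 1000)) \<in> O(\<lambda>n. log 2 (real n))"
proof (rule bigoI)
  show "\<forall>\<^sub>F n in sequentially. norm (real (1000 * bitlen n + 1000)) \<le> 3000 * norm (log 2 (real n))"
  proof (rule eventually_sequentiallyI[of 2])
    fix n :: nat assume n: "2 \<le> n"
    \<comment> \<open>Once the logarithm is at least 1, it absorbs the two additive constants: the
      bit length exceeds it by at most 1, which gives 3000.\<close>
    then have "1 \<le> log 2 (real n)" by simp
    then show "norm (real (1000 * bitlen n + 1000)) \<le> 3000 * norm (log 2 (real n))"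
      using bitlen_log[OF n] by simp
  qed
qed

theorem theorem6:
  shows "\<exists>(D :: eertree_impl) (K :: real) (T :: nat \<Rightarrow> nat) (S :: nat \<Rightarrow> nat) (C :: nat).
    (\<lambda>\<sigma>. real (T \<sigma>)) \<in> O(\<lambda>\<sigma>. log 2 (real \<sigma>)) \<and>
    (\<lambda>\<sigma>. real (S \<sigma>)) \<in> O(\<lambda>\<sigma>. log 2 (real \<sigma>)) \<and>
    (\<forall>\<sigma> w :: nat. 1 \<le> \<sigma> \<longrightarrow> \<sigma> < 2 ^ w \<longrightarrow>
       (word_size_ok K w 0 \<longrightarrow>
          runs_within w (init_code D) [\<sigma>] (\<lambda>_. 0) (T \<sigma>) (S \<sigma>)) \<and>
       (\<forall>s m. reachable D K \<sigma> w s m \<longrightarrow>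
          provides_eertree D \<sigma> w C (T \<sigma>) (S \<sigma>) s m \<and>
          (\<forall>c<\<sigma>. word_size_ok K w (length s + 1) \<longrightarrow>
             runs_within w (push_back_code D) [c] m (T \<sigma>) (S \<sigma>) \<and>
             runs_within w (push_front_code D) [c] m (T \<sigma>) (S \<sigma>)) \<and>
          (s \<noteq> [] \<longrightarrow>
             runs_within w (pop_back_code D) [] m C C \<and>
             runs_within w (pop_front_code D) [] m C C)))"
proof -
  \<comment> \<open>One function serves for time and space, since an instruction accesses at most
    one cell.\<close>
  let ?T = "\<lambda>\<sigma>. 1000 * bitlen \<sigma> + 1000"
  have init: "runs_within w (init_code eertree_programs) [\<sigma>] (\<lambda>_. 0) (?T \<sigma>) (?T \<sigma>)"
    if "word_size_ok 100 w 0" for w \<sigma>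
    using word_size_ok_100[OF that] init_ok init_cost[of 0]
    by (auto simp: eertree_programs_def intro!: runs_within_compile[where L = 0])
  have main: "provides_eertree eertree_programs \<sigma> w 1000 (?T \<sigma>) (?T \<sigma>) s m \<and>
      (\<forall>c<\<sigma>. word_size_ok 100 w (length s + 1) \<longrightarrow>
         runs_within w (push_back_code eertree_programs) [c] m (?T \<sigma>) (?T \<sigma>) \<and>
         runs_within w (push_front_code eertree_programs) [c] m (?T \<sigma>) (?T \<sigma>)) \<and>
      (s \<noteq> [] \<longrightarrow> runs_within w (pop_back_code eertree_programs) [] m 1000 1000 \<and>
         runs_within w (pop_front_code eertree_programs) [] m 1000 1000)"
    if "1 \<le> \<sigma>" "\<sigma> < 2 ^ w" "reachable eertree_programs 100 \<sigma> w s m" for \<sigma> w s m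
  proof -
    from reachable_inv[OF that(3,1,2)] have w: "100 \<le> w" by blast
    interpret word_ram w \<sigma> "capacity w" using word_ram_capacity[OF w that(1,2)] .
    from reachable_inv[OF that(3,1,2)] obtain h where inv: "inv True s h (arrays_of m)" by blast
    \<comment> \<open>Cell 15 is entry 0 of array 15, so every loop runs
      \<open>bitlen \<sigma>\<close> times.\<close>
    then have m15: "m 15 = \<sigma>" by (simp add: inv_def)
    have push: "runs_within w (compile (push d) 0) [c] m (?T \<sigma>) (?T \<sigma>)" for d c
      using push_ok[of d] push_cost[of "bitlen \<sigma>" d] m15
      by (intro runs_within_compile[where L = "bitlen \<sigma>"] w5) auto
    have pop: "runs_within w (compile (pop d) 0) [] m 1000 1000" for d
      using pop_ok[of d] pop_cost[of 0 d]
      by (intro runs_within_compile[where L = 0] w5) auto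
    show ?thesis
      using queries_correct[OF inv] push pop by (simp add: eertree_programs_def)
  qed
  show ?thesis
    using bitlen_bigo init main
    by (intro exI[of _ eertree_programs] exI[of _ "100 :: real"] exI[of _ ?T] exI[of _ "1000 :: nat"] conjI allI impI) blast+
qed

end
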